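(* There exist $C^\infty$ functions $\Phi$ and $G$ on the sphere $\mathbb{S}^2$ with the following properties. (1) The super-level set $\{\Phi>1\}$ has infinitely many connected components. (2) The function $G$ is positive, and defines a conformal metric $g_G=G\,g_0$ on $\mathbb{S}^2$ with associated Laplace-Beltrami operator $\Delta_G=G^{-1}\Delta_0$. (3) $-\Delta_G\Phi=2\,\Phi$. (4) The eigenvalue $2$ of $-\Delta_G$ has labelling at most $4$.
   Context: $g_0$ is the standard round metric on the unit sphere $\mathbb{S}^2\subset\mathbb{R}^3$ and $\Delta_0$ is its Laplace-Beltrami operator. The eigenvalues of $-\Delta_G$ are listed in nondecreasing order with multiplicities, starting from label $1$: $0=\lambda_1<\lambda_2\le\lambda_3\le\cdots$; the labelling of an eigenvalue $\lambda$ is the least $k$ with $\lambda_k=\lambda$. *)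

theory Defs
  imports "HOL-Analysis.Analysis" "HOL-Library.Function_Algebras"
begin

section \<open>Smooth functions\<close>

primrec Ck_on :: "nat \<Rightarrow> 'a::euclidean_space set \<Rightarrow> ('a \<Rightarrow> 'b::real_normed_vector) \<Rightarrow> bool" where
  "Ck_on 0 = (\<lambda>U f. continuous_on U f)"
| "Ck_on (Suc k) = (\<lambda>U f. (\<forall>x\<in>U. f differentiable (at x)) \<and>
     (\<forall>b\<in>Basis. Ck_on k U (\<lambda>x. frechet_derivative f (at x) b)))"

text \<open>Meant for open \<open>U\<close>, since the derivatives are two-sided.\<close>

definition smooth_on :: "'a::euclidean_space set \<Rightarrow> ('a \<Rightarrow> 'b::real_normed_vector) \<Rightarrow> bool" where
  "smooth_on U f \<longleftrightarrow> (\<forall>k. Ck_on k U f)"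

definition partial :: "'n::finite \<Rightarrow> (real ^ 'n \<Rightarrow> 'b::real_normed_vector) \<Rightarrow> real ^ 'n \<Rightarrow> 'b" where
  "partial i F u = frechet_derivative F (at u) (axis i 1)"


section \<open>The sphere and its stereographic atlas\<close>

text \<open>
  Functions on the sphere are represented by functions on the ambient space, of which only the
  values on the sphere matter. The differentiable structure is given by the two stereographic
  charts: for \<open>\<sigma> = 1\<close> (projection from the north pole) and \<open>\<sigma> = - 1\<close> (from the south pole),
  \<open>stereo \<sigma>\<close> parametrizes the sphere minus the pole \<open>(0, 0, \<sigma>)\<close> by the plane, and
  \<open>stereo_chart \<sigma>\<close> is the inverse map.
\<close>

definition S2 :: "(real ^ 3) set" where
  "S2 = sphere 0 1"

definition stereo :: "real \<Rightarrow> real ^ 2 \<Rightarrow> real ^ 3" where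
  "stereo \<sigma> u = (1 / (1 + (norm u)\<^sup>2)) *\<^sub>R vector [2 * u $ 1, 2 * u $ 2, \<sigma> * ((norm u)\<^sup>2 - 1)]"

definition stereo_chart :: "real \<Rightarrow> real ^ 3 \<Rightarrow> real ^ 2" where
  "stereo_chart \<sigma> x = (1 / (1 - \<sigma> * x $ 3)) *\<^sub>R vector [x $ 1, x $ 2]"

definition smooth_on_S2 :: "(real ^ 3 \<Rightarrow> real) \<Rightarrow> bool" where
  "smooth_on_S2 f \<longleftrightarrow> (\<forall>\<sigma>\<in>{1, -1}. smooth_on UNIV (f \<circ> stereo \<sigma>))"


section \<open>Riemannian metrics and the Laplace-Beltrami operator\<close>

definition tangent_space :: "real ^ 3 \<Rightarrow> (real ^ 3) set" where
  "tangent_space x = {v. v \<bullet> x = 0}"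

text \<open>A metric \<open>g\<close> assigns to \<open>x\<close> a form \<open>g x v w\<close>, which is relevant only for
  \<open>x \<in> S2\<close> and \<open>v, w \<in> tangent_space x\<close>.\<close>

type_synonym metric = "real ^ 3 \<Rightarrow> real ^ 3 \<Rightarrow> real ^ 3 \<Rightarrow> real"

definition metric_matrix :: "metric \<Rightarrow> real \<Rightarrow> real ^ 2 \<Rightarrow> real ^ 2 ^ 2" where
  "metric_matrix g \<sigma> u =
     (\<chi> i j. g (stereo \<sigma> u) (partial i (stereo \<sigma>) u) (partial j (stereo \<sigma>) u))"

definition riemannian_metric :: "metric \<Rightarrow> bool" where
  "riemannian_metric g \<longleftrightarrow>
     (\<forall>x\<in>S2. \<forall>v\<in>tangent_space x. \<forall>w\<in>tangent_space x.
        g x v w = g x w v \<and>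
        (\<forall>v'\<in>tangent_space x. \<forall>a b. g x (a *\<^sub>R v + b *\<^sub>R v') w = a * g x v w + b * g x v' w) \<and>
        (v \<noteq> 0 \<longrightarrow> g x v v > 0)) \<and>
     (\<forall>\<sigma>\<in>{1, -1}. \<forall>i j. smooth_on UNIV (\<lambda>u. metric_matrix g \<sigma> u $ i $ j))"

definition round_metric :: metric where
  "round_metric x v w = v \<bullet> w"

definition conformal_metric :: "(real ^ 3 \<Rightarrow> real) \<Rightarrow> metric" where
  "conformal_metric G x v w = G x * round_metric x v w"

text \<open>The coordinate expression
  \<open>|g|\<^sup>-\<^sup>1\<^sup>/\<^sup>2 \<Sum>\<^sub>i \<partial>\<^sub>i (|g|\<^sup>1\<^sup>/\<^sup>2 \<Sum>\<^sub>j g\<^sup>i\<^sup>j \<partial>\<^sub>j f)\<close> of \<open>div\<^sub>g grad\<^sub>g f\<close> in the chart given by \<open>\<sigma>\<close>.\<close>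

definition laplace_in_chart :: "metric \<Rightarrow> real \<Rightarrow> (real ^ 3 \<Rightarrow> real) \<Rightarrow> real ^ 2 \<Rightarrow> real" where
  "laplace_in_chart g \<sigma> f u =
     (1 / sqrt (det (metric_matrix g \<sigma> u))) *
     (\<Sum>i\<in>UNIV. partial i (\<lambda>z. sqrt (det (metric_matrix g \<sigma> z)) *
        (\<Sum>j\<in>UNIV. matrix_inv (metric_matrix g \<sigma> z) $ i $ j * partial j (f \<circ> stereo \<sigma>) z)) u)"

text \<open>The expression does not depend on the chart; we use projection from the north pole
  everywhere except at the north pole itself.\<close>

definition laplace_beltrami :: "metric \<Rightarrow> (real ^ 3 \<Rightarrow> real) \<Rightarrow> real ^ 3 \<Rightarrow> real" where
  "laplace_beltrami g f x =
     (let \<sigma> = (if x = vector [0, 0, 1] then - 1 else 1)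
      in laplace_in_chart g \<sigma> f (stereo_chart \<sigma> x))"


section \<open>Eigenvalues\<close>

global_interpretation fun_space: vector_space "\<lambda>(c::real) (f::real ^ 3 \<Rightarrow> real) x. c * f x"
  by unfold_locales (auto simp: fun_eq_iff algebra_simps)

text \<open>Requiring \<open>f = 0\<close> off the sphere makes the representation of a function on the sphere
  unique, so that dimensions of spaces of such functions are the right ones.\<close>

definition eigenspace :: "metric \<Rightarrow> real \<Rightarrow> (real ^ 3 \<Rightarrow> real) set" where
  "eigenspace g \<mu> = {f. smooth_on_S2 f \<and> (\<forall>x. x \<notin> S2 \<longrightarrow> f x = 0) \<and>
     (\<forall>x\<in>S2. - laplace_beltrami g f x = \<mu> * f x)}"

definition is_eigenvalue :: "metric \<Rightarrow> real \<Rightarrow> bool" where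
  "is_eigenvalue g \<mu> \<longleftrightarrow> (\<exists>f\<in>eigenspace g \<mu>. f \<noteq> 0)"

definition multiplicity :: "metric \<Rightarrow> real \<Rightarrow> nat" where
  "multiplicity g \<mu> = fun_space.dim (eigenspace g \<mu>)"

text \<open>
  \<open>eigenvalue g k\<close> is the \<open>k\<close>-th entry, for \<open>k \<ge> 1\<close>, of the list of the eigenvalues of
  \<open>- \<Delta>\<^sub>g\<close> in nondecreasing order with multiplicities: the least \<open>\<mu>\<close> such that at least \<open>k\<close>
  eigenvalues, counted with multiplicity, are at most \<open>\<mu>\<close>. The lemma \<open>eigenvalue_eq_listing\<close>
  below confirms that it agrees with any such list.
\<close>

definition eigenvalue_count :: "metric \<Rightarrow> real \<Rightarrow> nat" where
  "eigenvalue_count g \<mu> = (\<Sum>\<nu> | is_eigenvalue g \<nu> \<and> \<nu> \<le> \<mu>. multiplicity g \<nu>)"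

definition eigenvalue :: "metric \<Rightarrow> nat \<Rightarrow> real" where
  "eigenvalue g k = (LEAST \<mu>. k \<le> eigenvalue_count g \<mu>)"

definition labelling :: "metric \<Rightarrow> real \<Rightarrow> nat" where
  "labelling g \<mu> = (LEAST k. 1 \<le> k \<and> eigenvalue g k = \<mu>)"

lemma eigenvalue_eq_listing:
  fixes l :: "nat \<Rightarrow> real"
  assumes mono: "\<And>i j. 1 \<le> i \<Longrightarrow> i \<le> j \<Longrightarrow> l i \<le> l j"
    and ev: "\<And>\<mu>. is_eigenvalue g \<mu> \<longleftrightarrow> (\<exists>k\<ge>1. l k = \<mu>)"
    and fin: "\<And>\<mu>. finite {k. 1 \<le> k \<and> l k = \<mu>}"
    and mult: "\<And>\<mu>. card {k. 1 \<le> k \<and> l k = \<mu>} = multiplicity g \<mu>"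
    and k: "1 \<le> k"
  shows "eigenvalue g k = l k"
proof -
  have count: "eigenvalue_count g \<mu> = card {j. 1 \<le> j \<and> l j \<le> \<mu>}"
    if F: "finite {j. 1 \<le> j \<and> l j \<le> \<mu>}" for \<mu>
  proof -
    let ?J = "{j. 1 \<le> j \<and> l j \<le> \<mu>}"
    have im: "{\<nu>. is_eigenvalue g \<nu> \<and> \<nu> \<le> \<mu>} = l ` ?J"
      by (auto simp: ev)
    have "card ?J = card (\<Union>\<nu>\<in>l ` ?J. {j. 1 \<le> j \<and> l j = \<nu>})"
      by (rule arg_cong[where f = card]) auto
    also have "\<dots> = (\<Sum>\<nu>\<in>l ` ?J. card {j. 1 \<le> j \<and> l j = \<nu>})"
      using F fin by (intro card_UN_disjoint) auto
    finally show ?thesis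
      unfolding eigenvalue_count_def im mult by simp
  qed
  have sub: "{j. 1 \<le> j \<and> l j \<le> l k} \<subseteq> {..k} \<union> {j. 1 \<le> j \<and> l j = l k}"
  proof
    fix j assume "j \<in> {j. 1 \<le> j \<and> l j \<le> l k}"
    then show "j \<in> {..k} \<union> {j. 1 \<le> j \<and> l j = l k}"
      using mono[OF k, of j] by (cases "j \<le> k") auto
  qed
  have fk: "finite {j. 1 \<le> j \<and> l j \<le> l k}"
    by (rule finite_subset[OF sub]) (use fin in auto)
  show ?thesis
    unfolding eigenvalue_def
  proof (rule Least_equality)
    have "k = card {1..k}" by simp
    also have "\<dots> \<le> card {j. 1 \<le> j \<and> l j \<le> l k}"
      by (rule card_mono[OF fk]) (use mono in auto)
    finally show "k \<le> eigenvalue_count g (l k)"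
      using count[OF fk] by simp
  next
    fix \<mu> assume le: "k \<le> eigenvalue_count g \<mu>"
    show "l k \<le> \<mu>"
    proof (rule ccontr)
      assume "\<not> l k \<le> \<mu>"
      then have "j < k" if "l j \<le> \<mu>" for j
        using mono[OF k, of j] that by (cases "j < k") auto
      then have sub': "{j. 1 \<le> j \<and> l j \<le> \<mu>} \<subseteq> {1..<k}"
        by auto
      have "finite {j. 1 \<le> j \<and> l j \<le> \<mu>}"
        using sub' by (rule finite_subset) simp
      moreover have "card {j. 1 \<le> j \<and> l j \<le> \<mu>} \<le> card {1..<k}"
        using sub' by (intro card_mono) simp_all
      ultimately show False using le count[of \<mu>] k by simp
    qed
  qed
qed

end

theory Submission
  imports Defs
begin

text \<open>
  Let \<open>z = x $ 3\<close> be the height on the sphere and \<open>\<Delta>\<^sub>0\<close> the round Laplacian. The starting point is a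
  rotationally symmetric model (the functions \<open>prof_u\<close> and \<open>prof_g\<close>): explicit rational functions of
  \<open>z\<^sup>2\<close> with \<open>- \<Delta>\<^sub>0 u = g u\<close>, where \<open>g\<close> is positive, \<open>u\<close> is \<open>1\<close> on the whole equator, less
  than \<open>1\<close> elsewhere, and changes sign once in each hemisphere. Having its maximum along a curve, \<open>u\<close>
  can be made to exceed \<open>1\<close> on any open part of the equator by an arbitrarily small perturbation.
  Take \<open>\<Phi> = u + \<epsilon> u\<^sup>3 h\<close>, where \<open>h\<close> is a smooth function of \<open>x $ 1\<close> that changes sign infinitely often
  near \<open>0\<close>. Since \<open>u \<le> 1\<close>, the set \<open>{\<Phi> > 1}\<close> lies in \<open>{h > 0}\<close>, and it contains the
  points of the equator where \<open>h > 0\<close>; the bands where \<open>h < 0\<close> separate infinitely many of these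
  points (\<open>infinite_components\<close>).

  The factor \<open>u\<^sup>3\<close> keeps the equation divisible by \<open>u\<close>: \<open>- \<Delta>\<^sub>0 \<Phi> = u (g + \<epsilon> r)\<close> with a smooth \<open>r\<close>
  (\<open>laplace_Phi\<close>), while \<open>\<Phi> = u (1 + \<epsilon> u\<^sup>2 h)\<close>. Hence \<open>G = (g + \<epsilon> r) / (2 (1 + \<epsilon> u\<^sup>2 h))\<close> is smooth
  across the nodal lines, satisfies \<open>- \<Delta>\<^sub>0 \<Phi> = 2 G \<Phi>\<close>, and for small \<open>\<epsilon>\<close> it is positive with
  \<open>2 G < (21/20) g\<close> (\<open>perturbation_bounds\<close>).

  It remains to count eigenvalues. Eigenfunctions of \<open>- \<Delta>\<^sub>G\<close> with different eigenvalues are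
  orthogonal for the weight \<open>G\<close> (\<open>E_orthogonal\<close>), so on a sum \<open>f\<close> of eigenfunctions with eigenvalues at
  most \<open>2\<close> the Dirichlet energy is at most \<open>2 \<integral> G f\<^sup>2\<close>. If five of them were independent, a nonzero
  combination \<open>f\<close> would satisfy four prescribed linear conditions. Under suitable conditions, however,
  the energy is at least \<open>(21/20) \<integral> g f\<^sup>2 > 2 \<integral> G f\<^sup>2\<close> (\<open>low_combination_vanishes\<close>), a contradiction.
  So at most four eigenvalues, counted with multiplicity, are at most \<open>2\<close>.

  The conditions are that the mean of \<open>f\<close> over a circle of latitude vanishes for the four latitudes with
  \<open>u = \<plusminus> 1/8\<close>. On the cylinder with coordinate \<open>t\<close>, \<open>d/dt = (1 - z\<^sup>2) d/dz\<close>, the energy is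
  \<open>\<integral> f\<^sub>t\<^sup>2 + f\<^sub>\<theta>\<^sup>2\<close> and the weight \<open>g\<close> becomes \<open>V = (1 - z\<^sup>2) g\<close>. The model is long and thin:
  \<open>(21/20) V \<le> 1\<close>. Therefore Wirtinger's inequality on each circle of latitude disposes of \<open>f\<close> minus its
  means (\<open>spectral_lower_bound\<close>), and the means are left, a one-dimensional problem. There \<open>u\<close> solves
  \<open>u\<^sub>t\<^sub>t + V u = 0\<close>, and the functions \<open>u - 1/10\<close>, \<open>1 - u\<^sup>2\<close> and \<open>- u - 1/10\<close> are positive
  supersolutions, even for \<open>(21/20) V\<close>, on the zones \<open>u \<ge> 1/8\<close>, \<open>\<bar>u\<bar> \<le> 1/8\<close> and \<open>u \<le> - 1/8\<close>. Such a
  function gives the inequality on its zone, because the means vanish at the ends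
  (\<open>riccati_inequality\<close>, \<open>mean_inequality\<close>).
\<close>

section \<open>One-dimensional integral inequalities\<close>

lemma integral_le_integral_interior:
  fixes f g :: "real \<Rightarrow> real"
  assumes "f integrable_on {a..b}" "g integrable_on {a..b}" "\<And>x. x \<in> {a<..<b} \<Longrightarrow> f x \<le> g x"
  shows "integral {a..b} f \<le> integral {a..b} g"
  using assms has_integral_le[of f "integral {a..b} f" "{a<..<b}" g "integral {a..b} g"]
  by (simp add: has_integral_Icc_iff_Ioo[symmetric] integrable_integral)

text \<open>Completing the square in \<open>v'\<close> shows \<open>p v'\<^sup>2 - (Q v\<^sup>2)' \<ge> r v\<^sup>2\<close> pointwise; integration removes
  \<open>(Q v\<^sup>2)'\<close>. A positive supersolution \<open>\<psi>\<close> of \<open>(p \<psi>')' + r \<psi> = 0\<close> provides \<open>Q = p \<psi>' / \<psi>\<close>. Only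
  the product \<open>Q v\<^sup>2\<close> has to vanish at the ends, so \<open>v\<close> may be free where \<open>Q\<close> is zero.\<close>

lemma riccati_inequality:
  fixes p Q Q' r v v' :: "real \<Rightarrow> real"
  assumes "a \<le> b"
    and p: "\<And>x. x \<in> {a<..<b} \<Longrightarrow> p x > 0"
    and Q: "\<And>x. x \<in> {a<..<b} \<Longrightarrow> (Q has_real_derivative Q' x) (at x)"
    and v: "\<And>x. x \<in> {a<..<b} \<Longrightarrow> (v has_real_derivative v' x) (at x)"
    and riccati: "\<And>x. x \<in> {a<..<b} \<Longrightarrow> Q' x + (Q x)\<^sup>2 / p x + r x \<le> 0"
    and cont: "continuous_on {a..b} Q" "continuous_on {a..b} v"
      "continuous_on {a..b} (\<lambda>x. p x * (v' x)\<^sup>2)" "continuous_on {a..b} (\<lambda>x. r x * (v x)\<^sup>2)"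
    and bdry: "Q a * (v a)\<^sup>2 = 0" "Q b * (v b)\<^sup>2 = 0"
  shows "integral {a..b} (\<lambda>x. r x * (v x)\<^sup>2) \<le> integral {a..b} (\<lambda>x. p x * (v' x)\<^sup>2)"
proof -
  let ?W = "\<lambda>x. Q' x * (v x)\<^sup>2 + 2 * Q x * v x * v' x"
  have W: "(?W has_integral 0) {a..b}"
  proof -
    have "(?W has_integral (Q b * (v b)\<^sup>2 - Q a * (v a)\<^sup>2)) {a..b}"
    proof (rule fundamental_theorem_of_calculus_interior[OF \<open>a \<le> b\<close>])
      show "continuous_on {a..b} (\<lambda>x. Q x * (v x)\<^sup>2)"
        by (intro continuous_intros cont)
      fix x assume "x \<in> {a<..<b}"
      note [derivative_intros] = Q[OF this] v[OF this]
      show "((\<lambda>x. Q x * (v x)\<^sup>2) has_vector_derivative ?W x) (at x)"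
        unfolding has_real_derivative_iff_has_vector_derivative[symmetric]
        by (auto intro!: derivative_eq_intros)
    qed
    then show ?thesis using bdry by simp
  qed
  have int: "(\<lambda>x. p x * (v' x)\<^sup>2) integrable_on {a..b}" "(\<lambda>x. r x * (v x)\<^sup>2) integrable_on {a..b}"
    by (intro integrable_continuous_real cont)+
  have le: "integral {a..b} (\<lambda>x. r x * (v x)\<^sup>2) \<le> integral {a..b} (\<lambda>x. p x * (v' x)\<^sup>2 - ?W x)"
  proof (rule integral_le_integral_interior[OF int(2)])
    show "(\<lambda>x. p x * (v' x)\<^sup>2 - ?W x) integrable_on {a..b}"
      using int W by (intro integrable_diff) auto
    fix x assume x: "x \<in> {a<..<b}"
    have "0 \<le> p x * (v' x - Q x / p x * v x)\<^sup>2"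
      using p[OF x] by simp
    also have "\<dots> = p x * (v' x)\<^sup>2 - 2 * Q x * v x * v' x + (Q x)\<^sup>2 / p x * (v x)\<^sup>2"
      using p[OF x] by (simp add: power2_eq_square field_simps)
    finally have 1: "0 \<le> p x * (v' x)\<^sup>2 - 2 * Q x * v x * v' x + (Q x)\<^sup>2 / p x * (v x)\<^sup>2" .
    have "(Q' x + (Q x)\<^sup>2 / p x + r x) * (v x)\<^sup>2 \<le> 0"
      using riccati[OF x] by (simp add: mult_nonpos_nonneg)
    with 1 show "r x * (v x)\<^sup>2 \<le> p x * (v' x)\<^sup>2 - ?W x"
      by (simp add: algebra_simps)
  qed
  also have "\<dots> = integral {a..b} (\<lambda>x. p x * (v' x)\<^sup>2) - integral {a..b} ?W"
    using int W by (intro integral_diff) auto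
  finally show ?thesis using W by (simp add: integral_unique)
qed

text \<open>For \<open>k < 1\<close> the function \<open>cos (k (x - a - \<pi>/2))\<close> is positive on the closed interval, so its
  logarithmic derivative serves as \<open>Q\<close> and gives the inequality with the constant \<open>k\<^sup>2\<close>. Letting \<open>k\<close>
  tend to \<open>1\<close> avoids the singularities that appear for \<open>k = 1\<close>.\<close>

lemma wirtinger_dirichlet:
  fixes v v' :: "real \<Rightarrow> real"
  assumes v: "\<And>x. (v has_real_derivative v' x) (at x)" and v': "continuous_on UNIV v'"
    and zero: "v a = 0" "v (a + pi) = 0"
  shows "integral {a..a+pi} (\<lambda>x. (v x)\<^sup>2) \<le> integral {a..a+pi} (\<lambda>x. (v' x)\<^sup>2)"
proof -
  have cv: "continuous_on A v" for A
    using v by (meson DERIV_isCont continuous_at_imp_continuous_on)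
  have cv': "continuous_on A v'" for A
    using v' continuous_on_subset by blast
  have step: "k\<^sup>2 * integral {a..a+pi} (\<lambda>x. (v x)\<^sup>2) \<le> integral {a..a+pi} (\<lambda>x. (v' x)\<^sup>2)"
    if k: "0 < k" "k < 1" for k
  proof -
    let ?y = "\<lambda>x. k * (x - (a + pi/2))"
    have cos: "cos (?y x) > 0" if "x \<in> {a..a+pi}" for x
    proof (rule cos_gt_zero_pi)
      have "\<bar>x - (a + pi/2)\<bar> \<le> pi/2" using that by (simp add: abs_le_iff field_simps)
      then have "\<bar>?y x\<bar> \<le> k * (pi/2)"
        using k by (simp add: abs_mult)
      also have "\<dots> < 1 * (pi/2)" using k by (intro mult_strict_right_mono) auto
      finally show "- (pi/2) < ?y x" "?y x < pi/2" by linarith+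
    qed
    have "integral {a..a+pi} (\<lambda>x. k\<^sup>2 * (v x)\<^sup>2) \<le> integral {a..a+pi} (\<lambda>x. 1 * (v' x)\<^sup>2)"
    proof (rule riccati_inequality[where p = "\<lambda>_. 1" and r = "\<lambda>_. k\<^sup>2" and v = v and v' = v'
            and Q = "\<lambda>x. - k * tan (?y x)" and Q' = "\<lambda>x. - k\<^sup>2 * inverse ((cos (?y x))\<^sup>2)"])
      show "((\<lambda>x. - k * tan (?y x)) has_real_derivative - k\<^sup>2 * inverse ((cos (?y x))\<^sup>2)) (at x)"
        if "x \<in> {a<..<a+pi}" for x
        using cos[of x] that
        by (auto intro!: derivative_eq_intros simp: power2_eq_square)
      show "- k\<^sup>2 * inverse ((cos (?y x))\<^sup>2) + (- k * tan (?y x))\<^sup>2 / 1 + k\<^sup>2 \<le> 0"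
        if "x \<in> {a<..<a+pi}" for x
      proof -
        have "inverse ((cos (?y x))\<^sup>2) = 1 + (tan (?y x))\<^sup>2"
          using tan_sec[of "?y x"] cos[of x] that by (simp add: power_inverse)
        then show ?thesis
          by (simp only:) (simp add: power_mult_distrib algebra_simps)
      qed
      show "continuous_on {a..a+pi} (\<lambda>x. - k * tan (?y x))"
        using cos by (intro continuous_intros) force
    qed (use zero v in \<open>auto intro!: continuous_intros cv cv' simp: algebra_simps power2_eq_square\<close>)
    then show ?thesis by simp
  qed
  have lim: "((\<lambda>k. k\<^sup>2 * integral {a..a+pi} (\<lambda>x. (v x)\<^sup>2)) \<longlongrightarrow> 1\<^sup>2 * integral {a..a+pi} (\<lambda>x. (v x)\<^sup>2)) (at_left 1)"
    by (intro tendsto_intros)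
  have "eventually (\<lambda>k. k\<^sup>2 * integral {a..a+pi} (\<lambda>x. (v x)\<^sup>2) \<le> integral {a..a+pi} (\<lambda>x. (v' x)\<^sup>2)) (at_left (1::real))"
    unfolding eventually_at_left_field using step by (intro exI[of _ 0]) auto
  from tendsto_upperbound[OF lim this] show ?thesis by simp
qed

lemma integral_periodic:
  fixes f :: "real \<Rightarrow> real"
  assumes f: "continuous_on UNIV f" and per: "\<And>x. f (x + c) = f x" and "0 \<le> d" "d \<le> c"
  shows "integral {d..d+c} f = integral {0..c} f"
proof -
  have int: "f integrable_on {a..b}" for a b
    using f continuous_on_subset by (blast intro: integrable_continuous_real)
  have "integral {c..d+c} f = integral {0..d} f"
    using has_integral_affinity'[OF integrable_integral[OF int[of c "d + c"], folded box_real], of 1 c] per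
    by (simp add: integral_unique)
  moreover have "integral {d..c} f + integral {c..d+c} f = integral {d..d+c} f"
    "integral {0..d} f + integral {d..c} f = integral {0..c} f"
    using assms by (intro Henstock_Kurzweil_Integration.integral_combine int; simp)+
  ultimately show ?thesis by simp
qed

text \<open>The continuous function \<open>v x - v (x + \<pi>)\<close> changes sign on a half period, so \<open>v\<close> takes the same
  value \<open>c\<close> at two points at distance \<open>\<pi>\<close>. The Dirichlet inequality for \<open>v - c\<close> on both halves gives
  the claim with \<open>c\<close> in place of the mean, and the mean minimizes the left side.\<close>

lemma wirtinger_periodic:
  fixes v v' :: "real \<Rightarrow> real"
  assumes v: "\<And>x. (v has_real_derivative v' x) (at x)" and v': "continuous_on UNIV v'"
    and per: "\<And>x. v (x + 2 * pi) = v x"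
    and m: "m = integral {0..2*pi} v / (2 * pi)"
  shows "integral {0..2*pi} (\<lambda>x. (v x - m)\<^sup>2) \<le> integral {0..2*pi} (\<lambda>x. (v' x)\<^sup>2)"
proof -
  have cv: "continuous_on A v" for A
    using v by (meson DERIV_isCont continuous_at_imp_continuous_on)
  have cv': "continuous_on A v'" for A
    using v' continuous_on_subset by blast
  have "\<exists>x\<ge>0. x \<le> pi \<and> v x - v (x + pi) = 0"
  proof -
    have c: "continuous_on {0..pi} (\<lambda>x. v x - v (x + pi))"
      by (intro continuous_intros continuous_on_compose2[OF cv[of UNIV]]) auto
    have "v (pi + pi) = v 0" using per[of 0] by (metis add_0 mult_2)
    show ?thesis
    proof (cases "v 0 \<le> v pi")
      case True
      then show ?thesis
        using IVT'[of "\<lambda>x. v x - v (x + pi)" 0 0 pi, OF _ _ _ c] \<open>v (pi + pi) = v 0\<close> by auto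
    next
      case False
      then show ?thesis
        using IVT2'[of "\<lambda>x. v x - v (x + pi)" pi 0 0, OF _ _ _ c] \<open>v (pi + pi) = v 0\<close> by auto
    qed
  qed
  then obtain a where a: "0 \<le> a" "a \<le> pi" "v (a + pi) = v a" by auto
  define c where "c = v a"
  have per': "v' (x + 2 * pi) = v' x" for x
  proof -
    have "((\<lambda>x. v (x + 2 * pi)) has_real_derivative v' (x + 2*pi)) (at x)"
      using v[of "x + 2 * pi"] by (simp only: DERIV_shift)
    then show ?thesis using v[of x] unfolding per by (rule DERIV_unique)
  qed
  have dv: "((\<lambda>x. v x - c) has_real_derivative v' x) (at x)" for x
    by (auto intro!: derivative_eq_intros v)
  have [simp]: "v (a + pi + pi) = v a" "v (2 * pi + a) = v a"
    using per[of a] by (metis add.assoc mult_2, metis add.commute)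
  have D1: "integral {a..a+pi} (\<lambda>x. (v x - c)\<^sup>2) \<le> integral {a..a+pi} (\<lambda>x. (v' x)\<^sup>2)"
    by (rule wirtinger_dirichlet[OF dv v']) (simp_all add: c_def a)
  have D2: "integral {a+pi..a+pi+pi} (\<lambda>x. (v x - c)\<^sup>2) \<le> integral {a+pi..a+pi+pi} (\<lambda>x. (v' x)\<^sup>2)"
    by (rule wirtinger_dirichlet[OF dv v']) (simp_all add: c_def a)
  have comb: "integral {a..a+pi} f + integral {a+pi..a+pi+pi} f = integral {0..2*pi} f"
    if "continuous_on UNIV f" "\<And>x. f (x + 2*pi) = f x" for f :: "real \<Rightarrow> real"
  proof -
    have "integral {a..a+pi} f + integral {a+pi..a+pi+pi} f = integral {a..a+2*pi} f"
      using Henstock_Kurzweil_Integration.integral_combine[of a "a+pi" "a+2*pi" f]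
        continuous_on_subset[OF that(1)] integrable_continuous_real by (auto simp: algebra_simps)
    also have "\<dots> = integral {0..2*pi} f"
      using a that by (intro integral_periodic) auto
    finally show ?thesis .
  qed
  have "integral {0..2*pi} (\<lambda>x. (v x - c)\<^sup>2) \<le> integral {0..2*pi} (\<lambda>x. (v' x)\<^sup>2)"
    using D1 D2 comb[of "\<lambda>x. (v x - c)\<^sup>2"] comb[of "\<lambda>x. (v' x)\<^sup>2"] per per'
    by (auto simp: continuous_intros cv cv')
  moreover have "integral {0..2*pi} (\<lambda>x. (v x - m)\<^sup>2) \<le> integral {0..2*pi} (\<lambda>x. (v x - c)\<^sup>2)"
  proof -
    have "integral {0..2*pi} (\<lambda>x. (v x - c)\<^sup>2)
        = integral {0..2*pi} (\<lambda>x. (v x - m)\<^sup>2 + (2 * (m - c) * v x + (c\<^sup>2 - m\<^sup>2)))"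
      by (rule integral_cong) (simp add: power2_eq_square algebra_simps)
    also have "\<dots> = integral {0..2*pi} (\<lambda>x. (v x - m)\<^sup>2) + (integral {0..2*pi} (\<lambda>x. 2 * (m - c) * v x)
        + integral {0..2*pi} (\<lambda>x. c\<^sup>2 - m\<^sup>2))"
      by (simp add: integral_add integrable_continuous_real continuous_intros cv)
    also have "\<dots> = integral {0..2*pi} (\<lambda>x. (v x - m)\<^sup>2) + 2 * pi * (m - c)\<^sup>2"
    proof -
      have "integral {0..2*pi} (\<lambda>x. 2 * (m - c) * v x) = 2 * (m - c) * integral {0..2*pi} v"
        by (rule integral_mult_right)
      then show ?thesis using m by (simp only:) (simp add: power2_eq_square field_simps)
    qed
    finally show ?thesis by simp
  qed
  ultimately show ?thesis by linarith
qed

section \<open>Smooth functions\<close>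

lemma frechet_derivative_eqI: "(f has_derivative f') (at x) \<Longrightarrow> frechet_derivative f (at x) = f'"
  using frechet_derivative_at by metis

lemma partial_eqI: "(f has_derivative f') (at u) \<Longrightarrow> partial i f u = f' (axis i 1)"
  by (simp add: partial_def frechet_derivative_eqI)

lemma Ck_on_SucI:
  assumes "\<And>x. (f has_derivative f' x) (at x)" "\<And>b. b \<in> Basis \<Longrightarrow> Ck_on k UNIV (\<lambda>x. f' x b)"
  shows "Ck_on (Suc k) UNIV f"
proof -
  have "frechet_derivative f (at x) = f' x" for x
    using assms(1) by (rule frechet_derivative_eqI)
  with assms show ?thesis by (auto simp: differentiable_def)
qed

text \<open>Replaces the derivative chosen by \<open>frechet_derivative\<close> by an arbitrary derivative; together with
  \<open>Ck_on_SucI\<close> it lets derivatives be computed with the usual rules.\<close>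

lemma Ck_on_SucE:
  assumes "Ck_on (Suc k) UNIV f"
  obtains f' where "\<And>x. (f has_derivative f' x) (at x)" "\<And>b. b \<in> Basis \<Longrightarrow> Ck_on k UNIV (\<lambda>x. f' x b)"
  using assms that[of "\<lambda>x. frechet_derivative f (at x)"] by (simp add: frechet_derivative_works)

lemma Ck_on_Suc_imp_Ck_on: "Ck_on (Suc k) UNIV f \<Longrightarrow> Ck_on k UNIV f"
proof (induction k arbitrary: f)
  case 0
  then show ?case
    by (auto simp: continuous_on_eq_continuous_at intro: differentiable_imp_continuous_within)
next
  case (Suc k)
  then show ?case by (simp del: Ck_on.simps add: Ck_on.simps(2)[of "Suc k"] Ck_on.simps(2)[of k])
qed

lemma Ck_on_const: "Ck_on k UNIV (\<lambda>x. c)"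
proof (induction k arbitrary: c)
  case (Suc k)
  show ?case by (rule Ck_on_SucI[where f' = "\<lambda>x b. 0"]) (auto simp: Suc)
qed simp

lemma Ck_on_bounded_linear: "bounded_linear f \<Longrightarrow> Ck_on k UNIV f"
proof (cases k)
  case 0
  then show "bounded_linear f \<Longrightarrow> ?thesis" by (simp add: linear_continuous_on)
next
  case (Suc n)
  then show "bounded_linear f \<Longrightarrow> ?thesis"
    by (auto intro!: Ck_on_SucI[where f' = "\<lambda>x. f"] Ck_on_const bounded_linear_imp_has_derivative
        simp del: Ck_on.simps)
qed

lemma Ck_on_add: "Ck_on k UNIV f \<Longrightarrow> Ck_on k UNIV g \<Longrightarrow> Ck_on k UNIV (\<lambda>x. f x + g x)"
proof (induction k arbitrary: f g)
  case 0
  then show ?case by (simp add: continuous_on_add)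
next
  case (Suc k)
  obtain f' where f': "\<And>x. (f has_derivative f' x) (at x)" "\<And>b. b \<in> Basis \<Longrightarrow> Ck_on k UNIV (\<lambda>x. f' x b)"
    using Suc.prems(1) by (rule Ck_on_SucE) blast
  obtain g' where g': "\<And>x. (g has_derivative g' x) (at x)" "\<And>b. b \<in> Basis \<Longrightarrow> Ck_on k UNIV (\<lambda>x. g' x b)"
    using Suc.prems(2) by (rule Ck_on_SucE) blast
  show ?case
    by (rule Ck_on_SucI[where f' = "\<lambda>x b. f' x b + g' x b"])
      (auto intro!: derivative_eq_intros f'(1) g'(1) Suc.IH f'(2) g'(2))
qed

lemma Ck_on_mult:
  fixes f g :: "'a::euclidean_space \<Rightarrow> real"
  shows "Ck_on k UNIV f \<Longrightarrow> Ck_on k UNIV g \<Longrightarrow> Ck_on k UNIV (\<lambda>x. f x * g x)"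
proof (induction k arbitrary: f g)
  case 0
  then show ?case by (simp add: continuous_on_mult)
next
  case (Suc k)
  obtain f' where f': "\<And>x. (f has_derivative f' x) (at x)" "\<And>b. b \<in> Basis \<Longrightarrow> Ck_on k UNIV (\<lambda>x. f' x b)"
    using Suc.prems(1) by (rule Ck_on_SucE) blast
  obtain g' where g': "\<And>x. (g has_derivative g' x) (at x)" "\<And>b. b \<in> Basis \<Longrightarrow> Ck_on k UNIV (\<lambda>x. g' x b)"
    using Suc.prems(2) by (rule Ck_on_SucE) blast
  note low = Suc.prems[THEN Ck_on_Suc_imp_Ck_on]
  show ?case
    by (rule Ck_on_SucI[where f' = "\<lambda>x b. f x * g' x b + f' x b * g x"])
      (auto intro!: derivative_eq_intros f'(1) g'(1) Suc.IH Ck_on_add f'(2) g'(2) low)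
qed

lemma Ck_on_minus:
  fixes f :: "'a::euclidean_space \<Rightarrow> real"
  shows "Ck_on k UNIV f \<Longrightarrow> Ck_on k UNIV (\<lambda>x. - f x)"
  using Ck_on_mult[OF Ck_on_const[of k "- 1"]] by simp

lemma Ck_on_inverse:
  fixes f :: "'a::euclidean_space \<Rightarrow> real"
  shows "Ck_on k UNIV f \<Longrightarrow> (\<And>x. f x \<noteq> 0) \<Longrightarrow> Ck_on k UNIV (\<lambda>x. inverse (f x))"
proof (induction k arbitrary: f)
  case 0
  then show ?case by (simp add: continuous_on_inverse)
next
  case (Suc k)
  obtain f' where f': "\<And>x. (f has_derivative f' x) (at x)" "\<And>b. b \<in> Basis \<Longrightarrow> Ck_on k UNIV (\<lambda>x. f' x b)"
    using Suc.prems(1) by (rule Ck_on_SucE) blast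
  note low = Suc.prems(1)[THEN Ck_on_Suc_imp_Ck_on]
  have inv: "Ck_on k UNIV (\<lambda>x. inverse (f x))" by (rule Suc.IH[OF low Suc.prems(2)])
  show ?case
    by (rule Ck_on_SucI[where f' = "\<lambda>x b. - (inverse (f x) * f' x b * inverse (f x))"])
      (auto intro!: derivative_eq_intros f'(1) Ck_on_minus Ck_on_mult f'(2) inv Suc.prems(2))
qed

lemma Ck_on_compose_real:
  fixes h :: "real \<Rightarrow> real" and f :: "'a::euclidean_space \<Rightarrow> real"
  shows "Ck_on k UNIV h \<Longrightarrow> Ck_on k UNIV f \<Longrightarrow> Ck_on k UNIV (\<lambda>x. h (f x))"
proof (induction k arbitrary: h f)
  case 0
  then show ?case by (auto intro: continuous_on_compose2)
next
  case (Suc k)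
  obtain h' where h': "\<And>x. (h has_derivative h' x) (at x)" "\<And>b. b \<in> Basis \<Longrightarrow> Ck_on k UNIV (\<lambda>x. h' x b)"
    using Suc.prems(1) by (rule Ck_on_SucE) blast
  obtain f' where f': "\<And>x. (f has_derivative f' x) (at x)" "\<And>b. b \<in> Basis \<Longrightarrow> Ck_on k UNIV (\<lambda>x. f' x b)"
    using Suc.prems(2) by (rule Ck_on_SucE) blast
  note low = Suc.prems(2)[THEN Ck_on_Suc_imp_Ck_on]
  have lin: "h' y b = b * h' y 1" for y b
    using linear_scale[OF has_derivative_linear[OF h'(1)[of y]], of b 1] by simp
  show ?case
  proof (rule Ck_on_SucI[where f' = "\<lambda>x b. h' (f x) (f' x b)"])
    show "((\<lambda>x. h (f x)) has_derivative (\<lambda>b. h' (f x) (f' x b))) (at x)" for x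
      using diff_chain_at[OF f'(1)[of x] h'(1)[of "f x"]] by (simp add: o_def)
    show "Ck_on k UNIV (\<lambda>x. h' (f x) (f' x b))" if "b \<in> Basis" for b
      using Suc.IH[OF h'(2)[of 1] low] f'(2)[OF that] by (subst lin) (intro Ck_on_mult, auto)
  qed
qed

named_theorems smooth_intros

lemma smooth_on_const [smooth_intros]: "smooth_on UNIV (\<lambda>x. c)"
  by (simp add: smooth_on_def Ck_on_const del: Ck_on.simps)

lemma smooth_on_vec_nth [smooth_intros]: "smooth_on UNIV (\<lambda>u::real^'n. u $ i)"
  by (simp add: smooth_on_def Ck_on_bounded_linear bounded_linear_vec_nth)

lemma smooth_on_add [smooth_intros]:
  "smooth_on UNIV f \<Longrightarrow> smooth_on UNIV g \<Longrightarrow> smooth_on UNIV (\<lambda>x. f x + g x)"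
  by (simp add: smooth_on_def Ck_on_add)

lemma smooth_on_mult [smooth_intros]:
  fixes f g :: "'a::euclidean_space \<Rightarrow> real"
  shows "smooth_on UNIV f \<Longrightarrow> smooth_on UNIV g \<Longrightarrow> smooth_on UNIV (\<lambda>x. f x * g x)"
  by (simp add: smooth_on_def Ck_on_mult)

lemma smooth_on_minus [smooth_intros]:
  fixes f :: "'a::euclidean_space \<Rightarrow> real"
  shows "smooth_on UNIV f \<Longrightarrow> smooth_on UNIV (\<lambda>x. - f x)"
  by (simp add: smooth_on_def Ck_on_minus)

lemma smooth_on_diff [smooth_intros]:
  fixes f g :: "'a::euclidean_space \<Rightarrow> real"
  shows "smooth_on UNIV f \<Longrightarrow> smooth_on UNIV g \<Longrightarrow> smooth_on UNIV (\<lambda>x. f x - g x)"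
  using smooth_on_add[OF _ smooth_on_minus] by simp

lemma smooth_on_power [smooth_intros]:
  fixes f :: "'a::euclidean_space \<Rightarrow> real"
  shows "smooth_on UNIV f \<Longrightarrow> smooth_on UNIV (\<lambda>x. f x ^ n)"
  by (induction n) (simp_all add: smooth_intros)

lemma smooth_on_divide [smooth_intros]:
  fixes f g :: "'a::euclidean_space \<Rightarrow> real"
  shows "smooth_on UNIV f \<Longrightarrow> smooth_on UNIV g \<Longrightarrow> (\<And>x. g x \<noteq> 0) \<Longrightarrow> smooth_on UNIV (\<lambda>x. f x / g x)"
  unfolding divide_inverse by (intro smooth_on_mult) (auto simp: smooth_on_def Ck_on_inverse)

lemma smooth_on_sum [smooth_intros]:
  fixes f :: "'i \<Rightarrow> 'a::euclidean_space \<Rightarrow> real"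
  shows "(\<And>i. i \<in> I \<Longrightarrow> smooth_on UNIV (f i)) \<Longrightarrow> smooth_on UNIV (\<lambda>x. \<Sum>i\<in>I. f i x)"
  by (induction I rule: infinite_finite_induct) (simp_all add: smooth_intros)

lemma smooth_on_compose_real:
  fixes h :: "real \<Rightarrow> real" and f :: "'a::euclidean_space \<Rightarrow> real"
  shows "smooth_on UNIV h \<Longrightarrow> smooth_on UNIV f \<Longrightarrow> smooth_on UNIV (\<lambda>x. h (f x))"
  by (simp add: smooth_on_def Ck_on_compose_real)

lemma smooth_on_differentiable: "smooth_on UNIV f \<Longrightarrow> f differentiable (at x)"
  unfolding smooth_on_def by (drule spec[of _ "Suc 0"]) simp

lemma smooth_on_continuous: "smooth_on UNIV f \<Longrightarrow> continuous_on A f"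
  unfolding smooth_on_def by (drule spec[of _ 0]) (auto intro: continuous_on_subset)

lemma smooth_on_partial: "smooth_on UNIV f \<Longrightarrow> smooth_on UNIV (partial i f)"
  unfolding smooth_on_def partial_def
proof
  fix k assume "\<forall>k. Ck_on k UNIV f"
  then have "Ck_on (Suc k) UNIV f" by blast
  then show "Ck_on k UNIV (\<lambda>u. frechet_derivative f (at u) (axis i 1))"
    by (auto simp: Basis_vec_def)
qed

text \<open>For a function that is given together with formulas for all its derivatives.\<close>

lemma smooth_on_sequence:
  fixes h :: "nat \<Rightarrow> real \<Rightarrow> real"
  assumes "\<And>n x. (h n has_real_derivative h (Suc n) x) (at x)"
  shows "smooth_on UNIV (h n)"
proof -
  have "Ck_on k UNIV (h n)" for k n
  proof (induction k arbitrary: n)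
    case 0
    show ?case using assms by (auto intro!: continuous_at_imp_continuous_on DERIV_isCont simp: Ball_def)
  next
    case (Suc k)
    show ?case
      by (rule Ck_on_SucI[where f' = "\<lambda>x b. h (Suc n) x * b"])
        (use assms Suc in \<open>auto simp: has_field_derivative_def\<close>)
  qed
  then show ?thesis by (simp add: smooth_on_def)
qed

section \<open>Stereographic charts and conformal metrics\<close>

lemma partial_of_differentiable:
  assumes "F differentiable (at u)"
  shows "(F has_derivative frechet_derivative F (at u)) (at u)"
  using assms by (simp add: frechet_derivative_works)

lemma has_derivative_partial_2:
  fixes F :: "real^2 \<Rightarrow> real"
  assumes "F differentiable (at u)"
  shows "(F has_derivative (\<lambda>h. partial 1 F u * h $ 1 + partial 2 F u * h $ 2)) (at u)"
proof -
  let ?D = "frechet_derivative F (at u)"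
  have D: "(F has_derivative ?D) (at u)"
    using assms by (simp add: frechet_derivative_works)
  interpret D: linear ?D using has_derivative_linear[OF D] .
  have "?D h = partial 1 F u * h $ 1 + partial 2 F u * h $ 2" for h
  proof -
    have "h = h $ 1 *\<^sub>R axis 1 1 + h $ 2 *\<^sub>R axis 2 1"
      by (simp add: vec_eq_iff forall_2 axis_def)
    then have "?D h = ?D (h $ 1 *\<^sub>R axis 1 1 + h $ 2 *\<^sub>R axis 2 1)" by simp
    then show ?thesis by (simp add: D.add D.scaleR partial_def mult.commute)
  qed
  then have "?D = (\<lambda>h. partial 1 F u * h $ 1 + partial 2 F u * h $ 2)" by blast
  with D show ?thesis by simp
qed

definition laplacian2 :: "(real^2 \<Rightarrow> real) \<Rightarrow> real^2 \<Rightarrow> real" where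
  "laplacian2 F u = partial 1 (partial 1 F) u + partial 2 (partial 2 F) u"

lemma partial_add:
  "F differentiable (at u) \<Longrightarrow> F' differentiable (at u) \<Longrightarrow>
    partial i (\<lambda>u. F u + F' u) u = partial i F u + partial i F' u"
  by (subst partial_eqI[OF has_derivative_add]) (auto simp: partial_def intro: partial_of_differentiable)

lemma partial_cmult:
  fixes F :: "real^'n \<Rightarrow> real"
  shows "F differentiable (at u) \<Longrightarrow> partial i (\<lambda>u. c * F u) u = c * partial i F u"
  by (subst partial_eqI[OF has_derivative_mult_right]) (auto simp: partial_def intro: partial_of_differentiable)

lemma partial_mult:
  fixes F :: "real^'n \<Rightarrow> real"
  shows "F differentiable (at u) \<Longrightarrow> F' differentiable (at u) \<Longrightarrow>
    partial i (\<lambda>u. F u * F' u) u = partial i F u * F' u + F u * partial i F' u"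
  by (subst partial_eqI[OF has_derivative_mult]) (auto simp: partial_def intro: partial_of_differentiable)

lemma partial_compose_real:
  fixes F :: "real^'n \<Rightarrow> real"
  assumes "(h has_real_derivative h') (at (F u))" "F differentiable (at u)"
  shows "partial i (\<lambda>u. h (F u)) u = h' * partial i F u"
proof -
  have "((\<lambda>u. h (F u)) has_derivative (\<lambda>b. h' * frechet_derivative F (at u) b)) (at u)"
    using diff_chain_at[OF partial_of_differentiable[OF assms(2)], of h] assms(1)
    by (simp add: has_field_derivative_def o_def)
  from partial_eqI[OF this] show ?thesis by (simp add: partial_def)
qed

lemma laplacian2_add:
  assumes "smooth_on UNIV F" "smooth_on UNIV F'"
  shows "laplacian2 (\<lambda>u. F u + F' u) u = laplacian2 F u + laplacian2 F' u"
proof -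
  have "partial i (\<lambda>u. F u + F' u) = (\<lambda>u. partial i F u + partial i F' u)" for i
    using assms by (simp add: fun_eq_iff partial_add smooth_on_differentiable)
  then show ?thesis
    using assms by (simp add: laplacian2_def partial_add smooth_on_differentiable smooth_on_partial)
qed

lemma laplacian2_cmult:
  assumes "smooth_on UNIV F"
  shows "laplacian2 (\<lambda>u. c * F u) u = c * laplacian2 F u"
proof -
  have "partial i (\<lambda>u. c * F u) = (\<lambda>u. c * partial i F u)" for i
    using assms by (simp add: fun_eq_iff partial_cmult smooth_on_differentiable)
  then show ?thesis
    using assms by (simp add: laplacian2_def partial_cmult smooth_on_differentiable smooth_on_partial algebra_simps)
qed

text \<open>The round metric is \<open>4 / (stereo_denom u)\<^sup>2\<close> times the Euclidean metric in both charts.\<close>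

definition stereo_denom :: "real^2 \<Rightarrow> real" where
  "stereo_denom u = 1 + ((u $ 1)\<^sup>2 + (u $ 2)\<^sup>2)"

lemma stereo_denom_neq_0 [simp]: "stereo_denom u \<noteq> 0"
  by (simp add: stereo_denom_def add_pos_nonneg less_imp_neq[symmetric])

lemma norm_vec2_squared: "(norm (u::real^2))\<^sup>2 = (u $ 1)\<^sup>2 + (u $ 2)\<^sup>2"
  unfolding power2_norm_eq_inner by (simp add: inner_vec_def sum_2 power2_eq_square)

lemma stereo_nth:
  "stereo \<sigma> u $ 1 = 2 * u $ 1 / stereo_denom u"
  "stereo \<sigma> u $ 2 = 2 * u $ 2 / stereo_denom u"
  "stereo \<sigma> u $ 3 = \<sigma> * (1 - 2 / stereo_denom u)"
proof -
  have n: "(norm u)\<^sup>2 = stereo_denom u - 1"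
    by (simp add: stereo_denom_def norm_vec2_squared)
  show
    "stereo \<sigma> u $ 1 = 2 * u $ 1 / stereo_denom u"
    "stereo \<sigma> u $ 2 = 2 * u $ 2 / stereo_denom u"
    "stereo \<sigma> u $ 3 = \<sigma> * (1 - 2 / stereo_denom u)"
    unfolding stereo_def n by (simp_all add: field_simps)
qed

lemmas has_derivative_vec_nth [derivative_intros] =
  bounded_linear.has_derivative[OF bounded_linear_vec_nth]

lemma has_derivative_stereo_denom [derivative_intros]:
  "(f has_derivative f') (at x) \<Longrightarrow>
    ((\<lambda>x. stereo_denom (f x)) has_derivative (\<lambda>h. 2 * (f x $ 1 * f' h $ 1 + f x $ 2 * f' h $ 2))) (at x)"
  unfolding stereo_denom_def by (auto intro!: derivative_eq_intros simp: algebra_simps)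

lemma has_derivative_stereo_nth:
  "((\<lambda>u. stereo \<sigma> u $ 1) has_derivative
     (\<lambda>h. 2 * h $ 1 / stereo_denom u - 4 * u $ 1 * (u $ 1 * h $ 1 + u $ 2 * h $ 2) / (stereo_denom u)\<^sup>2)) (at u)"
  "((\<lambda>u. stereo \<sigma> u $ 2) has_derivative
     (\<lambda>h. 2 * h $ 2 / stereo_denom u - 4 * u $ 2 * (u $ 1 * h $ 1 + u $ 2 * h $ 2) / (stereo_denom u)\<^sup>2)) (at u)"
  "((\<lambda>u. stereo \<sigma> u $ 3) has_derivative
     (\<lambda>h. 4 * \<sigma> * (u $ 1 * h $ 1 + u $ 2 * h $ 2) / (stereo_denom u)\<^sup>2)) (at u)"
  unfolding stereo_nth
  by (auto intro!: derivative_eq_intros simp: power2_eq_square field_simps)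

lemma partial_stereo_nth:
  "partial 1 (\<lambda>u. stereo \<sigma> u $ 1) = (\<lambda>u. 2 / stereo_denom u - 4 * (u $ 1)\<^sup>2 / (stereo_denom u)\<^sup>2)"
  "partial 2 (\<lambda>u. stereo \<sigma> u $ 1) = (\<lambda>u. - 4 * u $ 1 * u $ 2 / (stereo_denom u)\<^sup>2)"
  "partial 1 (\<lambda>u. stereo \<sigma> u $ 2) = (\<lambda>u. - 4 * u $ 1 * u $ 2 / (stereo_denom u)\<^sup>2)"
  "partial 2 (\<lambda>u. stereo \<sigma> u $ 2) = (\<lambda>u. 2 / stereo_denom u - 4 * (u $ 2)\<^sup>2 / (stereo_denom u)\<^sup>2)"
  "partial i (\<lambda>u. stereo \<sigma> u $ 3) = (\<lambda>u. 4 * \<sigma> * u $ i / (stereo_denom u)\<^sup>2)"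
  using exhaust_2[of i]
  by (auto simp: fun_eq_iff partial_eqI[OF has_derivative_stereo_nth(1)] partial_eqI[OF has_derivative_stereo_nth(2)]
      partial_eqI[OF has_derivative_stereo_nth(3)] axis_def power2_eq_square)

text \<open>The coordinate functions are eigenfunctions of the round Laplacian with eigenvalue \<open>2\<close>.\<close>

lemma laplacian2_stereo_nth:
  "laplacian2 (\<lambda>u. stereo \<sigma> u $ 1) u = - 2 * (4 / (stereo_denom u)\<^sup>2) * stereo \<sigma> u $ 1"
  "laplacian2 (\<lambda>u. stereo \<sigma> u $ 3) u = - 2 * (4 / (stereo_denom u)\<^sup>2) * stereo \<sigma> u $ 3"
proof -
  let ?D = "stereo_denom u"
  have "((\<lambda>u. 2 / stereo_denom u - 4 * (u $ 1)\<^sup>2 / (stereo_denom u)\<^sup>2) has_derivative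
      (\<lambda>h. - 4 * (u $ 1 * h $ 1 + u $ 2 * h $ 2) / ?D\<^sup>2 - 8 * u $ 1 * h $ 1 / ?D\<^sup>2
         + 16 * (u $ 1)\<^sup>2 * (u $ 1 * h $ 1 + u $ 2 * h $ 2) / ?D^3)) (at u)"
    by (auto intro!: derivative_eq_intros simp: power2_eq_square power3_eq_cube field_simps)
  from partial_eqI[OF this, of 1]
  have 1: "partial 1 (partial 1 (\<lambda>u. stereo \<sigma> u $ 1)) u
      = - 12 * u $ 1 / ?D\<^sup>2 + 16 * (u $ 1)^3 / ?D^3"
    by (simp add: partial_stereo_nth axis_def power2_eq_square power3_eq_cube)
  have "((\<lambda>u. - 4 * u $ 1 * u $ 2 / (stereo_denom u)\<^sup>2) has_derivative
      (\<lambda>h. - 4 * (h $ 1 * u $ 2 + u $ 1 * h $ 2) / ?D\<^sup>2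
         + 16 * u $ 1 * u $ 2 * (u $ 1 * h $ 1 + u $ 2 * h $ 2) / ?D^3)) (at u)"
    by (auto intro!: derivative_eq_intros simp: power2_eq_square power3_eq_cube field_simps)
  from partial_eqI[OF this, of 2]
  have 2: "partial 2 (partial 2 (\<lambda>u. stereo \<sigma> u $ 1)) u
      = - 4 * u $ 1 / ?D\<^sup>2 + 16 * u $ 1 * (u $ 2)\<^sup>2 / ?D^3"
    by (simp add: partial_stereo_nth axis_def power2_eq_square power3_eq_cube)
  have "laplacian2 (\<lambda>u. stereo \<sigma> u $ 1) u
      = - 16 * u $ 1 / ?D\<^sup>2 + 16 * u $ 1 * ((u $ 1)\<^sup>2 + (u $ 2)\<^sup>2) / ?D^3"
    by (simp add: laplacian2_def 1 2 power2_eq_square power3_eq_cube field_simps)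
  also have "(u $ 1)\<^sup>2 + (u $ 2)\<^sup>2 = ?D - 1" by (simp add: stereo_denom_def)
  finally show "laplacian2 (\<lambda>u. stereo \<sigma> u $ 1) u = - 2 * (4 / ?D\<^sup>2) * stereo \<sigma> u $ 1"
    by (simp only:) (simp add: stereo_nth power2_eq_square power3_eq_cube field_simps)
  have "((\<lambda>u. 4 * \<sigma> * u $ i / (stereo_denom u)\<^sup>2) has_derivative
      (\<lambda>h. 4 * \<sigma> * h $ i / ?D\<^sup>2 - 16 * \<sigma> * u $ i * (u $ 1 * h $ 1 + u $ 2 * h $ 2) / ?D^3)) (at u)" for i
    by (auto intro!: derivative_eq_intros simp: power2_eq_square power3_eq_cube field_simps)
  from partial_eqI[OF this[of 1], of 1] partial_eqI[OF this[of 2], of 2]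
  have "laplacian2 (\<lambda>u. stereo \<sigma> u $ 3) u
      = 8 * \<sigma> / ?D\<^sup>2 - 16 * \<sigma> * ((u $ 1)\<^sup>2 + (u $ 2)\<^sup>2) / ?D^3"
    by (simp add: laplacian2_def partial_stereo_nth axis_def power2_eq_square power3_eq_cube field_simps)
  also have "(u $ 1)\<^sup>2 + (u $ 2)\<^sup>2 = ?D - 1" by (simp add: stereo_denom_def)
  finally show "laplacian2 (\<lambda>u. stereo \<sigma> u $ 3) u = - 2 * (4 / ?D\<^sup>2) * stereo \<sigma> u $ 3"
    by (simp only:) (simp add: stereo_nth power2_eq_square power3_eq_cube field_simps)
qed

text \<open>Up to the conformal factor these are the inner products of the tangential gradients of the coordinate
  functions, that is, of the projections of the coordinate vectors to the tangent plane.\<close>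

lemma stereo_gradients:
  fixes \<sigma> :: real
  assumes "\<sigma> = 1 \<or> \<sigma> = -1"
  defines "X \<equiv> \<lambda>u. stereo \<sigma> u $ 1" and "Z \<equiv> \<lambda>u. stereo \<sigma> u $ 3"
  shows
  "(partial 1 X u)\<^sup>2 + (partial 2 X u)\<^sup>2 = 4 / (stereo_denom u)\<^sup>2 * (1 - (X u)\<^sup>2)"
  "(partial 1 Z u)\<^sup>2 + (partial 2 Z u)\<^sup>2 = 4 / (stereo_denom u)\<^sup>2 * (1 - (Z u)\<^sup>2)"
  "partial 1 X u * partial 1 Z u + partial 2 X u * partial 2 Z u = - 4 / (stereo_denom u)\<^sup>2 * (X u * Z u)"
proof -
  let ?D = "stereo_denom u"
  have s: "\<sigma> * \<sigma> = 1" using assms(1) by auto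
  show "(partial 1 X u)\<^sup>2 + (partial 2 X u)\<^sup>2 = 4 / ?D\<^sup>2 * (1 - (X u)\<^sup>2)"
  proof -
    have "(partial 1 X u)\<^sup>2 + (partial 2 X u)\<^sup>2
      = 4 / ?D\<^sup>2 - 16 * (u $ 1)\<^sup>2 / ?D^3 + 16 * (u $ 1)\<^sup>2 * ((u $ 1)\<^sup>2 + (u $ 2)\<^sup>2) / ?D^4"
      by (simp add: X_def partial_stereo_nth power2_eq_square power3_eq_cube power4_eq_xxxx field_simps)
    also have "(u $ 1)\<^sup>2 + (u $ 2)\<^sup>2 = ?D - 1" by (simp add: stereo_denom_def)
    finally show ?thesis
      by (simp add: X_def stereo_nth power2_eq_square power3_eq_cube power4_eq_xxxx field_simps)
  qed
  show "(partial 1 Z u)\<^sup>2 + (partial 2 Z u)\<^sup>2 = 4 / ?D\<^sup>2 * (1 - (Z u)\<^sup>2)"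
  proof -
    have "(partial 1 Z u)\<^sup>2 + (partial 2 Z u)\<^sup>2
      = (\<sigma> * \<sigma>) * (16 * ((u $ 1)\<^sup>2 + (u $ 2)\<^sup>2) / ?D^4)"
      by (simp add: Z_def partial_stereo_nth power2_eq_square power4_eq_xxxx field_simps)
    also have "(u $ 1)\<^sup>2 + (u $ 2)\<^sup>2 = ?D - 1" by (simp add: stereo_denom_def)
    finally have lhs: "(partial 1 Z u)\<^sup>2 + (partial 2 Z u)\<^sup>2 = 16 * (?D - 1) / ?D^4"
      by (simp add: s)
    have "(Z u)\<^sup>2 = (\<sigma> * \<sigma>) * (1 - 2 / ?D)\<^sup>2"
      by (simp add: Z_def stereo_nth power2_eq_square)
    then have Z: "(Z u)\<^sup>2 = (1 - 2 / ?D)\<^sup>2" by (simp add: s)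
    have "4 / ?D\<^sup>2 * (1 - (Z u)\<^sup>2) = 16 * (?D - 1) / ?D^4"
      unfolding Z by (simp add: power2_eq_square power4_eq_xxxx field_simps)
    with lhs show ?thesis by simp
  qed
  show "partial 1 X u * partial 1 Z u + partial 2 X u * partial 2 Z u = - 4 / ?D\<^sup>2 * (X u * Z u)"
  proof -
    have "partial 1 X u * partial 1 Z u + partial 2 X u * partial 2 Z u
      = \<sigma> * u $ 1 * (8 / ?D^3 - 16 * ((u $ 1)\<^sup>2 + (u $ 2)\<^sup>2) / ?D^4)"
      by (simp add: X_def Z_def partial_stereo_nth power2_eq_square power3_eq_cube power4_eq_xxxx field_simps)
    also have "(u $ 1)\<^sup>2 + (u $ 2)\<^sup>2 = ?D - 1" by (simp add: stereo_denom_def)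
    finally show ?thesis
      by (simp add: X_def Z_def stereo_nth power2_eq_square power3_eq_cube power4_eq_xxxx field_simps)
  qed
qed

lemma stereo_differentiable: "stereo \<sigma> differentiable (at u)"
proof -
  have "\<forall>k. (\<lambda>u. stereo \<sigma> u $ k) differentiable (at u)"
    unfolding forall_3 using has_derivative_stereo_nth[of \<sigma> u] by (auto simp: differentiable_def)
  then show ?thesis
    by (subst differentiable_componentwise_within) (auto simp: Basis_vec_def inner_axis)
qed

lemma partial_stereo_component: "partial i (stereo \<sigma>) u $ k = partial i (\<lambda>u. stereo \<sigma> u $ k) u"
proof -
  have "((\<lambda>u. stereo \<sigma> u $ k) has_derivative (\<lambda>h. frechet_derivative (stereo \<sigma>) (at u) h $ k)) (at u)"
    by (intro has_derivative_vec_nth partial_of_differentiable stereo_differentiable)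
  from partial_eqI[OF this] show ?thesis by (simp add: partial_def)
qed

lemma partial_stereo_inner:
  assumes "\<sigma> = 1 \<or> \<sigma> = -1"
  shows "partial i (stereo \<sigma>) u \<bullet> partial j (stereo \<sigma>) u = (if i = j then 4 / (stereo_denom u)\<^sup>2 else 0)"
proof -
  let ?D = "stereo_denom u"
  have s: "\<sigma> * \<sigma> = 1" using assms by auto
  have r: "(u $ 1)\<^sup>2 + (u $ 2)\<^sup>2 = ?D - 1" by (simp add: stereo_denom_def)
  have "partial 1 (stereo \<sigma>) u \<bullet> partial 1 (stereo \<sigma>) u
      = 4 / ?D\<^sup>2 - 16 * (u $ 1)\<^sup>2 / ?D^3 + 16 * (u $ 1)\<^sup>2 * ((u $ 1)\<^sup>2 + (u $ 2)\<^sup>2) / ?D^4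
        + (\<sigma> * \<sigma>) * 16 * (u $ 1)\<^sup>2 / ?D^4"
    by (simp add: inner_vec_def sum_3 partial_stereo_component partial_stereo_nth
        power2_eq_square power3_eq_cube power4_eq_xxxx field_simps)
  then have 11: "partial 1 (stereo \<sigma>) u \<bullet> partial 1 (stereo \<sigma>) u = 4 / ?D\<^sup>2"
    unfolding r s by (simp only:) (simp add: power2_eq_square power3_eq_cube power4_eq_xxxx field_simps)
  have "partial 2 (stereo \<sigma>) u \<bullet> partial 2 (stereo \<sigma>) u
      = 4 / ?D\<^sup>2 - 16 * (u $ 2)\<^sup>2 / ?D^3 + 16 * (u $ 2)\<^sup>2 * ((u $ 1)\<^sup>2 + (u $ 2)\<^sup>2) / ?D^4
        + (\<sigma> * \<sigma>) * 16 * (u $ 2)\<^sup>2 / ?D^4"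
    by (simp add: inner_vec_def sum_3 partial_stereo_component partial_stereo_nth
        power2_eq_square power3_eq_cube power4_eq_xxxx field_simps)
  then have 22: "partial 2 (stereo \<sigma>) u \<bullet> partial 2 (stereo \<sigma>) u = 4 / ?D\<^sup>2"
    unfolding r s by (simp only:) (simp add: power2_eq_square power3_eq_cube power4_eq_xxxx field_simps)
  have "partial 1 (stereo \<sigma>) u \<bullet> partial 2 (stereo \<sigma>) u
      = u $ 1 * u $ 2 * (- 16 / ?D^3 + 16 * ((u $ 1)\<^sup>2 + (u $ 2)\<^sup>2) / ?D^4 + (\<sigma> * \<sigma>) * 16 / ?D^4)"
    by (simp add: inner_vec_def sum_3 partial_stereo_component partial_stereo_nth
        power2_eq_square power3_eq_cube power4_eq_xxxx field_simps)
  then have 12: "partial 1 (stereo \<sigma>) u \<bullet> partial 2 (stereo \<sigma>) u = 0"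
    unfolding r s by (simp only:) (simp add: power2_eq_square power3_eq_cube power4_eq_xxxx field_simps)
  show ?thesis
    using exhaust_2[of i] exhaust_2[of j] 11 22 12 by (auto simp: inner_commute)
qed

lemma metric_matrix_conformal:
  assumes "\<sigma> = 1 \<or> \<sigma> = -1"
  shows "metric_matrix (conformal_metric G) \<sigma> u = mat (G (stereo \<sigma> u) * (4 / (stereo_denom u)\<^sup>2))"
  by (simp add: metric_matrix_def conformal_metric_def round_metric_def partial_stereo_inner[OF assms]
      mat_def vec_eq_iff)

lemma matrix_inv_mat:
  fixes c :: real
  assumes "c \<noteq> 0"
  shows "matrix_inv (mat c :: real^'n^'n) = mat (1 / c)"
proof -
  have prod: "mat a ** mat b = (mat (a * b) :: real^'n^'n)" for a b :: real
    by (simp add: matrix_matrix_mult_def mat_def vec_eq_iff if_distrib[of "\<lambda>x. x * _"] if_distrib[of "(*) _"] cong: if_cong)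
  have "\<exists>A'. mat c ** A' = (mat 1 :: real^'n^'n) \<and> A' ** mat c = mat 1"
    by (rule exI[of _ "mat (1 / c)"]) (simp add: prod assms)
  then have inv: "mat c ** matrix_inv (mat c) = (mat 1 :: real^'n^'n)"
    unfolding matrix_inv_def by (rule someI2_ex) simp
  have "matrix_inv (mat c) = mat (1 / c) ** (mat c ** matrix_inv (mat c) :: real^'n^'n)"
    by (simp add: matrix_mul_assoc prod assms)
  also have "\<dots> = mat (1 / c)" by (simp add: inv)
  finally show ?thesis .
qed

text \<open>In dimension two the factors \<open>sqrt (det g)\<close> and \<open>g\<^sup>-\<^sup>1\<close> inside the divergence cancel for a
  conformally flat metric, which leaves the flat Laplacian divided by the conformal factor.\<close>

lemma laplace_in_chart_conformal:
  assumes \<sigma>: "\<sigma> = 1 \<or> \<sigma> = -1" and G: "\<And>u. G (stereo \<sigma> u) > 0"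
  shows "laplace_in_chart (conformal_metric G) \<sigma> f u
    = laplacian2 (f \<circ> stereo \<sigma>) u / (G (stereo \<sigma> u) * (4 / (stereo_denom u)\<^sup>2))"
proof -
  define \<mu> where "\<mu> u = G (stereo \<sigma> u) * (4 / (stereo_denom u)\<^sup>2)" for u
  have \<mu>: "\<mu> u > 0" for u using G by (simp add: \<mu>_def)
  have M: "metric_matrix (conformal_metric G) \<sigma> u = mat (\<mu> u)" for u
    by (simp add: metric_matrix_conformal[OF \<sigma>] \<mu>_def)
  have det: "sqrt (det (mat (\<mu> z) :: real^2^2)) = \<mu> z" for z
    using \<mu>[of z] by (simp add: det_2 mat_def)
  have "sqrt (det (mat (\<mu> z) :: real^2^2)) * (\<Sum>j\<in>UNIV. matrix_inv (mat (\<mu> z)) $ i $ j * partial j (f \<circ> stereo \<sigma>) z)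
      = partial i (f \<circ> stereo \<sigma>) z" for i z
  proof -
    have "matrix_inv (mat (\<mu> z) :: real^2^2) = mat (1 / \<mu> z)"
      using \<mu>[of z] by (intro matrix_inv_mat) auto
    then show ?thesis
      using \<mu>[of z] exhaust_2[of i] unfolding det by (auto simp: sum_2 mat_def)
  qed
  then show ?thesis
    unfolding laplace_in_chart_def M \<mu>_def[symmetric] by (simp add: det sum_2 laplacian2_def)
qed

lemma stereo_chart_stereo:
  assumes "x \<in> S2" "\<sigma> = 1 \<or> \<sigma> = -1" "x $ 3 \<noteq> \<sigma>"
  shows "stereo \<sigma> (stereo_chart \<sigma> x) = x"
proof -
  have n: "x $ 1 * x $ 1 + x $ 2 * x $ 2 + x $ 3 * x $ 3 = 1"
    using assms(1) by (simp add: S2_def norm_eq_1 inner_vec_def sum_3)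
  have s: "\<sigma> * \<sigma> = 1" "1 - \<sigma> * x $ 3 \<noteq> 0" using assms(2,3) by auto
  have D: "stereo_denom (stereo_chart \<sigma> x) = 2 / (1 - \<sigma> * x $ 3)"
  proof -
    have "stereo_denom (stereo_chart \<sigma> x) = 1 + (x $ 1 * x $ 1 + x $ 2 * x $ 2) / (1 - \<sigma> * x $ 3)\<^sup>2"
      by (simp add: stereo_denom_def stereo_chart_def power_divide power2_eq_square add_divide_distrib)
    also have "x $ 1 * x $ 1 + x $ 2 * x $ 2 = 1 - (\<sigma> * \<sigma>) * (x $ 3 * x $ 3)" using n s by simp
    also have "\<dots> = (1 - \<sigma> * x $ 3) * (2 - (1 - \<sigma> * x $ 3))" by (simp add: algebra_simps)
    also have "1 + q * (2 - q) / q\<^sup>2 = 2 / q" if "q \<noteq> 0" for q :: real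
      using that by (simp add: power2_eq_square field_simps)
    finally show ?thesis using s by simp
  qed
  have "stereo \<sigma> (stereo_chart \<sigma> x) $ 3 = (\<sigma> * \<sigma>) * x $ 3"
    unfolding stereo_nth D using assms(2) by (auto simp: diff_divide_distrib add_divide_distrib)
  moreover have "stereo \<sigma> (stereo_chart \<sigma> x) $ 1 = x $ 1" "stereo \<sigma> (stereo_chart \<sigma> x) $ 2 = x $ 2"
    using s unfolding stereo_nth D by (simp_all add: stereo_chart_def)
  ultimately show ?thesis by (simp add: vec_eq_iff forall_3 s)
qed

lemma stereo_in_S2:
  assumes "\<sigma> = 1 \<or> \<sigma> = -1"
  shows "stereo \<sigma> u \<in> S2"
proof -
  let ?D = "stereo_denom u"
  have s: "\<sigma> * \<sigma> = 1" using assms by auto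
  have "stereo \<sigma> u \<bullet> stereo \<sigma> u = 4 * ((u $ 1)\<^sup>2 + (u $ 2)\<^sup>2) / ?D\<^sup>2 + (\<sigma> * \<sigma>) * (1 - 2 / ?D)\<^sup>2"
    by (simp add: inner_vec_def sum_3 stereo_nth power2_eq_square add_divide_distrib algebra_simps)
  also have "(u $ 1)\<^sup>2 + (u $ 2)\<^sup>2 = ?D - 1" by (simp add: stereo_denom_def)
  finally show ?thesis by (simp add: S2_def norm_eq_1 s power2_eq_square field_simps)
qed

text \<open>The sign of the chart in which \<open>laplace_beltrami\<close> is evaluated at \<open>x\<close>.\<close>

definition chart_sign :: "real^3 \<Rightarrow> real" where
  "chart_sign x = (if x = vector [0, 0, 1] then - 1 else 1)"

lemma chart_sign: "chart_sign x = 1 \<or> chart_sign x = - 1"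
  by (simp add: chart_sign_def)

lemma stereo_chart_sign:
  assumes "x \<in> S2"
  shows "stereo (chart_sign x) (stereo_chart (chart_sign x) x) = x"
proof (rule stereo_chart_stereo[OF assms chart_sign])
  have n: "x $ 1 * x $ 1 + x $ 2 * x $ 2 + x $ 3 * x $ 3 = 1"
    using assms by (simp add: S2_def norm_eq_1 inner_vec_def sum_3)
  show "x $ 3 \<noteq> chart_sign x"
  proof
    assume eq: "x $ 3 = chart_sign x"
    then have "x $ 1 * x $ 1 + x $ 2 * x $ 2 = 0" using n by (auto simp: chart_sign_def split: if_splits)
    then have "x $ 1 = 0 \<and> x $ 2 = 0" by (simp add: sum_squares_eq_zero_iff)
    with eq show False by (auto simp: chart_sign_def vec_eq_iff forall_3 split: if_splits)
  qed
qed

lemma laplace_beltrami_conformal: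
  assumes x: "x \<in> S2" and G: "\<And>x. x \<in> S2 \<Longrightarrow> G x > 0"
  shows "laplace_beltrami (conformal_metric G) f x
    = laplacian2 (f \<circ> stereo (chart_sign x)) (stereo_chart (chart_sign x) x)
      / (G x * (4 / (stereo_denom (stereo_chart (chart_sign x) x))\<^sup>2))"
  unfolding laplace_beltrami_def Let_def chart_sign_def[symmetric]
  by (subst laplace_in_chart_conformal[OF chart_sign])
     (simp_all add: G stereo_in_S2[OF chart_sign] stereo_chart_sign[OF x])

lemma round_metric_conformal: "round_metric = conformal_metric (\<lambda>x. 1)"
  by (simp add: fun_eq_iff conformal_metric_def)

lemma laplace_beltrami_round:
  assumes "x \<in> S2"
  shows "laplace_beltrami round_metric f x
    = (stereo_denom (stereo_chart (chart_sign x) x))\<^sup>2 / 4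
      * laplacian2 (f \<circ> stereo (chart_sign x)) (stereo_chart (chart_sign x) x)"
  unfolding round_metric_conformal using assms by (subst laplace_beltrami_conformal) auto

lemma laplace_beltrami_conformal_round:
  assumes "x \<in> S2" and "\<And>x. x \<in> S2 \<Longrightarrow> G x > 0"
  shows "laplace_beltrami (conformal_metric G) f x = inverse (G x) * laplace_beltrami round_metric f x"
proof -
  have "laplace_beltrami (conformal_metric G) f x
    = laplacian2 (f \<circ> stereo (chart_sign x)) (stereo_chart (chart_sign x) x)
      / (G x * (4 / (stereo_denom (stereo_chart (chart_sign x) x))\<^sup>2))"
    using assms by (rule laplace_beltrami_conformal)
  then show ?thesis
    by (simp add: laplace_beltrami_round[OF assms(1)] field_simps)
qed

lemma smooth_on_S2_iff: "smooth_on_S2 f \<longleftrightarrow> smooth_on UNIV (f \<circ> stereo 1) \<and> smooth_on UNIV (f \<circ> stereo (- 1))"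
  by (simp add: smooth_on_S2_def)

lemma smooth_on_S2D: "smooth_on_S2 f \<Longrightarrow> \<sigma> = 1 \<or> \<sigma> = -1 \<Longrightarrow> smooth_on UNIV (f \<circ> stereo \<sigma>)"
  by (auto simp: smooth_on_S2_def)

lemma smooth_on_stereo_denom [smooth_intros]: "smooth_on UNIV stereo_denom"
  unfolding stereo_denom_def[abs_def] by (intro smooth_intros)

lemma smooth_on_stereo_nth [smooth_intros]: "smooth_on UNIV (\<lambda>u. stereo \<sigma> u $ k)"
proof -
  have "smooth_on UNIV (\<lambda>u. stereo \<sigma> u $ 1)" "smooth_on UNIV (\<lambda>u. stereo \<sigma> u $ 2)"
    "smooth_on UNIV (\<lambda>u. stereo \<sigma> u $ 3)"
    unfolding stereo_nth by (intro smooth_intros stereo_denom_neq_0)+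
  then show ?thesis using exhaust_3[of k] by auto
qed

lemma riemannian_metric_conformal:
  assumes "smooth_on_S2 G" and "\<And>x. x \<in> S2 \<Longrightarrow> G x > 0"
  shows "riemannian_metric (conformal_metric G)"
  unfolding riemannian_metric_def
proof (intro conjI ballI allI impI)
  fix \<sigma> :: real and i j :: 2
  assume "\<sigma> \<in> {1, -1}"
  then have \<sigma>: "\<sigma> = 1 \<or> \<sigma> = -1" by auto
  have G: "smooth_on UNIV (\<lambda>u. G (stereo \<sigma> u))"
    using smooth_on_S2D[OF assms(1) \<sigma>] by (simp add: o_def)
  have "smooth_on UNIV (\<lambda>u. (if i = j then 1 else 0) * (G (stereo \<sigma> u) * (4 / (stereo_denom u)\<^sup>2)))"
    by (intro smooth_intros G) simp
  then show "smooth_on UNIV (\<lambda>u. metric_matrix (conformal_metric G) \<sigma> u $ i $ j)"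
    by (cases "i = j") (simp_all add: metric_matrix_conformal[OF \<sigma>] mat_def)
qed (use assms(2) in \<open>auto simp: conformal_metric_def round_metric_def inner_commute inner_add_left algebra_simps\<close>)

lemma smooth_on_S2_intros:
  "smooth_on_S2 f \<Longrightarrow> smooth_on_S2 g \<Longrightarrow> smooth_on_S2 (\<lambda>x. f x + g x)"
  "smooth_on_S2 f \<Longrightarrow> smooth_on_S2 (\<lambda>x. c * f x)"
  by (auto simp: smooth_on_S2_iff o_def intro!: smooth_intros)

lemma laplace_beltrami_round_linear:
  assumes "x \<in> S2" "smooth_on_S2 f"
  shows "smooth_on_S2 g \<Longrightarrow> laplace_beltrami round_metric (\<lambda>x. f x + g x) x
      = laplace_beltrami round_metric f x + laplace_beltrami round_metric g x"
    "laplace_beltrami round_metric (\<lambda>x. c * f x) x = c * laplace_beltrami round_metric f x"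
  using laplacian2_add[OF smooth_on_S2D[OF _ chart_sign] smooth_on_S2D[OF _ chart_sign], of f g x x]
    laplacian2_cmult[OF smooth_on_S2D[OF assms(2) chart_sign]] assms
  by (simp_all add: laplace_beltrami_round o_def algebra_simps)

section \<open>Polar coordinates\<close>

definition polar :: "real \<Rightarrow> real \<Rightarrow> real^3" where
  "polar s t = vector [sin s * cos t, sin s * sin t, cos s]"

lemma polar_nth [simp]: "polar s t $ 1 = sin s * cos t" "polar s t $ 2 = sin s * sin t" "polar s t $ 3 = cos s"
  by (simp_all add: polar_def)

lemma polar_in_S2 [simp]: "polar s t \<in> S2"
proof -
  have "sin s * cos t * (sin s * cos t) + sin s * sin t * (sin s * sin t) + cos s * cos s = 1"
    using sin_cos_squared_add[of s] sin_cos_squared_add[of t] by algebra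
  then show ?thesis by (simp add: S2_def norm_eq_1 inner_vec_def sum_3)
qed

lemma S2_polar:
  assumes "x \<in> S2"
  obtains s t where "s \<in> {0..pi}" "t \<in> {0..2*pi}" "x = polar s t"
proof -
  have n: "(x $ 1)\<^sup>2 + (x $ 2)\<^sup>2 + (x $ 3)\<^sup>2 = 1"
    using assms by (simp add: S2_def norm_eq_1 inner_vec_def sum_3 power2_eq_square)
  have z: "- 1 \<le> x $ 3" "x $ 3 \<le> 1"
  proof -
    have "(x $ 3)\<^sup>2 \<le> 1" using n by (smt (verit) zero_le_power2)
    then show "- 1 \<le> x $ 3" "x $ 3 \<le> 1" by (simp_all add: abs_square_le_1 abs_le_iff)
  qed
  define s where "s = arccos (x $ 3)"
  have s: "s \<in> {0..pi}" "cos s = x $ 3" using z by (auto simp: s_def arccos_lbound arccos_ubound)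
  have s0: "sin s \<ge> 0" using s by (auto intro: sin_ge_zero)
  have sq: "(sin s)\<^sup>2 = (x $ 1)\<^sup>2 + (x $ 2)\<^sup>2"
    using n s by (simp add: sin_squared_eq)
  show thesis
  proof (cases "sin s = 0")
    case True
    then have "x = polar s 0" using sq s by (auto simp: vec_eq_iff forall_3 sum_power2_eq_zero_iff)
    then show thesis using s that[of s 0] by auto
  next
    case False
    have "(x $ 1 / sin s)\<^sup>2 + (x $ 2 / sin s)\<^sup>2 = 1"
    proof -
      have "(x $ 1 / sin s)\<^sup>2 + (x $ 2 / sin s)\<^sup>2 = ((x $ 1)\<^sup>2 + (x $ 2)\<^sup>2) / (sin s)\<^sup>2"
        by (simp add: power_divide add_divide_distrib)
      also have "\<dots> = 1" unfolding sq[symmetric] using False by simp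
      finally show ?thesis .
    qed
    then obtain t where "0 \<le> t" "t < 2 * pi" "x $ 1 / sin s = cos t" "x $ 2 / sin s = sin t"
      using sincos_total_2pi[of "x $ 1 / sin s" "x $ 2 / sin s"] by metis
    then have "x = polar s t" using s False by (simp add: vec_eq_iff forall_3 field_simps)
    then show thesis using s that[of s t] \<open>0 \<le> t\<close> \<open>t < 2 * pi\<close> by auto
  qed
qed

text \<open>Unlike \<open>vector [a, b]\<close>, this form is accepted by the rules for continuity and derivatives.\<close>

definition plane_vec :: "real \<Rightarrow> real \<Rightarrow> real^2" where
  "plane_vec a b = a *\<^sub>R axis 1 1 + b *\<^sub>R axis 2 1"

lemma plane_vec_nth [simp]: "plane_vec a b $ 1 = a" "plane_vec a b $ 2 = b"
  by (simp_all add: plane_vec_def axis_def)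

lemma has_real_derivative_plane_curve:
  assumes "F differentiable (at (plane_vec (a s) (b s)))"
    and a: "(a has_real_derivative a') (at s)" and b: "(b has_real_derivative b') (at s)"
  shows "((\<lambda>s. F (plane_vec (a s) (b s))) has_real_derivative
    partial 1 F (plane_vec (a s) (b s)) * a' + partial 2 F (plane_vec (a s) (b s)) * b') (at s)"
proof -
  note [derivative_intros] = a[unfolded has_field_derivative_def] b[unfolded has_field_derivative_def]
  have "((\<lambda>s. plane_vec (a s) (b s)) has_derivative (\<lambda>h. plane_vec (a' * h) (b' * h))) (at s)"
    unfolding plane_vec_def by (auto intro!: derivative_eq_intros)
  note D = diff_chain_at[OF this has_derivative_partial_2[OF assms(1)]]
  show ?thesis
    unfolding has_field_derivative_def
    by (rule has_derivative_eq_rhs[OF D[unfolded o_def]]) (simp add: fun_eq_iff algebra_simps)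
qed

definition polar_ds :: "(real^3 \<Rightarrow> real) \<Rightarrow> real \<Rightarrow> real \<Rightarrow> real" where
  "polar_ds f s t = deriv (\<lambda>s. f (polar s t)) s"
text \<open>The derivative of \<open>sin s \<partial>\<^sub>s f\<close> rather than the second derivative: this is the radial part of the round
  Laplacian multiplied by \<open>sin s\<close>, and it is continuous up to the poles.\<close>

definition polar_dss :: "(real^3 \<Rightarrow> real) \<Rightarrow> real \<Rightarrow> real \<Rightarrow> real" where
  "polar_dss f s t = deriv (\<lambda>s. sin s * polar_ds f s t) s"
definition polar_dt :: "(real^3 \<Rightarrow> real) \<Rightarrow> real \<Rightarrow> real \<Rightarrow> real" where
  "polar_dt f s t = deriv (\<lambda>t. f (polar s t)) t"
definition polar_dtt :: "(real^3 \<Rightarrow> real) \<Rightarrow> real \<Rightarrow> real \<Rightarrow> real" where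
  "polar_dtt f s t = deriv (\<lambda>t. polar_dt f s t) t"

lemma has_real_derivative_deriv: "(f has_real_derivative d) (at x) \<Longrightarrow> (f has_real_derivative deriv f x) (at x)"
  by (simp add: DERIV_imp_deriv)

context
  fixes f :: "real^3 \<Rightarrow> real" and \<sigma> :: real
  assumes f: "smooth_on_S2 f" and \<sigma>: "\<sigma> = 1 \<or> \<sigma> = -1"
begin

private definition g where "g = f \<circ> stereo \<sigma>"
private definition \<omega> where "\<omega> s = 1 / (1 - \<sigma> * cos s)" for s
private definition \<kappa> where "\<kappa> s = sin s * \<omega> s" for s
private definition U where "U s t = plane_vec (\<kappa> s * cos t) (\<kappa> s * sin t)" for s t

private lemma \<sigma>2: "\<sigma> * \<sigma> = 1" using \<sigma> by auto

private lemma region: "cos s \<noteq> \<sigma> \<Longrightarrow> 1 - \<sigma> * cos s \<noteq> 0" using \<sigma> by auto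

private lemma smooth: "smooth_on UNIV g" unfolding g_def using smooth_on_S2D[OF f \<sigma>] .

private abbreviation region_set :: "(real \<times> real) set" where
  "region_set \<equiv> {s. cos s \<noteq> \<sigma>} \<times> UNIV"

private lemma open_region: "open {s. cos s \<noteq> \<sigma>}" 
  by (intro open_Collect_neq continuous_intros)

private lemma f_polar: "cos s \<noteq> \<sigma> \<Longrightarrow> f (polar s t) = g (U s t)"
proof -
  assume s: "cos s \<noteq> \<sigma>"
  have "stereo_chart \<sigma> (polar s t) = U s t"
    by (simp add: vec_eq_iff forall_2 stereo_chart_def U_def \<kappa>_def \<omega>_def)
  then show ?thesis
    using stereo_chart_stereo[of "polar s t" \<sigma>] s \<sigma> by (simp add: g_def)
qed

private lemma kappa_deriv:
  assumes "cos s \<noteq> \<sigma>"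
  shows "(\<kappa> has_real_derivative - \<sigma> * \<omega> s) (at s)"
proof -
  let ?q = "1 - \<sigma> * cos s"
  have "(\<kappa> has_real_derivative (cos s * ?q - sin s * (\<sigma> * sin s)) / (?q * ?q)) (at s)"
    unfolding \<kappa>_def[abs_def] \<omega>_def using region[OF assms]
    by (auto intro!: derivative_eq_intros simp: field_simps)
  also have "cos s * ?q - sin s * (\<sigma> * sin s) = - \<sigma> * ?q"
    using sin_cos_squared_add[of s] \<sigma>2 by algebra
  finally show ?thesis using region[OF assms] by (simp add: \<omega>_def)
qed

private lemma along_s:
  assumes "cos s \<noteq> \<sigma>" and h: "smooth_on UNIV h"
  shows "((\<lambda>s. h (U s t)) has_real_derivative
    - \<sigma> * \<omega> s * (partial 1 h (U s t) * cos t + partial 2 h (U s t) * sin t)) (at s)"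
proof -
  note [derivative_intros] = kappa_deriv[OF assms(1)]
  show ?thesis
    unfolding U_def
    by (rule DERIV_cong[OF has_real_derivative_plane_curve[where a' = "- \<sigma> * \<omega> s * cos t" and b' = "- \<sigma> * \<omega> s * sin t"]])
      (auto intro!: derivative_eq_intros smooth_on_differentiable[OF h] simp: algebra_simps)
qed

private lemma along_t:
  assumes h: "smooth_on UNIV h"
  shows "((\<lambda>t. h (U s t)) has_real_derivative
    \<kappa> s * (- partial 1 h (U s t) * sin t + partial 2 h (U s t) * cos t)) (at t)"
    unfolding U_def
    by (rule DERIV_cong[OF has_real_derivative_plane_curve[where a' = "- \<kappa> s * sin t" and b' = "\<kappa> s * cos t"]])
      (auto intro!: derivative_eq_intros smooth_on_differentiable[OF h] simp: algebra_simps)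

private abbreviation "g1 \<equiv> partial 1 g"
private abbreviation "g2 \<equiv> partial 2 g"

private lemmas smooth' = smooth_on_partial[OF smooth, of 1] smooth_on_partial[OF smooth, of 2]

private definition Fs where "Fs s t = - \<sigma> * \<omega> s * (g1 (U s t) * cos t + g2 (U s t) * sin t)" for s t
private definition E where "E s t = \<omega> s * ((g1 (U s t) * cos t + g2 (U s t) * sin t)
  + \<kappa> s * ((partial 1 g1 (U s t) * cos t + partial 2 g1 (U s t) * sin t) * cos t
    + (partial 1 g2 (U s t) * cos t + partial 2 g2 (U s t) * sin t) * sin t))" for s t
private definition Ft where "Ft s t = \<kappa> s * (- g1 (U s t) * sin t + g2 (U s t) * cos t)" for s t
private definition Ftt where "Ftt s t = \<kappa> s * (- g1 (U s t) * cos t - g2 (U s t) * sin t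
  + \<kappa> s * (- (- partial 1 g1 (U s t) * sin t + partial 2 g1 (U s t) * cos t) * sin t
    + (- partial 1 g2 (U s t) * sin t + partial 2 g2 (U s t) * cos t) * cos t))" for s t

private lemma Fs:
  assumes "cos s \<noteq> \<sigma>" shows "((\<lambda>s. f (polar s t)) has_real_derivative Fs s t) (at s)" "polar_ds f s t = Fs s t"
proof -
  show 1: "((\<lambda>s. f (polar s t)) has_real_derivative Fs s t) (at s)"
    using along_s[OF assms smooth] unfolding Fs_def
    by (rule has_field_derivative_transform_within_open[OF _ open_region]) (use assms f_polar in auto)
  then show "polar_ds f s t = Fs s t" by (simp add: polar_ds_def DERIV_imp_deriv)
qed

private lemma E:
  assumes "cos s \<noteq> \<sigma>" shows "((\<lambda>s. sin s * polar_ds f s t) has_real_derivative E s t) (at s)" "polar_dss f s t = E s t"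
proof -
  note [derivative_intros] = kappa_deriv[OF assms(1)] along_s[OF assms smooth'(1)] along_s[OF assms smooth'(2)]
  have "((\<lambda>s. - \<sigma> * \<kappa> s * (g1 (U s t) * cos t + g2 (U s t) * sin t)) has_real_derivative 
    (\<sigma> * \<sigma>) * E s t) (at s)"
    unfolding E_def by (auto intro!: derivative_eq_intros simp: algebra_simps)
  then have "((\<lambda>s. - \<sigma> * \<kappa> s * (g1 (U s t) * cos t + g2 (U s t) * sin t)) has_real_derivative 
     E s t) (at s)" by (simp only: \<sigma>2 mult_1)
  then show 1: "((\<lambda>s. sin s * polar_ds f s t) has_real_derivative E s t) (at s)"
    by (rule has_field_derivative_transform_within_open[OF _ open_region]) (use assms Fs(2) in \<open>auto simp: Fs_def \<kappa>_def\<close>)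
  then show "polar_dss f s t = E s t" by (simp add: polar_dss_def DERIV_imp_deriv)
qed

private lemma Ft:
  assumes "cos s \<noteq> \<sigma>" shows "((\<lambda>t. f (polar s t)) has_real_derivative Ft s t) (at t)" "polar_dt f s t = Ft s t"
proof -
  show 1: "((\<lambda>t. f (polar s t)) has_real_derivative Ft s t) (at t)"
    using along_t[OF smooth] unfolding Ft_def f_polar[OF assms] .
  then show "polar_dt f s t = Ft s t" by (simp add: polar_dt_def DERIV_imp_deriv)
qed

private lemma Ftt:
  assumes "cos s \<noteq> \<sigma>" shows "((\<lambda>t. polar_dt f s t) has_real_derivative Ftt s t) (at t)" "polar_dtt f s t = Ftt s t"
proof -
  note [derivative_intros] = along_t[OF smooth'(1)] along_t[OF smooth'(2)]
  show 1: "((\<lambda>t. polar_dt f s t) has_real_derivative Ftt s t) (at t)"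
    unfolding Ft(2)[OF assms] Ft_def Ftt_def by (auto intro!: derivative_eq_intros simp: algebra_simps)
  then show "polar_dtt f s t = Ftt s t" by (simp add: polar_dtt_def DERIV_imp_deriv)
qed

private lemma continuous_\<omega>: "continuous_on region_set (\<lambda>p. \<omega> (fst p))"
  unfolding \<omega>_def using region by (auto intro!: continuous_intros)

private lemma continuous_\<kappa>: "continuous_on region_set (\<lambda>p. \<kappa> (fst p))"
  unfolding \<kappa>_def by (intro continuous_intros continuous_\<omega>)

private lemma continuous_U:
  assumes "smooth_on UNIV h"
  shows "continuous_on region_set (\<lambda>p. h (U (fst p) (snd p)))"
  unfolding U_def plane_vec_def
  by (intro continuous_on_compose2[OF smooth_on_continuous[OF assms, of UNIV]] continuous_intros continuous_\<kappa>) auto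

lemma polar_derivatives_chart:
  assumes "cos s \<noteq> \<sigma>"
  shows "((\<lambda>s. f (polar s t)) has_real_derivative polar_ds f s t) (at s)"
    "((\<lambda>s. sin s * polar_ds f s t) has_real_derivative polar_dss f s t) (at s)"
    "((\<lambda>t. f (polar s t)) has_real_derivative polar_dt f s t) (at t)"
    "((\<lambda>t. polar_dt f s t) has_real_derivative polar_dtt f s t) (at t)"
  using Fs[OF assms] E[OF assms] Ft[OF assms] Ftt[OF assms] by metis+

lemma polar_continuous_chart:
  "continuous_on region_set (\<lambda>p. f (polar (fst p) (snd p)))"
  "continuous_on region_set (\<lambda>p. polar_ds f (fst p) (snd p))"
  "continuous_on region_set (\<lambda>p. polar_dss f (fst p) (snd p))"
  "continuous_on region_set (\<lambda>p. polar_dt f (fst p) (snd p))"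
  "continuous_on region_set (\<lambda>p. polar_dtt f (fst p) (snd p))"
proof -
  note c = continuous_\<omega> continuous_\<kappa> continuous_U[OF smooth'(1)] continuous_U[OF smooth'(2)]
    continuous_U[OF smooth_on_partial[OF smooth'(1)]] continuous_U[OF smooth_on_partial[OF smooth'(2)]]
  show "continuous_on region_set (\<lambda>p. f (polar (fst p) (snd p)))"
    using continuous_U[OF smooth]
    by (rule continuous_on_eq) (auto simp: f_polar)
  show "continuous_on region_set (\<lambda>p. polar_ds f (fst p) (snd p))"
    by (rule continuous_on_eq[of _ "\<lambda>p. Fs (fst p) (snd p)"])
      (auto simp: Fs Fs_def intro!: continuous_intros c)
  show "continuous_on region_set (\<lambda>p. polar_dss f (fst p) (snd p))"
    by (rule continuous_on_eq[of _ "\<lambda>p. E (fst p) (snd p)"])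
      (auto simp: E E_def intro!: continuous_intros c)
  show "continuous_on region_set (\<lambda>p. polar_dt f (fst p) (snd p))"
    by (rule continuous_on_eq[of _ "\<lambda>p. Ft (fst p) (snd p)"])
      (auto simp: Ft Ft_def intro!: continuous_intros c)
  show "continuous_on region_set (\<lambda>p. polar_dtt f (fst p) (snd p))"
    by (rule continuous_on_eq[of _ "\<lambda>p. Ftt (fst p) (snd p)"])
      (auto simp: Ftt Ftt_def intro!: continuous_intros c)
qed

text \<open>Since \<open>sin s d/ds = - \<sigma> \<kappa> d/d\<kappa>\<close>, this is the polar form
  \<open>(\<kappa> \<partial>\<^sub>\<kappa>)\<^sup>2 + \<partial>\<^sub>t\<^sup>2 = \<kappa>\<^sup>2 \<Delta>\<close> of the flat Laplacian.\<close>

lemma polar_laplace_chart: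
  assumes s: "cos s \<noteq> \<sigma>"
  shows "sin s * polar_dss f s t + polar_dtt f s t = (\<kappa> s)\<^sup>2 * laplacian2 g (U s t)"
proof -
  show ?thesis
    unfolding E(2)[OF s] Ftt(2)[OF s] E_def Ftt_def laplacian2_def \<kappa>_def
    using sin_cos_squared_add[of t] by algebra
qed

lemma polar_laplace:
  assumes "sin s \<noteq> 0" "\<sigma> = 1"
  shows "(sin s)\<^sup>2 * laplace_beltrami round_metric f (polar s t) = sin s * polar_dss f s t + polar_dtt f s t"
proof -
  have s: "cos s \<noteq> \<sigma>" using assms cos_one_sin_zero by auto
  have "polar s t \<noteq> vector [0, 0, 1]"
    using s assms(2) by (auto dest: arg_cong[where f = "\<lambda>v. v $ 3"])
  then have cs: "chart_sign (polar s t) = \<sigma>" by (simp add: chart_sign_def assms)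
  have U: "stereo_chart \<sigma> (polar s t) = U s t"
    by (simp add: vec_eq_iff forall_2 stereo_chart_def U_def \<kappa>_def \<omega>_def)
  have "stereo_denom (U s t) = 1 + (\<kappa> s)\<^sup>2"
    unfolding stereo_denom_def U_def plane_vec_nth using sin_cos_squared_add[of t] by algebra
  also have "\<dots> = 2 * \<omega> s"
  proof -
    let ?q = "1 - cos s"
    have q: "?q \<noteq> 0" using region[OF s] assms(2) by simp
    have "1 + (sin s / ?q)\<^sup>2 = (?q\<^sup>2 + (sin s)\<^sup>2) / ?q\<^sup>2"
      using q by (simp add: add_divide_distrib power_divide)
    also have "?q\<^sup>2 + (sin s)\<^sup>2 = 2 * ?q" using sin_cos_squared_add[of s] by algebra
    also have "2 * r / r\<^sup>2 = 2 * (1 / r)" if "r \<noteq> 0" for r :: real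
      using that by (simp add: power2_eq_square)
    from this[OF q] have "2 * ?q / ?q\<^sup>2 = 2 * (1 / ?q)" .
    finally show ?thesis
      unfolding \<kappa>_def \<omega>_def by (simp add: assms(2))
  qed
  finally have D: "stereo_denom (U s t) = 2 * \<omega> s" .
  show ?thesis
    unfolding polar_laplace_chart[OF s] laplace_beltrami_round[OF polar_in_S2] cs U D g_def
    by (simp add: \<kappa>_def power2_eq_square)
qed

end

lemma polar_derivatives:
  assumes "smooth_on_S2 f"
  shows "((\<lambda>s. f (polar s t)) has_real_derivative polar_ds f s t) (at s)"
    "((\<lambda>s. sin s * polar_ds f s t) has_real_derivative polar_dss f s t) (at s)"
    "((\<lambda>t. f (polar s t)) has_real_derivative polar_dt f s t) (at t)"
    "((\<lambda>t. polar_dt f s t) has_real_derivative polar_dtt f s t) (at t)"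
  using polar_derivatives_chart[OF assms, of 1 s t] polar_derivatives_chart[OF assms, of "-1" s t]
  by (cases "cos s = 1"; simp)+

text \<open>Each chart covers the parameters with \<open>cos s \<noteq> \<sigma>\<close>, so the two charts together cover the whole
  parameter plane, the poles included.\<close>

lemma continuous_on_two_regions:
  fixes h :: "real \<times> real \<Rightarrow> real"
  assumes "\<And>\<sigma>::real. \<sigma> = 1 \<or> \<sigma> = -1 \<Longrightarrow> continuous_on ({s. cos s \<noteq> \<sigma>} \<times> UNIV) h"
  shows "continuous_on UNIV h"
proof -
  have o: "open ({s. cos s \<noteq> \<sigma>} \<times> (UNIV::real set))" for \<sigma> :: real
    by (intro open_Times open_Collect_neq continuous_intros) auto
  have "continuous_on ({s. cos s \<noteq> 1} \<times> UNIV \<union> {s. cos s \<noteq> -1} \<times> UNIV) h"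
    by (intro continuous_on_open_Un o assms) auto
  also have "{s. cos s \<noteq> 1} \<times> UNIV \<union> {s. cos s \<noteq> -1} \<times> UNIV = (UNIV :: (real \<times> real) set)" by auto
  finally show ?thesis .
qed

lemma polar_continuous:
  assumes "smooth_on_S2 f"
  shows "continuous_on UNIV (\<lambda>p. f (polar (fst p) (snd p)))"
    "continuous_on UNIV (\<lambda>p. polar_ds f (fst p) (snd p))"
    "continuous_on UNIV (\<lambda>p. polar_dss f (fst p) (snd p))"
    "continuous_on UNIV (\<lambda>p. polar_dt f (fst p) (snd p))"
    "continuous_on UNIV (\<lambda>p. polar_dtt f (fst p) (snd p))"
  using polar_continuous_chart[OF assms] by (blast intro: continuous_on_two_regions)+

section \<open>Green's formula and a lower bound for the Dirichlet energy\<close>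

text \<open>Polar expressions are continuous on the whole parameter plane. Asking for this rather than for
  continuity on a rectangle spares side conditions on the parameters.\<close>

definition cont2 :: "(real \<Rightarrow> real \<Rightarrow> real) \<Rightarrow> bool" where
  "cont2 K \<longleftrightarrow> continuous_on UNIV (\<lambda>p. K (fst p) (snd p))"

text \<open>The area density \<open>sin s\<close> is kept in the integrand, so that expressions such as \<open>polar_dss\<close>, where it
  has been absorbed, can be integrated too.\<close>

definition box_integral :: "(real \<Rightarrow> real \<Rightarrow> real) \<Rightarrow> real" where
  "box_integral K = integral {0..pi} (\<lambda>s. integral {0..2*pi} (K s))"

lemma cont2_polar:
  assumes "smooth_on_S2 f"
  shows "cont2 (\<lambda>s t. f (polar s t))" "cont2 (polar_ds f)" "cont2 (polar_dss f)" "cont2 (polar_dt f)" "cont2 (polar_dtt f)"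
  using polar_continuous[OF assms] by (simp_all add: cont2_def)

lemma cont2_intros:
  "continuous_on UNIV a \<Longrightarrow> cont2 (\<lambda>s t. a s)"
  "cont2 K \<Longrightarrow> cont2 L \<Longrightarrow> cont2 (\<lambda>s t. K s t + L s t)"
  "cont2 K \<Longrightarrow> cont2 L \<Longrightarrow> cont2 (\<lambda>s t. K s t - L s t)"
  "cont2 K \<Longrightarrow> cont2 L \<Longrightarrow> cont2 (\<lambda>s t. K s t * L s t)"
  "cont2 K \<Longrightarrow> cont2 (\<lambda>s t. (K s t)^n)"
  unfolding cont2_def by (auto intro!: continuous_intros continuous_on_compose2[of UNIV a])

lemma cont2_slice:
  assumes "cont2 K"
  shows "continuous_on A (K s)"
proof -
  have "continuous_on A (\<lambda>t. (s, t))" by (intro continuous_intros)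
  from continuous_on_compose2[OF assms[unfolded cont2_def] this] show ?thesis by simp
qed

lemma cont2_slice':
  assumes "cont2 K"
  shows "continuous_on A (\<lambda>s. K s t)"
proof -
  have "continuous_on A (\<lambda>s. (s, t))" by (intro continuous_intros)
  from continuous_on_compose2[OF assms[unfolded cont2_def] this] show ?thesis by simp
qed

lemma cont2_integrable: "cont2 K \<Longrightarrow> K s integrable_on {a..b}"
  by (rule integrable_continuous_real) (rule cont2_slice)

lemma cont2_split: "cont2 K \<Longrightarrow> continuous_on A (\<lambda>(s, t). K s t)"
  by (auto simp: cont2_def split_def intro: continuous_on_subset)

lemma cont2_inner: "cont2 K \<Longrightarrow> continuous_on A (\<lambda>s. integral {a..b} (K s))"
  using integral_continuous_on_param[OF cont2_split[of K "A \<times> cbox a b"]] by simp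

lemma cont2_inner_integrable: "cont2 K \<Longrightarrow> (\<lambda>s. integral {a..b} (K s)) integrable_on {c..d}"
  by (rule integrable_continuous_real) (rule cont2_inner)

lemma box_integral_add:
  assumes "cont2 K" "cont2 L"
  shows "box_integral (\<lambda>s t. K s t + L s t) = box_integral K + box_integral L"
proof -
  have "box_integral (\<lambda>s t. K s t + L s t)
      = integral {0..pi} (\<lambda>s. integral {0..2*pi} (K s) + integral {0..2*pi} (L s))"
    unfolding box_integral_def by (intro integral_cong integral_add cont2_integrable assms)
  then show ?thesis
    unfolding box_integral_def by (simp add: integral_add cont2_inner_integrable assms)
qed

lemma box_integral_diff:
  assumes "cont2 K" "cont2 L"
  shows "box_integral (\<lambda>s t. K s t - L s t) = box_integral K - box_integral L"
  using box_integral_add[OF cont2_intros(3)[OF assms] assms(2)] by simp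

lemma box_integral_cmult: "box_integral (\<lambda>s t. c * K s t) = c * box_integral K"
  unfolding box_integral_def by simp

lemma box_integral_sum:
  "(\<And>i. i \<in> I \<Longrightarrow> cont2 (K i)) \<Longrightarrow> box_integral (\<lambda>s t. \<Sum>i\<in>I. K i s t) = (\<Sum>i\<in>I. box_integral (K i))"
proof (induction I rule: infinite_finite_induct)
  case (insert i I)
  have "cont2 (\<lambda>s t. \<Sum>i\<in>I. K i s t)"
    using insert.prems by (auto simp: cont2_def intro!: continuous_on_sum)
  then show ?case using insert by (simp add: box_integral_add)
qed (simp_all add: box_integral_def)

text \<open>A nonnegative continuous function with integral \<open>0\<close> vanishes; this is applied to both integrations.\<close>

lemma box_integral_eq_0:
  assumes K: "cont2 K" and nonneg: "\<And>s t. s \<in> {0..pi} \<Longrightarrow> K s t \<ge> 0" and 0: "box_integral K \<le> 0"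
    and s: "s \<in> {0..pi}" and t: "t \<in> {0..2*pi}"
  shows "K s t = 0"
proof -
  have ge: "integral {0..2*pi} (K s) \<ge> 0" if "s \<in> {0..pi}" for s
    using nonneg that by (intro integral_nonneg cont2_integrable K) auto
  then have "box_integral K \<ge> 0"
    unfolding box_integral_def by (rule integral_nonneg[OF cont2_inner_integrable[OF K]])
  with 0 have "((\<lambda>s. integral {0..2*pi} (K s)) has_integral 0) (cbox 0 pi)"
    using integrable_integral[OF cont2_inner_integrable[OF K, of 0 "2*pi" 0 pi]]
    by (simp add: box_integral_def)
  then have "integral {0..2*pi} (K s) = 0"
    by (rule has_integral_0_cbox_imp_0[rotated 2]) (use s ge pi_gt_zero in \<open>auto intro: cont2_inner K simp del: pi_gt_zero\<close>)
  then have "(K s has_integral 0) (cbox 0 (2*pi))"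
    using integrable_integral[OF cont2_integrable[OF K, of s 0 "2*pi"]] by simp
  then show ?thesis
    by (rule has_integral_0_cbox_imp_0[rotated 2]) (use s t nonneg pi_gt_zero in \<open>auto intro: cont2_slice K simp del: pi_gt_zero\<close>)
qed

lemma box_integral_swap:
  assumes "cont2 K"
  shows "box_integral K = integral {0..2*pi} (\<lambda>t. integral {0..pi} (\<lambda>s. K s t))"
  unfolding box_integral_def
  using integral_swap_continuous[of 0 0 pi "2*pi" K, OF cont2_split[OF assms]] by simp

lemma polar_periodic: "polar s (t + 2 * pi) = polar s t"
  by (simp add: polar_def)

lemma polar_dt_periodic:
  assumes "smooth_on_S2 f"
  shows "polar_dt f s (t + 2 * pi) = polar_dt f s t"
proof -
  have "((\<lambda>t. f (polar s (t + 2 * pi))) has_real_derivative polar_dt f s (t + 2*pi)) (at t)"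
    using polar_derivatives(3)[OF assms, of s "t + 2 * pi"] by (simp only: DERIV_shift)
  then show ?thesis
    using polar_derivatives(3)[OF assms, of s t] unfolding polar_periodic by (rule DERIV_unique)
qed

lemma integral_by_parts_t:
  assumes f: "smooth_on_S2 f" and h: "smooth_on_S2 h"
  shows "integral {0..2*pi} (\<lambda>t. f (polar s t) * polar_dtt h s t)
    = - integral {0..2*pi} (\<lambda>t. polar_dt f s t * polar_dt h s t)"
proof -
  note [derivative_intros] = polar_derivatives(3,4)[OF f, THEN has_field_derivative_at_within]
    polar_derivatives(3,4)[OF h, THEN has_field_derivative_at_within]
  note [continuous_intros] = cont2_slice[OF cont2_polar(1)[OF f]] cont2_slice[OF cont2_polar(4)[OF h]]
    cont2_slice[OF cont2_polar(4)[OF f]] cont2_slice[OF cont2_polar(5)[OF h]]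
  have "((\<lambda>t. f (polar s t) * polar_dtt h s t + polar_dt f s t * polar_dt h s t) has_integral
      f (polar s (2*pi)) * polar_dt h s (2*pi) - f (polar s 0) * polar_dt h s 0) {0..2*pi}"
    by (rule fundamental_theorem_of_calculus)
      (auto intro!: derivative_eq_intros has_vector_derivative_at_within
        simp flip: has_real_derivative_iff_has_vector_derivative)
  moreover have "f (polar s (2*pi)) * polar_dt h s (2*pi) = f (polar s 0) * polar_dt h s 0"
    using polar_periodic[of s 0] polar_dt_periodic[OF h, of s 0] by simp
  ultimately have "integral {0..2*pi} (\<lambda>t. f (polar s t) * polar_dtt h s t + polar_dt f s t * polar_dt h s t) = 0"
    by (simp add: integral_unique)
  then show ?thesis
    by (subst (asm) integral_add) (auto intro!: integrable_continuous_real continuous_intros)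
qed

text \<open>For fixed \<open>t\<close> the boundary terms contain the factor \<open>sin s\<close> and vanish at the poles.\<close>

lemma integral_by_parts_s:
  assumes f: "smooth_on_S2 f" and h: "smooth_on_S2 h"
  shows "box_integral (\<lambda>s t. f (polar s t) * polar_dss h s t)
    = - box_integral (\<lambda>s t. sin s * (polar_ds f s t * polar_ds h s t))"
proof -
  have c: "cont2 (\<lambda>s t. f (polar s t) * polar_dss h s t)" "cont2 (\<lambda>s t. sin s * (polar_ds f s t * polar_ds h s t))"
    by (intro cont2_intros cont2_polar f h continuous_intros)+
  have "((\<lambda>s. f (polar s t) * polar_dss h s t + sin s * (polar_ds f s t * polar_ds h s t)) has_integral
      f (polar pi t) * (sin pi * polar_ds h pi t) - f (polar 0 t) * (sin 0 * polar_ds h 0 t)) {0..pi}" for t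
  proof (rule fundamental_theorem_of_calculus)
    fix s
    have "((\<lambda>s. f (polar s t) * (sin s * polar_ds h s t)) has_real_derivative
        f (polar s t) * polar_dss h s t + sin s * (polar_ds f s t * polar_ds h s t)) (at s)"
      using DERIV_mult[OF polar_derivatives(1)[OF f, where s = s and t = t] polar_derivatives(2)[OF h, where s = s and t = t]] by (simp add: algebra_simps)
    then show "((\<lambda>s. f (polar s t) * (sin s * polar_ds h s t)) has_vector_derivative
        f (polar s t) * polar_dss h s t + sin s * (polar_ds f s t * polar_ds h s t)) (at s within {0..pi})"
      by (simp add: has_real_derivative_iff_has_vector_derivative has_vector_derivative_at_within)
  qed simp
  then have "integral {0..pi} (\<lambda>s. f (polar s t) * polar_dss h s t + sin s * (polar_ds f s t * polar_ds h s t)) = 0" for t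
    by (simp add: integral_unique)
  then have "box_integral (\<lambda>s t. f (polar s t) * polar_dss h s t + sin s * (polar_ds f s t * polar_ds h s t)) = 0"
    using box_integral_swap[OF cont2_intros(2)[OF c]] by simp
  then show ?thesis using box_integral_add[OF c] by simp
qed

text \<open>If \<open>w\<close> represents \<open>- \<Delta>\<^sub>0 h\<close>, this is \<open>(\<integral> \<partial>\<^sub>t f \<partial>\<^sub>t h dt) / sin s\<close> for \<open>0 < s < \<pi>\<close>. Written
  without division by \<open>sin s\<close> it is continuous up to the poles.\<close>

definition angular_energy :: "(real^3 \<Rightarrow> real) \<Rightarrow> (real^3 \<Rightarrow> real) \<Rightarrow> (real \<Rightarrow> real \<Rightarrow> real) \<Rightarrow> real \<Rightarrow> real" where
  "angular_energy f h w s = integral {0..2*pi} (\<lambda>t. f (polar s t) * (sin s * w s t + polar_dss h s t))"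

text \<open>\<open>w\<close> represents \<open>- \<Delta>\<^sub>0 h\<close> in polar coordinates. The poles are left out because the polar formula for
  the Laplacian degenerates there; they do not affect integrals of the continuous function \<open>w\<close>.\<close>

definition neg_laplacian :: "(real^3 \<Rightarrow> real) \<Rightarrow> (real \<Rightarrow> real \<Rightarrow> real) \<Rightarrow> bool" where
  "neg_laplacian h w \<longleftrightarrow> cont2 w \<and> (\<forall>s\<in>{0<..<pi}. \<forall>t. w s t = - laplace_beltrami round_metric h (polar s t))"

lemma green_formula:
  assumes f: "smooth_on_S2 f" and h: "smooth_on_S2 h" and w: "cont2 w"
  shows "box_integral (\<lambda>s t. sin s * (f (polar s t) * w s t))
    = box_integral (\<lambda>s t. sin s * (polar_ds f s t * polar_ds h s t)) + integral {0..pi} (angular_energy f h w)"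
proof -
  have c: "cont2 (\<lambda>s t. sin s * (f (polar s t) * w s t))" "cont2 (\<lambda>s t. f (polar s t) * polar_dss h s t)"
    by (intro cont2_intros cont2_polar f h w continuous_intros)+
  have "integral {0..pi} (angular_energy f h w)
      = box_integral (\<lambda>s t. sin s * (f (polar s t) * w s t) + f (polar s t) * polar_dss h s t)"
    unfolding box_integral_def angular_energy_def by (simp add: algebra_simps)
  also have "\<dots> = box_integral (\<lambda>s t. sin s * (f (polar s t) * w s t))
      - box_integral (\<lambda>s t. sin s * (polar_ds f s t * polar_ds h s t))"
    by (simp add: box_integral_add[OF c] integral_by_parts_s[OF f h])
  finally show ?thesis by simp
qed

lemma angular_energy:
  assumes f: "smooth_on_S2 f" and h: "smooth_on_S2 h" and w: "neg_laplacian h w" and s: "s \<in> {0<..<pi}"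
  shows "sin s * angular_energy f h w s = integral {0..2*pi} (\<lambda>t. polar_dt f s t * polar_dt h s t)"
proof -
  have s0: "sin s \<noteq> 0" using s by (auto simp: sin_gt_zero less_imp_neq[symmetric])
  have w': "sin s * (sin s * w s t + polar_dss h s t) = - polar_dtt h s t" for t
    using polar_laplace[OF h _ s0 refl, of t] w s
    by (simp add: neg_laplacian_def power2_eq_square algebra_simps)
  have "sin s * angular_energy f h w s = integral {0..2*pi} (\<lambda>t. f (polar s t) * (sin s * (sin s * w s t + polar_dss h s t)))"
    unfolding angular_energy_def integral_mult_right[symmetric] by (simp add: algebra_simps)
  also have "\<dots> = - integral {0..2*pi} (\<lambda>t. f (polar s t) * polar_dtt h s t)"
    unfolding w' by simp
  finally show ?thesis by (simp add: integral_by_parts_t[OF f h])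
qed

lemma green_symmetric:
  assumes f: "smooth_on_S2 f" "neg_laplacian f v" and h: "smooth_on_S2 h" "neg_laplacian h w"
  shows "box_integral (\<lambda>s t. sin s * (f (polar s t) * w s t)) = box_integral (\<lambda>s t. sin s * (h (polar s t) * v s t))"
proof -
  have "angular_energy f h w s = angular_energy h f v s" if s: "s \<in> {0<..<pi}" for s
  proof -
    have "sin s * angular_energy f h w s = sin s * angular_energy h f v s"
      using angular_energy[OF f(1) h s] angular_energy[OF h(1) f s] by (simp add: mult.commute)
    moreover have "sin s \<noteq> 0" using s by (auto simp: sin_gt_zero less_imp_neq[symmetric])
    ultimately show ?thesis by simp
  qed
  then have "integral {0..pi} (angular_energy f h w) = integral {0..pi} (angular_energy h f v)"
    by (intro integral_spike[of "{0, pi}"]) (auto simp: less_le)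
  then show ?thesis
    using green_formula[OF f(1) h(1), of w] green_formula[OF h(1) f(1), of v] f(2) h(2)
    by (simp add: neg_laplacian_def mult.commute[of "polar_ds f _ _"])
qed

definition latitude_mean :: "(real^3 \<Rightarrow> real) \<Rightarrow> real \<Rightarrow> real" where
  "latitude_mean f s = integral {0..2*pi} (\<lambda>t. f (polar s t)) / (2 * pi)"

definition latitude_mean_ds :: "(real^3 \<Rightarrow> real) \<Rightarrow> real \<Rightarrow> real" where
  "latitude_mean_ds f s = integral {0..2*pi} (polar_ds f s) / (2 * pi)"

lemma latitude_mean_derivative:
  assumes f: "smooth_on_S2 f"
  shows "(latitude_mean f has_real_derivative latitude_mean_ds f s) (at s)"
proof -
  have "((\<lambda>s. integral (cbox 0 (2*pi)) (\<lambda>t. f (polar s t))) has_real_derivative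
      integral (cbox 0 (2*pi)) (polar_ds f s)) (at s within UNIV)"
    by (rule leibniz_rule_field_derivative)
      (use polar_derivatives(1)[OF f] cont2_integrable[OF cont2_polar(1)[OF f]] cont2_split[OF cont2_polar(2)[OF f]] in auto)
  then show ?thesis
    unfolding latitude_mean_def latitude_mean_ds_def by (auto intro!: derivative_eq_intros)
qed

lemma continuous_latitude_mean:
  assumes "smooth_on_S2 f"
  shows "continuous_on A (latitude_mean f)" "continuous_on A (latitude_mean_ds f)"
  unfolding latitude_mean_def latitude_mean_ds_def
  by (intro continuous_intros cont2_inner cont2_polar assms; simp)+

lemma integral_square_mean:
  fixes v :: "real \<Rightarrow> real"
  assumes v: "continuous_on {0..2*pi} v" and m: "m = integral {0..2*pi} v / (2 * pi)"
  shows "integral {0..2*pi} (\<lambda>t. (v t)\<^sup>2) = integral {0..2*pi} (\<lambda>t. (v t - m)\<^sup>2) + 2 * pi * m\<^sup>2"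
proof -
  have i: "v integrable_on {0..2*pi}" "(\<lambda>t. (v t)\<^sup>2) integrable_on {0..2*pi}"
    by (intro integrable_continuous_real continuous_intros v)+
  have "((\<lambda>t. (v t)\<^sup>2 - 2 * m * v t + m\<^sup>2) has_integral
      integral {0..2*pi} (\<lambda>t. (v t)\<^sup>2) - 2 * m * integral {0..2*pi} v + m\<^sup>2 * (2 * pi)) {0..2*pi}"
    using has_integral_const_real[of "m\<^sup>2" 0 "2*pi"]
    by (intro has_integral_add has_integral_diff has_integral_mult_right integrable_integral i) (simp add: mult.commute)
  moreover have "(\<lambda>t. (v t)\<^sup>2 - 2 * m * v t + m\<^sup>2) = (\<lambda>t. (v t - m)\<^sup>2)"
    by (simp add: fun_eq_iff power2_eq_square algebra_simps)
  ultimately have "integral {0..2*pi} (\<lambda>t. (v t - m)\<^sup>2)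
      = integral {0..2*pi} (\<lambda>t. (v t)\<^sup>2) - 2 * m * integral {0..2*pi} v + m\<^sup>2 * (2 * pi)"
    by (simp add: integral_unique)
  moreover have "integral {0..2*pi} v = 2 * pi * m" using m by simp
  ultimately show ?thesis by (simp add: power2_eq_square algebra_simps)
qed

text \<open>On a circle of latitude, \<open>f\<close> splits into its mean \<open>m\<close> and a part with mean zero. For the latter
  Wirtinger's inequality bounds the angular energy from below by \<open>\<integral> (f - m)\<^sup>2 / sin s\<close>, which
  dominates \<open>sin s \<gamma> \<integral> (f - m)\<^sup>2\<close> because \<open>(sin s)\<^sup>2 \<gamma> \<le> 1\<close>. For the mean, the energy in the
  \<open>s\<close> direction is at least that of \<open>m\<close>, which is controlled by assumption.\<close>

lemma spectral_lower_bound: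
  assumes f: "smooth_on_S2 f" and w: "neg_laplacian f w"
    and \<gamma>: "continuous_on UNIV \<gamma>" "\<And>s. s \<in> {0..pi} \<Longrightarrow> \<gamma> s \<ge> 0" "\<And>s. s \<in> {0..pi} \<Longrightarrow> (sin s)\<^sup>2 * \<gamma> s \<le> 1"
    and mean: "integral {0..pi} (\<lambda>s. sin s * \<gamma> s * (latitude_mean f s)\<^sup>2)
      \<le> integral {0..pi} (\<lambda>s. sin s * (latitude_mean_ds f s)\<^sup>2)"
  shows "box_integral (\<lambda>s t. sin s * (\<gamma> s * (f (polar s t))\<^sup>2)) \<le> box_integral (\<lambda>s t. sin s * (f (polar s t) * w s t))"
proof -
  let ?m = "latitude_mean f" and ?m' = "latitude_mean_ds f" and ?A = "angular_energy f f w"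
  note cm = continuous_latitude_mean[OF f]
  note c = cont2_polar[OF f]
  have w': "cont2 w" using w by (simp add: neg_laplacian_def)
  have cA: "continuous_on {0..pi} ?A"
    unfolding angular_energy_def by (intro cont2_inner cont2_intros c w' continuous_intros)
  have "integral {0..2*pi} (\<lambda>t. sin s * (\<gamma> s * (f (polar s t))\<^sup>2)) \<le> ?A s + 2 * pi * (sin s * \<gamma> s * (?m s)\<^sup>2)"
    if s: "s \<in> {0<..<pi}" for s
  proof -
    have s0: "sin s > 0" using s by (auto simp: sin_gt_zero)
    let ?V = "integral {0..2*pi} (\<lambda>t. (f (polar s t) - ?m s)\<^sup>2)"
    have V0: "?V \<ge> 0"
      by (intro integral_nonneg integrable_continuous_real continuous_intros cont2_slice[OF c(1)]) auto
    have "?V \<le> integral {0..2*pi} (\<lambda>t. (polar_dt f s t)\<^sup>2)"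
      by (rule wirtinger_periodic)
        (auto intro: polar_derivatives f cont2_slice c simp: polar_periodic latitude_mean_def)
    also have "\<dots> = sin s * ?A s"
      unfolding angular_energy[OF f f w s] by (simp add: power2_eq_square)
    finally have V: "?V \<le> sin s * ?A s" .
    have "(sin s)\<^sup>2 * \<gamma> s * ?V \<le> 1 * ?V"
      using \<gamma>(3)[of s] s V0 by (intro mult_right_mono) auto
    with V have "sin s * (sin s * \<gamma> s * ?V) \<le> sin s * ?A s" by (simp add: power2_eq_square algebra_simps)
    then have 1: "sin s * \<gamma> s * ?V \<le> ?A s" using s0 by simp
    have "integral {0..2*pi} (\<lambda>t. sin s * (\<gamma> s * (f (polar s t))\<^sup>2)) = sin s * \<gamma> s * integral {0..2*pi} (\<lambda>t. (f (polar s t))\<^sup>2)"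
      by simp
    also have "integral {0..2*pi} (\<lambda>t. (f (polar s t))\<^sup>2) = ?V + 2 * pi * (?m s)\<^sup>2"
      by (rule integral_square_mean) (auto intro: cont2_slice c simp: latitude_mean_def)
    finally show ?thesis using 1 by (simp add: algebra_simps)
  qed
  then have "box_integral (\<lambda>s t. sin s * (\<gamma> s * (f (polar s t))\<^sup>2))
      \<le> integral {0..pi} (\<lambda>s. ?A s + 2 * pi * (sin s * \<gamma> s * (?m s)\<^sup>2))"
    unfolding box_integral_def
    by (intro integral_le_integral_interior cont2_inner_integrable cont2_intros c continuous_intros
        integrable_continuous_real cA cm continuous_on_subset[OF \<gamma>(1)]) auto
  also have "\<dots> = integral {0..pi} ?A + 2 * pi * integral {0..pi} (\<lambda>s. sin s * \<gamma> s * (?m s)\<^sup>2)"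
    by (subst integral_add)
      (auto intro!: integrable_continuous_real continuous_intros cA cm continuous_on_subset[OF \<gamma>(1)])
  also have "\<dots> \<le> integral {0..pi} ?A + 2 * pi * integral {0..pi} (\<lambda>s. sin s * (?m' s)\<^sup>2)"
    using mean by simp
  also have "2 * pi * integral {0..pi} (\<lambda>s. sin s * (?m' s)\<^sup>2) = integral {0..pi} (\<lambda>s. 2 * pi * (sin s * (?m' s)\<^sup>2))"
    by simp
  also have "\<dots> \<le> box_integral (\<lambda>s t. sin s * (polar_ds f s t * polar_ds f s t))"
    unfolding box_integral_def
  proof (rule integral_le_integral_interior)
    show "(\<lambda>s. integral {0..2*pi} (\<lambda>t. sin s * (polar_ds f s t * polar_ds f s t))) integrable_on {0..pi}"
      by (intro cont2_inner_integrable cont2_intros c continuous_intros)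
    fix s :: real assume s: "s \<in> {0<..<pi}"
    have s0: "sin s > 0" using s by (auto simp: sin_gt_zero)
    have "integral {0..2*pi} (\<lambda>t. (polar_ds f s t - ?m' s)\<^sup>2) \<ge> 0"
      by (intro integral_nonneg integrable_continuous_real continuous_intros cont2_slice[OF c(2)]) auto
    then have "2 * pi * (?m' s)\<^sup>2 \<le> integral {0..2*pi} (\<lambda>t. (polar_ds f s t)\<^sup>2)"
      by (subst integral_square_mean[of _ "?m' s"]) (auto intro: cont2_slice c simp: latitude_mean_ds_def)
    then have "sin s * (2 * pi * (?m' s)\<^sup>2) \<le> sin s * integral {0..2*pi} (\<lambda>t. (polar_ds f s t)\<^sup>2)"
      using s0 by simp
    then show "2 * pi * (sin s * (?m' s)\<^sup>2) \<le> integral {0..2*pi} (\<lambda>t. sin s * (polar_ds f s t * polar_ds f s t))"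
      by (simp add: power2_eq_square algebra_simps)
  qed (intro integrable_continuous_real continuous_intros cm)
  finally show ?thesis
    using green_formula[OF f f w'] by simp
qed

section \<open>A rotationally symmetric model\<close>

text \<open>A substitute for the height: it decreases from \<open>1\<close> on the equator to \<open>- 1\<close> at the poles, with its zero
  close to the poles, at \<open>z\<^sup>2 = 9/10\<close>. This places a sign change of \<open>prof_u\<close> near each end of a long cylinder.\<close>

definition prof_w :: "real \<Rightarrow> real" where
  "prof_w z = (9 - 10 * z\<^sup>2) / (9 - 8 * z\<^sup>2)"
text \<open>For \<open>u = (a w + b w\<^sup>2 + c w\<^sup>3)\<close> the function \<open>((1 - z\<^sup>2) u')'\<close> is divisible by \<open>u\<close> if
  \<open>20 b = - a\<close>. The remaining coefficients and the constants in \<open>prof_w\<close> are chosen, with \<open>u = 1\<close> on the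
  equator, so that the quotient \<open>- g\<close> is negative and \<open>(1 - z\<^sup>2) g\<close> stays below \<open>20/21\<close>.\<close>

definition prof_u :: "real \<Rightarrow> real" where
  "prof_u z = prof_w z * (20 - prof_w z + 6 * (prof_w z)\<^sup>2) / 25"
text \<open>The derivative of \<open>prof_u\<close>.\<close>

definition prof_du :: "real \<Rightarrow> real" where
  "prof_du z = - (4/9) * z * (5 - 4 * prof_w z)\<^sup>2 * ((20 - 2 * prof_w z + 18 * (prof_w z)\<^sup>2) / 25)"
text \<open>The only factor of \<open>prof_g\<close> whose sign is not obvious.\<close>

definition prof_cubic :: "real \<Rightarrow> real" where
  "prof_cubic w = 3/5 - 54/5 * w + 75 * w\<^sup>2 - 288/5 * w^3"
definition prof_g :: "real \<Rightarrow> real" where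
  "prof_g z = (20/9) * (5 - 4 * prof_w z) * prof_cubic (prof_w z) / (20 - prof_w z + 6 * (prof_w z)\<^sup>2)"

lemma prof_denom: "\<bar>z\<bar> \<le> 1 \<Longrightarrow> 9 - 8 * z\<^sup>2 \<ge> (1::real)"
  using abs_square_le_1[of z] by simp

lemma prof_w_bounds:
  assumes "\<bar>z\<bar> \<le> 1" shows "- 1 \<le> prof_w z" "prof_w z \<le> 1"
  using prof_denom[OF assms] abs_square_le_1[of z] assms
  by (simp_all add: prof_w_def divide_simps)

lemma prof_w_z:
  assumes "\<bar>z\<bar> \<le> 1"
  shows "2 * (5 - 4 * prof_w z) * z\<^sup>2 = 9 * (1 - prof_w z)"
    "2 * (5 - 4 * prof_w z) * (1 - z\<^sup>2) = 1 + prof_w z"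
  using prof_denom[OF assms] by (simp_all add: prof_w_def field_simps)

lemma prof_quadratic_pos: "20 - w + 6 * w\<^sup>2 \<ge> (19::real)"
proof -
  have "20 - w + 6 * w\<^sup>2 = 19 + (6 * (w - 1/12)\<^sup>2 + 23/24)" by (simp add: power2_eq_square field_simps)
  then show ?thesis using zero_le_power2[of "w - 1/12"] by linarith
qed

lemma prof_quadratic'_pos: "20 - 2 * w + 18 * w\<^sup>2 \<ge> (19::real)"
proof -
  have "20 - 2 * w + 18 * w\<^sup>2 = 19 + (18 * (w - 1/18)\<^sup>2 + 17/18)" by (simp add: power2_eq_square field_simps)
  then show ?thesis using zero_le_power2[of "w - 1/18"] by linarith
qed

lemma prof_cubic_pos:
  assumes "w \<le> 1" shows "prof_cubic w > 0"
proof (cases "w \<le> 1/4")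
  case True
  have "prof_cubic w = 288/5 * w\<^sup>2 * (1/4 - w) + (303/5 * (w - 9/101)\<^sup>2 + (3/5 - 303/5 * (9/101)\<^sup>2))"
    by (simp add: prof_cubic_def power2_eq_square power3_eq_cube field_simps)
  moreover have "288/5 * w\<^sup>2 * (1/4 - w) \<ge> 0"
    using True by (intro mult_nonneg_nonneg) auto
  moreover have "303/5 * (w - 9/101)\<^sup>2 + (3/5 - 303/5 * (9/101)\<^sup>2) > (0::real)"
    by (intro add_nonneg_pos) (simp_all add: power2_eq_square)
  ultimately show ?thesis by linarith
next
  case False
  have "prof_cubic w = 3/5 + w * (72/5 * ((4 * w - 1) * (1 - w)) + (3 * w + 18/5))"
    by (simp add: prof_cubic_def power2_eq_square power3_eq_cube field_simps)
  moreover have "w * (72/5 * ((4 * w - 1) * (1 - w)) + (3 * w + 18/5)) \<ge> 0"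
    using False assms by (intro mult_nonneg_nonneg add_nonneg_nonneg) auto
  ultimately show ?thesis by linarith
qed

lemma prof_g_pos: "\<bar>z\<bar> \<le> 1 \<Longrightarrow> prof_g z > 0"
  unfolding prof_g_def using prof_w_bounds[of z] prof_cubic_pos[of "prof_w z"] prof_quadratic_pos[of "prof_w z"]
  by (auto intro!: divide_pos_pos mult_pos_pos)

text \<open>This is what makes the surface thin enough for Wirtinger's inequality. It amounts to the positivity of
  a quartic in \<open>w\<close> that comes close to \<open>0\<close> near \<open>w = - 0.66\<close> and \<open>w = 0.8\<close>, the approximate roots of the
  square that is split off in the proof.\<close>

lemma prof_g_upper:
  assumes "\<bar>z\<bar> \<le> 1"
  shows "(1 - z\<^sup>2) * (21/20 * prof_g z) \<le> 1"
proof -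
  define w where "w = prof_w z"
  have V: "(1 - z\<^sup>2) * (21/20 * prof_g z) = 7/6 * ((1 + w) * prof_cubic w) / (20 - w + 6 * w\<^sup>2)"
  proof -
    have "a * (21/20 * ((20/9) * q * c / d)) = 7/6 * ((2 * q * a) * c) / d" for a q c d :: real
      by (simp add: field_simps)
    then have "(1 - z\<^sup>2) * (21/20 * prof_g z)
        = 7/6 * ((2 * (5 - 4 * w) * (1 - z\<^sup>2)) * prof_cubic w) / (20 - w + 6 * w\<^sup>2)"
      unfolding prof_g_def w_def .
    then show ?thesis unfolding prof_w_z(2)[OF assms, folded w_def] .
  qed
  have "7/6 * ((1 + w) * prof_cubic w) \<le> 20 - w + 6 * w\<^sup>2"
  proof -
    have "20 - w + 6 * w\<^sup>2 - 7/6 * ((1 + w) * prof_cubic w) - 336/5 * (w\<^sup>2 - 29/192 * w - 53/100)\<^sup>2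
      = (-689/10 - 336/5 * ((29/192)\<^sup>2 - 53/50)) * w\<^sup>2 + (109/10 - 336/5 * (29/96) * (53/100)) * w
        + (193/10 - 336/5 * (53/100)\<^sup>2)"
      by (simp add: prof_cubic_def power2_eq_square power3_eq_cube algebra_simps) (simp add: field_simps)
    also have "\<dots> = (-689/10 - 336/5 * ((29/192)\<^sup>2 - 53/50) - 3/4) * w\<^sup>2
        + 3/4 * (w + 2/3 * (109/10 - 336/5 * (29/96) * (53/100)))\<^sup>2
        + (193/10 - 336/5 * (53/100)\<^sup>2 - 1/3 * (109/10 - 336/5 * (29/96) * (53/100))\<^sup>2)"
      by (simp add: power2_eq_square algebra_simps)
    also have "\<dots> \<ge> 0"
      by (intro add_nonneg_nonneg mult_nonneg_nonneg) (simp_all add: power2_eq_square)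
    finally show ?thesis using zero_le_power2[of "w\<^sup>2 - 29/192 * w - 53/100"] by linarith
  qed
  then show ?thesis
    unfolding V using prof_quadratic_pos[of w] by simp
qed

lemma prof_w_derivative:
  assumes "\<bar>z\<bar> \<le> 1"
  shows "(prof_w has_real_derivative - (4/9) * z * (5 - 4 * prof_w z)\<^sup>2) (at z)"
proof -
  let ?d = "9 - 8 * z\<^sup>2"
  have d: "?d \<noteq> 0" using prof_denom[OF assms] by linarith
  have "5 - 4 * prof_w z = 9 / ?d" using d by (simp add: prof_w_def field_simps)
  moreover have "(prof_w has_real_derivative - (4/9) * z * (9 / ?d)\<^sup>2) (at z)"
    unfolding prof_w_def[abs_def] using d
    by (auto intro!: derivative_eq_intros simp: power2_eq_square field_simps)
  ultimately show ?thesis by simp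
qed

lemma prof_u_derivative:
  assumes "\<bar>z\<bar> \<le> 1"
  shows "(prof_u has_real_derivative prof_du z) (at z)"
  unfolding prof_u_def[abs_def] prof_du_def
  by (auto intro!: derivative_eq_intros prof_w_derivative[OF assms] simp: power2_eq_square field_simps)

lemma prof_ode:
  assumes z: "\<bar>z\<bar> \<le> 1"
  shows "((\<lambda>z. (1 - z\<^sup>2) * prof_du z) has_real_derivative - prof_g z * prof_u z) (at z)"
proof -
  define P where "P w = (20 - 2 * w + 18 * w\<^sup>2) / 25" for w :: real
  define w where "w = prof_w z"
  let ?q = "5 - 4 * w"
  have P': "(P has_real_derivative (36 * w - 2) / 25) (at w)" for w
    unfolding P_def[abs_def] by (auto intro!: derivative_eq_intros)
  have Pw: "((\<lambda>z. P (prof_w z)) has_real_derivative (36 * w - 2) / 25 * (- (4/9) * z * ?q\<^sup>2)) (at z)"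
    using DERIV_chain2[OF P' prof_w_derivative[OF z]] by (simp add: w_def)
  have w': "(prof_w has_real_derivative - (4/9) * z * ?q\<^sup>2) (at z)"
    using prof_w_derivative[OF z] by (simp add: w_def)
  have du: "prof_du z = - (4/9) * z * (5 - 4 * prof_w z)\<^sup>2 * P (prof_w z)" for z
    by (simp add: prof_du_def P_def)
  have A: "2 * ?q * z\<^sup>2 = 9 * (1 - w)" and B: "2 * ?q * (1 - z\<^sup>2) = 1 + w"
    using prof_w_z[OF z] by (simp_all add: w_def)
  have deriv: "((\<lambda>z. (1 - z\<^sup>2) * (- (4/9) * z * (5 - 4 * W z)\<^sup>2 * R z)) has_real_derivative
      - 2 * z * (- (4/9) * z * (5 - 4 * W z)\<^sup>2 * R z) + (1 - z\<^sup>2) * (- (4/9) * (5 - 4 * W z)\<^sup>2 * R z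
        + (32/9) * z * (5 - 4 * W z) * W' * R z - (4/9) * z * (5 - 4 * W z)\<^sup>2 * R')) (at z)"
    if W: "(W has_real_derivative W') (at z)" and R: "(R has_real_derivative R') (at z)" for W R :: "real \<Rightarrow> real" and W' R' z
  proof -
    have 1: "((\<lambda>z. 1 - z\<^sup>2) has_real_derivative - 2 * z) (at z)"
      by (auto intro!: derivative_eq_intros)
    have 2: "((\<lambda>z. - (4/9) * z * (5 - 4 * W z)\<^sup>2) has_real_derivative
        - (4/9) * (5 - 4 * W z)\<^sup>2 + (32/9) * z * (5 - 4 * W z) * W') (at z)"
      by (auto intro!: derivative_eq_intros W simp: field_simps)
    show ?thesis
      by (rule DERIV_cong[OF DERIV_mult[OF 1 DERIV_mult[OF 2 R]]]) (simp add: algebra_simps)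
  qed
  have eq: "- 2 * z * (- (4/9) * z * q\<^sup>2 * p) + (1 - z\<^sup>2) * (- (4/9) * q\<^sup>2 * p
        + (32/9) * z * q * (- (4/9) * z * q\<^sup>2) * p - (4/9) * z * q\<^sup>2 * (e * (- (4/9) * z * q\<^sup>2)))
    = (4/9) * p * (2 * q * z\<^sup>2) * q - (2/9) * (2 * q * (1 - z\<^sup>2)) * q * p
       + (4/81) * (2 * q * (1 - z\<^sup>2)) * (2 * q * z\<^sup>2) * q * (q * e - 8 * p)" for p q e :: real
  proof -
    have "- 2 * z * (- (4/9) * z * q\<^sup>2 * p) + a * (- (4/9) * q\<^sup>2 * p
        + (32/9) * z * q * (- (4/9) * z * q\<^sup>2) * p - (4/9) * z * q\<^sup>2 * (e * (- (4/9) * z * q\<^sup>2)))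
      = (4/9) * p * (2 * q * z\<^sup>2) * q - (2/9) * (2 * q * a) * q * p
        + (4/81) * (2 * q * a) * (2 * q * z\<^sup>2) * q * (q * e - 8 * p)" for a
      by (simp add: power2_eq_square field_simps)
    then show ?thesis .
  qed
  have "((\<lambda>z. (1 - z\<^sup>2) * prof_du z) has_real_derivative
      (4/9) * P w * (2 * ?q * z\<^sup>2) * ?q - (2/9) * (2 * ?q * (1 - z\<^sup>2)) * ?q * P w
       + (4/81) * (2 * ?q * (1 - z\<^sup>2)) * (2 * ?q * z\<^sup>2) * ?q * (?q * ((36 * w - 2) / 25) - 8 * P w)) (at z)"
    (is "(_ has_real_derivative ?deriv) _")
    using deriv[OF w' Pw] unfolding du eq[symmetric] w_def .
  also have "?deriv = - (20/9) * ?q * prof_cubic w * w / 25"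
    unfolding A B prof_cubic_def P_def by (simp add: power2_eq_square power3_eq_cube field_simps)
  also have "\<dots> = - prof_g z * prof_u z"
  proof -
    have eq: "- (20/9) * q * c * w / 25 = - ((20/9) * q * c / d) * (w * d / 25)" if "d \<noteq> 0" for q c d :: real
      using that by (simp add: field_simps)
    show ?thesis
      unfolding prof_g_def prof_u_def w_def[symmetric]
      by (rule eq) (use prof_quadratic_pos[of w] in linarith)
  qed
  finally show ?thesis .
qed

text \<open>Near its zeros \<open>u\<close> has a large slope on the cylinder, which makes \<open>1 - u\<^sup>2\<close> strictly concave there.\<close>

lemma prof_du_lower:
  assumes z: "\<bar>z\<bar> \<le> 1" and u: "\<bar>prof_u z\<bar> \<le> 1/8"
  shows "((1 - z\<^sup>2) * prof_du z)\<^sup>2 \<ge> 11/20"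
proof -
  define w where "w = prof_w z"
  define P where "P = (20 - 2 * w + 18 * w\<^sup>2) / 25"
  have A: "2 * (5 - 4 * w) * z\<^sup>2 = 9 * (1 - w)" and B: "2 * (5 - 4 * w) * (1 - z\<^sup>2) = 1 + w"
    using prof_w_z[OF z] by (simp_all add: w_def)
  have "\<bar>w\<bar> * 19 \<le> \<bar>w\<bar> * \<bar>20 - w + 6 * w\<^sup>2\<bar>"
    using prof_quadratic_pos[of w] by (intro mult_left_mono) auto
  also have "\<dots> = 25 * \<bar>prof_u z\<bar>" by (simp add: prof_u_def w_def abs_mult)
  finally have w: "\<bar>w\<bar> \<le> 25/152" using u by simp
  have "(a * (- (4/9) * z * q\<^sup>2 * P))\<^sup>2 = (2/81) * ((2 * q * a)\<^sup>2 * (2 * q * z\<^sup>2) * q * P\<^sup>2)" for a q :: real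
    by (simp add: power2_eq_square field_simps)
  from this[of "1 - z\<^sup>2" "5 - 4 * w"]
  have "((1 - z\<^sup>2) * prof_du z)\<^sup>2 = (2/81) * ((1 + w)\<^sup>2 * (9 * (1 - w)) * (5 - 4 * w) * P\<^sup>2)"
    unfolding A B by (simp add: prof_du_def w_def P_def)
  also have "\<dots> = (2/9) * ((1 - w\<^sup>2) * ((5 - 4 * w) * (1 + w)) * P\<^sup>2)"
    by (simp add: power2_eq_square[of w] power2_eq_square[of "1 + w"] algebra_simps)
  finally have D: "((1 - z\<^sup>2) * prof_du z)\<^sup>2 = (2/9) * ((1 - w\<^sup>2) * ((5 - 4 * w) * (1 + w)) * P\<^sup>2)" .
  have w2: "w\<^sup>2 \<le> 28/1000"
    using power_mono[OF w, of 2] by (simp add: power2_eq_square)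
  have "(5 - 4 * w) * (1 + w) = 5 + w - 4 * w\<^sup>2" by (simp add: power2_eq_square algebra_simps)
  then have 2: "(5 - 4 * w) * (1 + w) \<ge> 47/10" using w w2 by linarith
  have "20 - 2 * w + 18 * w\<^sup>2 \<ge> 39/2" using w zero_le_power2[of w] by (simp only: abs_le_iff) linarith
  then have "P \<ge> 78/100" unfolding P_def by simp
  then have 3: "P\<^sup>2 \<ge> (78/100)\<^sup>2" by (intro power_mono) auto
  have "(97/100) * (47/10) * (78/100)\<^sup>2 \<le> (1 - w\<^sup>2) * ((5 - 4 * w) * (1 + w)) * P\<^sup>2"
    using w2 2 3 by (intro mult_mono) auto
  then show ?thesis unfolding D by (simp add: power2_eq_square)
qed

lemma prof_u_upper: "\<bar>z\<bar> \<le> 1 \<Longrightarrow> prof_u z \<le> 1"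
  and prof_u_lower: "\<bar>z\<bar> \<le> 1 \<Longrightarrow> - 2 \<le> prof_u z"
proof -
  assume z: "\<bar>z\<bar> \<le> 1"
  let ?w = "prof_w z"
  note b = prof_w_bounds[OF z]
  have "1 - prof_u z = (1 - ?w) * (25 + 5 * ?w + 6 * ?w\<^sup>2) / 25"
    by (simp add: prof_u_def power2_eq_square power3_eq_cube field_simps)
  also have "\<dots> \<ge> 0"
  proof (intro divide_nonneg_pos mult_nonneg_nonneg)
    show "25 + 5 * ?w + 6 * ?w\<^sup>2 \<ge> 0" using b zero_le_power2[of ?w] by linarith
  qed (use b in auto)
  finally show "prof_u z \<le> 1" by simp
  have "prof_u z + 27/25 = (1 + ?w) * (27 - 7 * ?w + 6 * ?w\<^sup>2) / 25"
    by (simp add: prof_u_def power2_eq_square power3_eq_cube field_simps)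
  also have "\<dots> \<ge> 0"
  proof (intro divide_nonneg_pos mult_nonneg_nonneg)
    show "27 - 7 * ?w + 6 * ?w\<^sup>2 \<ge> 0" using b zero_le_power2[of ?w] by linarith
  qed (use b in auto)
  finally show "- 2 \<le> prof_u z" by simp
qed

lemma prof_u_zero [simp]: "prof_u 0 = 1"
  by (simp add: prof_u_def prof_w_def)

lemma prof_u_minus [simp]: "prof_u (- z) = prof_u z"
  by (simp add: prof_u_def prof_w_def)

lemma prof_u_antimono:
  assumes "0 \<le> x" "x \<le> y" "y \<le> 1"
  shows "prof_u y \<le> prof_u x"
proof (rule DERIV_nonpos_imp_nonincreasing[OF assms(2)])
  fix z assume "x \<le> z" "z \<le> y"
  then have z: "0 \<le> z" "\<bar>z\<bar> \<le> 1" using assms by auto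
  have "prof_du z \<le> 0"
    unfolding prof_du_def using z prof_quadratic'_pos[of "prof_w z"]
    by (auto intro!: mult_nonneg_nonneg divide_nonneg_nonneg)
  then show "\<exists>y. (prof_u has_real_derivative y) (at z) \<and> y \<le> 0"
    using prof_u_derivative[OF z(2)] by blast
qed


text \<open>The Riccati inequality on the cylinder, where \<open>d/dt\<close> is \<open>(1 - z\<^sup>2) d/dz\<close> in terms of the height and
  \<open>- sin s d/ds\<close> in terms of the polar angle; hence \<open>Q = - q (cos s)\<close>.\<close>

lemma mean_inequality_on:
  assumes f: "smooth_on_S2 f" and ab: "0 \<le> a" "a \<le> b" "b \<le> pi"
    and q: "\<And>z. \<bar>z\<bar> \<le> 1 \<Longrightarrow> cos b \<le> z \<Longrightarrow> z \<le> cos a \<Longrightarrow> (q has_real_derivative q' z) (at z)"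
    and riccati: "\<And>z. \<bar>z\<bar> \<le> 1 \<Longrightarrow> cos b \<le> z \<Longrightarrow> z \<le> cos a \<Longrightarrow>
      (1 - z\<^sup>2) * q' z + (q z)\<^sup>2 + (1 - z\<^sup>2) * \<gamma> z \<le> 0"
    and \<gamma>: "continuous_on {a..b} (\<lambda>s. \<gamma> (cos s))"
    and bdry: "q (cos a) * (latitude_mean f a)\<^sup>2 = 0" "q (cos b) * (latitude_mean f b)\<^sup>2 = 0"
  shows "integral {a..b} (\<lambda>s. sin s * \<gamma> (cos s) * (latitude_mean f s)\<^sup>2)
    \<le> integral {a..b} (\<lambda>s. sin s * (latitude_mean_ds f s)\<^sup>2)"
proof -
  note cm = continuous_latitude_mean[OF f]
  have range: "\<bar>cos s\<bar> \<le> 1" "cos b \<le> cos s" "cos s \<le> cos a" if "s \<in> {a..b}" for s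
    using that ab by (auto intro!: cos_monotone_0_pi_le)
  show ?thesis
  proof (rule riccati_inequality[where p = sin and r = "\<lambda>s. sin s * \<gamma> (cos s)" and Q = "\<lambda>s. - q (cos s)"
        and Q' = "\<lambda>s. sin s * q' (cos s)" and v = "latitude_mean f" and v' = "latitude_mean_ds f"])
    fix s assume s: "s \<in> {a<..<b}"
    then show s0: "sin s > 0" using ab by (intro sin_gt_zero) auto
    show "(latitude_mean f has_real_derivative latitude_mean_ds f s) (at s)"
      by (rule latitude_mean_derivative[OF f])
    have "(q has_real_derivative q' (cos s)) (at (cos s))"
      using s by (intro q range) auto
    from DERIV_minus[OF DERIV_chain2[OF this DERIV_cos]]
    show "((\<lambda>s. - q (cos s)) has_real_derivative sin s * q' (cos s)) (at s)" by (simp add: mult.commute)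
    have "(sin s)\<^sup>2 * q' (cos s) + (q (cos s))\<^sup>2 + (sin s)\<^sup>2 * \<gamma> (cos s) \<le> 0"
      using riccati[of "cos s"] range[of s] s unfolding sin_squared_eq by auto
    then have "((sin s)\<^sup>2 * q' (cos s) + (q (cos s))\<^sup>2 + (sin s)\<^sup>2 * \<gamma> (cos s)) / sin s \<le> 0"
      using s0 by (simp add: divide_nonpos_pos)
    then show "sin s * q' (cos s) + (- q (cos s))\<^sup>2 / sin s + sin s * \<gamma> (cos s) \<le> 0"
      using s0 by (simp add: add_divide_distrib power2_eq_square)
  next
    show "continuous_on {a..b} (\<lambda>s. - q (cos s))"
    proof (intro continuous_intros continuous_at_imp_continuous_on ballI)
      fix s assume s: "s \<in> {a..b}"
      have "isCont q (cos s)" using DERIV_isCont[OF q] range[OF s] by blast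
      then show "isCont (\<lambda>s. q (cos s)) s" by (rule isCont_o2[rotated]) simp
    qed
  qed (use ab bdry in \<open>auto intro!: continuous_intros cm \<gamma>\<close>)
qed

lemma prof_continuous:
  "continuous_on A (\<lambda>s. prof_g (cos s))" "continuous_on A (\<lambda>s. prof_u (cos s))"
proof -
  have w: "continuous_on A (\<lambda>s. prof_w (cos s))"
    unfolding prof_w_def
  proof (intro continuous_intros ballI)
    show "9 - 8 * (cos s)\<^sup>2 \<noteq> 0" for s :: real
      using prof_denom[OF abs_cos_le_one, of s] by linarith
  qed
  show "continuous_on A (\<lambda>s. prof_g (cos s))"
    unfolding prof_g_def prof_cubic_def
  proof (intro continuous_intros w ballI)
    show "20 - prof_w (cos s) + 6 * (prof_w (cos s))\<^sup>2 \<noteq> 0" for s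
      using prof_quadratic_pos[of "prof_w (cos s)"] by linarith
  qed
  show "continuous_on A (\<lambda>s. prof_u (cos s))"
    unfolding prof_u_def by (intro continuous_intros w) simp
qed

text \<open>For \<open>\<psi> = u - k\<close> one has \<open>- \<psi>\<^sub>t\<^sub>t / \<psi> = V u / (u - k)\<close>. Moving \<open>u\<close> towards zero by \<open>k\<close> makes the
  quotient \<open>u / (u - k)\<close> exceed \<open>21/20\<close>, because \<open>u\<close> lies between \<open>- 2\<close> and \<open>1\<close>.\<close>

lemma riccati_outer:
  assumes z: "\<bar>z\<bar> \<le> 1" and k: "k = 1/10 \<and> prof_u z \<ge> 1/8 \<or> k = - 1/10 \<and> prof_u z \<le> - 1/8"
  defines "D \<equiv> \<lambda>z. (1 - z\<^sup>2) * prof_du z"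
  shows "((\<lambda>z. D z / (prof_u z - k)) has_real_derivative
      (- prof_g z * prof_u z * (prof_u z - k) - D z * prof_du z) / (prof_u z - k)\<^sup>2) (at z)" (is ?deriv)
    and "(1 - z\<^sup>2) * ((- prof_g z * prof_u z * (prof_u z - k) - D z * prof_du z) / (prof_u z - k)\<^sup>2)
      + (D z / (prof_u z - k))\<^sup>2 + (1 - z\<^sup>2) * (21/20 * prof_g z) \<le> 0" (is "?L \<le> 0")
proof -
  have nz: "prof_u z - k \<noteq> 0" using k by auto
  have D: "(D has_real_derivative - prof_g z * prof_u z) (at z)"
    unfolding D_def by (rule prof_ode[OF z])
  show ?deriv
    using nz by (auto intro!: derivative_eq_intros D prof_u_derivative[OF z] simp: power2_eq_square)
  have ratio: "prof_u z / (prof_u z - k) \<ge> 21/20"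
    using k
  proof
    assume "k = 1/10 \<and> prof_u z \<ge> 1/8"
    then show ?thesis using prof_u_upper[OF z] by (simp add: le_divide_eq)
  next
    assume "k = - 1/10 \<and> prof_u z \<le> - 1/8"
    then show ?thesis using prof_u_lower[OF z] by (simp add: le_divide_eq)
  qed
  have z2: "(1 - z\<^sup>2) \<ge> 0" using z by (simp add: abs_square_le_1)
  have "(1 - z\<^sup>2) * ((- g * u * v - D z * prof_du z) / v\<^sup>2) + (D z / v)\<^sup>2
      = - (1 - z\<^sup>2) * g * (u / v)" if "v \<noteq> 0" for g u v
    using that unfolding D_def by (simp add: power2_eq_square field_simps)
  from this[OF nz, of "prof_g z" "prof_u z"]
  have "?L
    = ((1 - z\<^sup>2) * prof_g z) * (21/20 - prof_u z / (prof_u z - k))"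
    by (simp add: algebra_simps)
  also have "\<dots> \<le> 0"
    using z2 prof_g_pos[OF z] ratio by (intro mult_nonneg_nonpos) auto
  finally show "?L \<le> 0" .
qed

text \<open>For \<open>\<psi> = 1 - u\<^sup>2\<close> one has \<open>- \<psi>\<^sub>t\<^sub>t = 2 (u\<^sub>t\<^sup>2 - V u\<^sup>2)\<close>, which is at least
  \<open>1 \<ge> (21/20) V\<close> where \<open>u\<close> is small.\<close>

lemma riccati_middle:
  assumes z: "\<bar>z\<bar> \<le> 1" and u: "\<bar>prof_u z\<bar> \<le> 1/8"
  defines "D \<equiv> \<lambda>z. (1 - z\<^sup>2) * prof_du z"
  shows "((\<lambda>z. - 2 * prof_u z * D z / (1 - (prof_u z)\<^sup>2)) has_real_derivative
      ((- 2 * (prof_du z * D z - prof_g z * (prof_u z)\<^sup>2)) * (1 - (prof_u z)\<^sup>2)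
        - 4 * (prof_u z)\<^sup>2 * D z * prof_du z) / (1 - (prof_u z)\<^sup>2)\<^sup>2) (at z)" (is ?deriv)
    and "(1 - z\<^sup>2) * (((- 2 * (prof_du z * D z - prof_g z * (prof_u z)\<^sup>2)) * (1 - (prof_u z)\<^sup>2)
        - 4 * (prof_u z)\<^sup>2 * D z * prof_du z) / (1 - (prof_u z)\<^sup>2)\<^sup>2)
      + (- 2 * prof_u z * D z / (1 - (prof_u z)\<^sup>2))\<^sup>2 + (1 - z\<^sup>2) * (21/20 * prof_g z) \<le> 0" (is "?L \<le> 0")
proof -
  have u2: "(prof_u z)\<^sup>2 \<le> 1/64"
    using power_mono[OF u, of 2] by (simp add: power2_eq_square)
  have nz: "1 - (prof_u z)\<^sup>2 \<noteq> 0" using u2 by auto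
  have D: "(D has_real_derivative - prof_g z * prof_u z) (at z)"
    unfolding D_def by (rule prof_ode[OF z])
  have "((\<lambda>z. - 2 * prof_u z * D z) has_real_derivative - 2 * (prof_du z * D z - prof_g z * (prof_u z)\<^sup>2)) (at z)"
    by (auto intro!: derivative_eq_intros D prof_u_derivative[OF z] simp: power2_eq_square algebra_simps)
  moreover have "((\<lambda>z. 1 - (prof_u z)\<^sup>2) has_real_derivative - 2 * prof_u z * prof_du z) (at z)"
    by (auto intro!: derivative_eq_intros prof_u_derivative[OF z])
  ultimately show ?deriv
    using nz by (auto dest: DERIV_divide simp: power2_eq_square algebra_simps)
  have z2: "(1 - z\<^sup>2) \<ge> 0" using z by (simp add: abs_square_le_1)
  define V where "V = (1 - z\<^sup>2) * prof_g z"
  have V: "21/20 * V \<le> 1" using prof_g_upper[OF z] by (simp add: V_def)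
  have "(1 - z\<^sup>2) * (((- 2 * (d * ((1 - z\<^sup>2) * d) - g * u\<^sup>2)) * v - 4 * u\<^sup>2 * ((1 - z\<^sup>2) * d) * d) / v\<^sup>2)
      + (- 2 * u * ((1 - z\<^sup>2) * d) / v)\<^sup>2
    = - 2 * (((1 - z\<^sup>2) * d)\<^sup>2 - ((1 - z\<^sup>2) * g) * u\<^sup>2) / v" if "v \<noteq> 0" for d g u v
    using that by (simp add: power2_eq_square field_simps)
  from this[OF nz, of "prof_du z" "prof_g z" "prof_u z"]
  have eq: "?L
    = - 2 * ((D z)\<^sup>2 - V * (prof_u z)\<^sup>2) / (1 - (prof_u z)\<^sup>2) + 21/20 * V"
    by (simp add: D_def V_def)
  have V0: "V \<ge> 0" using z2 prof_g_pos[OF z] by (simp add: V_def)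
  have "V * (prof_u z)\<^sup>2 \<le> 1 * (1/64)" using V V0 u2 by (intro mult_mono) auto
  moreover have "(D z)\<^sup>2 \<ge> 11/20" unfolding D_def by (rule prof_du_lower[OF z u])
  moreover have "1 \<le> 2 * (d - b)" if "b \<le> 1 * (1/64)" "11/20 \<le> d" for b d :: real
    using that by simp
  ultimately have num: "2 * ((D z)\<^sup>2 - V * (prof_u z)\<^sup>2) \<ge> 1" by blast
  have ratio: "1 \<le> n / d" if "1 \<le> n" "0 < d" "d \<le> 1" for n d :: real
    using that by (simp add: le_divide_eq)
  have "1 \<le> 2 * ((D z)\<^sup>2 - V * (prof_u z)\<^sup>2) / (1 - (prof_u z)\<^sup>2)"
    by (rule ratio[OF num]) (use u2 in auto)
  moreover have "- 2 * a / d + b \<le> 0" if "1 \<le> 2 * a / d" "b \<le> 1" for a b d :: real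
  proof -
    have "- 2 * a / d = - (2 * a / d)" by simp
    then show ?thesis using that by linarith
  qed
  ultimately show "?L \<le> 0"
    unfolding eq using V by blast
qed

text \<open>The latitudes are those where \<open>u\<close> is \<open>1/8\<close> or \<open>- 1/8\<close>. They cut the interval into five pieces, with
  one of the supersolutions for each. No condition is needed at the poles, since \<open>(1 - z\<^sup>2) u'\<close>
  vanishes there.\<close>

lemma mean_inequality:
  obtains L :: "real set" where "finite L" "card L \<le> 4" 
    "\<And>f. smooth_on_S2 f \<Longrightarrow> (\<And>s. s \<in> L \<Longrightarrow> latitude_mean f s = 0) \<Longrightarrow>
      integral {0..pi} (\<lambda>s. sin s * (21/20 * prof_g (cos s)) * (latitude_mean f s)\<^sup>2)
        \<le> integral {0..pi} (\<lambda>s. sin s * (latitude_mean_ds f s)\<^sup>2)"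
proof -
  have cu: "continuous_on {0..pi/2} (\<lambda>s. prof_u (cos s))" by (rule prof_continuous)
  have u0: "prof_u (cos 0) = -27/25" by (simp add: prof_u_def prof_w_def)
  have "\<exists>s\<ge>0. s \<le> pi/2 \<and> prof_u (cos s) = -1/8"
    using IVT'[of "\<lambda>s. prof_u (cos s)" 0 "-1/8" "pi/2", OF _ _ _ cu] u0 by simp
  then obtain a1 where a1: "0 \<le> a1" "a1 \<le> pi/2" "prof_u (cos a1) = -1/8" by blast
  have "\<exists>s\<ge>0. s \<le> pi/2 \<and> prof_u (cos s) = 1/8"
    using IVT'[of "\<lambda>s. prof_u (cos s)" 0 "1/8" "pi/2", OF _ _ _ cu] u0 by simp
  then obtain a2 where a2: "0 \<le> a2" "a2 \<le> pi/2" "prof_u (cos a2) = 1/8" by blast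
  have c: "0 \<le> cos a1" "0 \<le> cos a2" using a1 a2 by (auto intro: cos_ge_zero)
  have a12: "a1 \<le> a2"
  proof (rule ccontr)
    assume "\<not> a1 \<le> a2"
    then have "cos a1 \<le> cos a2" using a1 a2 pi_gt_zero by (intro cos_monotone_0_pi_le) linarith+
    then show False using prof_u_antimono[of "cos a1" "cos a2"] a1 a2 c by simp
  qed
  have cos12: "cos a2 \<le> cos a1" using a1 a2 a12 pi_gt_zero by (intro cos_monotone_0_pi_le) linarith+
  have u_abs: "prof_u z = prof_u \<bar>z\<bar>" for z by (simp add: abs_if)
  have low: "prof_u z \<le> - 1/8" if "\<bar>z\<bar> \<le> 1" "cos a1 \<le> \<bar>z\<bar>" for z
    using prof_u_antimono[of "cos a1" "\<bar>z\<bar>"] c that a1 u_abs[of z] by simp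
  have high: "prof_u z \<ge> 1/8" if "\<bar>z\<bar> \<le> cos a2" for z
    using prof_u_antimono[of "\<bar>z\<bar>" "cos a2"] c that a2 u_abs[of z] by simp
  have mid: "\<bar>prof_u z\<bar> \<le> 1/8" if "cos a2 \<le> \<bar>z\<bar>" "\<bar>z\<bar> \<le> cos a1" for z
  proof -
    have "\<bar>z\<bar> \<le> 1" using that(2) cos_le_one[of a1] by linarith
    then have "prof_u \<bar>z\<bar> \<le> 1/8" "- (1/8) \<le> prof_u \<bar>z\<bar>"
      using prof_u_antimono[of "cos a2" "\<bar>z\<bar>"] prof_u_antimono[of "\<bar>z\<bar>" "cos a1"] c that a1 a2 by auto
    then show ?thesis unfolding u_abs[of z] by (intro abs_leI) linarith+
  qed
  let ?L = "{a1, a2, pi - a2, pi - a1}"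
  show thesis
  proof (rule that[of ?L])
    show "finite ?L" by simp
    show "card ?L \<le> 4" by (auto simp: card_insert_if)
    fix f :: "real^3 \<Rightarrow> real"
    assume f: "smooth_on_S2 f" and "\<And>s. s \<in> ?L \<Longrightarrow> latitude_mean f s = 0"
    then have m: "latitude_mean f a1 = 0" "latitude_mean f a2 = 0" "latitude_mean f (pi - a2) = 0" "latitude_mean f (pi - a1) = 0"
      by auto
    let ?l = "\<lambda>s. sin s * (21/20 * prof_g (cos s)) * (latitude_mean f s)\<^sup>2"
    let ?r = "\<lambda>s. sin s * (latitude_mean_ds f s)\<^sup>2"
    have cg: "continuous_on A (\<lambda>s. 21/20 * prof_g (cos s))" for A
      by (intro continuous_intros prof_continuous)
    have 1: "integral {0..a1} ?l \<le> integral {0..a1} ?r"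
      by (rule mean_inequality_on[where \<gamma> = "\<lambda>z. 21/20 * prof_g z", OF f _ _ _ riccati_outer(1)[where k = "-1/10"] riccati_outer(2)[where k = "-1/10"] cg])
        (use a1 low m in auto)
    have 2: "integral {a1..a2} ?l \<le> integral {a1..a2} ?r"
      by (rule mean_inequality_on[where \<gamma> = "\<lambda>z. 21/20 * prof_g z", OF f _ _ _ riccati_middle(1) riccati_middle(2) cg])
        (use a1 a2 a12 mid c m in auto)
    have 3: "integral {a2..pi - a2} ?l \<le> integral {a2..pi - a2} ?r"
      by (rule mean_inequality_on[where \<gamma> = "\<lambda>z. 21/20 * prof_g z", OF f _ _ _ riccati_outer(1)[where k = "1/10"] riccati_outer(2)[where k = "1/10"] cg])
        (use a2 high c m in auto)
    have 4: "integral {pi - a2..pi - a1} ?l \<le> integral {pi - a2..pi - a1} ?r"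
      by (rule mean_inequality_on[where \<gamma> = "\<lambda>z. 21/20 * prof_g z", OF f _ _ _ riccati_middle(1) riccati_middle(2) cg])
        (use a1 a2 a12 mid c m in auto)
    have 5: "integral {pi - a1..pi} ?l \<le> integral {pi - a1..pi} ?r"
      by (rule mean_inequality_on[where \<gamma> = "\<lambda>z. 21/20 * prof_g z", OF f _ _ _ riccati_outer(1)[where k = "-1/10"] riccati_outer(2)[where k = "-1/10"] cg])
        (use a1 low c m in auto)
    have comb: "integral {0..pi} h = integral {0..a1} h + integral {a1..a2} h + integral {a2..pi - a2} h
        + integral {pi - a2..pi - a1} h + integral {pi - a1..pi} h" if h: "continuous_on UNIV h" for h :: "real \<Rightarrow> real"
    proof -
      have i: "h integrable_on {a..b}" for a b
        using h continuous_on_subset by (blast intro: integrable_continuous_real)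
      have "integral {a..b} h + integral {b..c} h = integral {a..c} h" if "a \<le> b" "b \<le> c" for a b c
        using that i by (rule Henstock_Kurzweil_Integration.integral_combine)
      from this[of 0 "pi - a1" pi] this[of 0 "pi - a2" "pi - a1"] this[of 0 a2 "pi - a2"] this[of 0 a1 a2]
      show ?thesis using a1 a2 a12 by simp
    qed
    have c: "continuous_on UNIV ?l" "continuous_on UNIV ?r"
      by (intro continuous_intros cg continuous_latitude_mean f)+
    show "integral {0..pi} ?l \<le> integral {0..pi} ?r"
      unfolding comb[OF c(1)] comb[OF c(2)] using 1 2 3 4 5 by linarith
  qed
qed

section \<open>Eigenvalues of nearby conformal metrics\<close>

lemma homogeneous_system_solution:
  fixes A :: "'s \<Rightarrow> 'i \<Rightarrow> real"
  assumes "finite L" "finite I" "card L < card I"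
  shows "\<exists>c. (\<exists>i\<in>I. c i \<noteq> 0) \<and> (\<forall>s\<in>L. (\<Sum>i\<in>I. c i * A s i) = 0)"
  using assms
proof (induction L arbitrary: I A rule: finite_induct)
  case empty
  then have "I \<noteq> {}" by auto
  then show ?case by (intro exI[of _ "\<lambda>_. 1"]) auto
next
  case (insert s L)
  show ?case
  proof (cases "\<forall>i\<in>I. A s i = 0")
    case True
    obtain c where "\<exists>i\<in>I. c i \<noteq> 0" "\<forall>s\<in>L. (\<Sum>i\<in>I. c i * A s i) = 0"
      using insert.IH[of I A] insert.prems insert.hyps by auto
    with True show ?thesis by (intro exI[of _ c]) auto
  next
    case False
    then obtain i0 where i0: "i0 \<in> I" "A s i0 \<noteq> 0" by auto
    \<comment> \<open>Eliminate the unknown \<open>i0\<close> with the help of equation \<open>s\<close>.\<close>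
    let ?I = "I - {i0}"
    define A' where "A' r i = A r i - A r i0 * A s i / A s i0" for r i
    have "card L < card ?I" using insert.prems insert.hyps i0 by simp
    then obtain c where c: "\<exists>i\<in>?I. c i \<noteq> 0" "\<forall>r\<in>L. (\<Sum>i\<in>?I. c i * A' r i) = 0"
      using insert.IH[of ?I A'] insert.prems by auto
    define c' where "c' = c(i0 := - (\<Sum>i\<in>?I. c i * A s i) / A s i0)"
    have sum: "(\<Sum>i\<in>I. c' i * A r i) = (\<Sum>i\<in>?I. c i * A' r i)" for r
    proof -
      have "(\<Sum>i\<in>I. c' i * A r i) = c' i0 * A r i0 + (\<Sum>i\<in>?I. c' i * A r i)"
        using i0 insert.prems by (intro sum.remove) auto
      also have "(\<Sum>i\<in>?I. c' i * A r i) = (\<Sum>i\<in>?I. c i * A r i)"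
        by (intro sum.cong) (auto simp: c'_def)
      also have "c' i0 * A r i0 = - (\<Sum>i\<in>?I. c i * (A r i0 * A s i / A s i0))"
      proof -
        have "c' i0 * A r i0 = - ((\<Sum>i\<in>?I. c i * A s i) * (A r i0 / A s i0))"
          by (simp add: c'_def)
        then show ?thesis by (auto simp: sum_distrib_right sum_divide_distrib intro!: sum.cong)
      qed
      finally show ?thesis by (simp add: A'_def right_diff_distrib sum_subtractf)
    qed
    have "(\<Sum>i\<in>?I. c i * A' s i) = 0" using i0 by (simp add: A'_def)
    moreover have "\<exists>i\<in>I. c' i \<noteq> 0" using c(1) by (auto simp: c'_def)
    ultimately show ?thesis using c(2) sum by (intro exI[of _ c']) auto
  qed
qed

lemma sum_fun_apply: "(\<Sum>i\<in>I. F i) x = (\<Sum>i\<in>I. F i x)"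
  for F :: "'i \<Rightarrow> 'a \<Rightarrow> real"
  by (induction I rule: infinite_finite_induct) auto

lemma smooth_on_S2_sum:
  "(\<And>i. i \<in> I \<Longrightarrow> smooth_on_S2 (F i)) \<Longrightarrow> smooth_on_S2 (\<lambda>x. \<Sum>i\<in>I. F i x)"
  by (auto simp: smooth_on_S2_iff o_def intro!: smooth_on_sum)

lemma laplace_beltrami_round_zero: "x \<in> S2 \<Longrightarrow> laplace_beltrami round_metric (\<lambda>x. 0) x = 0"
  using laplace_beltrami_round_linear(2)[of x "\<lambda>x. 0" 0]
  by (simp add: smooth_on_S2_iff o_def smooth_on_const)

lemma neg_laplacian_sum:
  assumes "\<And>i. i \<in> I \<Longrightarrow> smooth_on_S2 (F i)" "\<And>i. i \<in> I \<Longrightarrow> neg_laplacian (F i) (w i)"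
  shows "neg_laplacian (\<lambda>x. \<Sum>i\<in>I. F i x) (\<lambda>s t. \<Sum>i\<in>I. w i s t)"
  using assms
proof (induction I rule: infinite_finite_induct)
  case (insert i I)
  have "smooth_on_S2 (F i)" "smooth_on_S2 (\<lambda>x. \<Sum>i\<in>I. F i x)"
    using insert.prems by (auto intro: smooth_on_S2_sum)
  then show ?case
    using insert by (auto simp: neg_laplacian_def laplace_beltrami_round_linear(1) intro!: cont2_intros)
qed (auto simp: neg_laplacian_def cont2_def laplace_beltrami_round_zero)

text \<open>The factor \<open>sin s\<close> only gives the vanishing away from the poles; continuity gives the rest.\<close>

lemma vanish_if_weighted_square_vanishes:
  assumes h: "smooth_on_S2 h" and \<rho>: "cont2 \<rho>" "\<And>s t. s \<in> {0..pi} \<Longrightarrow> \<rho> s t > 0"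
    and 0: "box_integral (\<lambda>s t. sin s * (\<rho> s t * (h (polar s t))\<^sup>2)) \<le> 0" and x: "x \<in> S2"
  shows "h x = 0"
proof -
  obtain s t where st: "s \<in> {0..pi}" "t \<in> {0..2*pi}" "x = polar s t" using x by (rule S2_polar)
  have c: "cont2 (\<lambda>s t. sin s * (\<rho> s t * (h (polar s t))\<^sup>2))"
    by (intro cont2_intros \<rho> cont2_polar h continuous_intros)
  have open_zero: "h (polar s' t) = 0" if s': "s' \<in> {0<..<pi}" for s'
  proof -
    have s'': "s' \<in> {0..pi}" using s' by auto
    have "sin s' * (\<rho> s' t * (h (polar s' t))\<^sup>2) = 0"
      by (rule box_integral_eq_0[OF c _ 0 s'' st(2)])
        (auto intro!: mult_nonneg_nonneg sin_ge_zero less_imp_le[OF \<rho>(2)])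
    moreover have "sin s' > 0" using s' by (auto intro: sin_gt_zero)
    ultimately show ?thesis using \<rho>(2)[OF s'', of t] by auto
  qed
  have "continuous_on (closure {0<..<pi}) (\<lambda>s. h (polar s t))"
    by (rule cont2_slice'[OF cont2_polar(1)[OF h]])
  then have "h (polar s t) = 0"
    by (rule continuous_constant_on_closure) (use open_zero st in \<open>auto simp: closure_greaterThanLessThan\<close>)
  then show ?thesis using st by simp
qed

text \<open>\<open>G\<close> need not be rotationally symmetric; it only has to lie below the model weight with the margin
  that the supersolutions allow.\<close>

locale weighted_sphere =
  fixes G :: "real^3 \<Rightarrow> real"
  assumes G_smooth: "smooth_on_S2 G" and G_pos: "\<And>x. x \<in> S2 \<Longrightarrow> G x > 0"
    and G_less: "\<And>x. x \<in> S2 \<Longrightarrow> 2 * G x < 21/20 * prof_g (x $ 3)"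
begin

abbreviation E :: "real \<Rightarrow> (real^3 \<Rightarrow> real) set" where
  "E \<equiv> eigenspace (conformal_metric G)"

lemma E_iff: "f \<in> E \<mu> \<longleftrightarrow> smooth_on_S2 f \<and> (\<forall>x. x \<notin> S2 \<longrightarrow> f x = 0) \<and>
    (\<forall>x\<in>S2. - laplace_beltrami round_metric f x = \<mu> * G x * f x)"
proof -
  have "- laplace_beltrami (conformal_metric G) f x = \<mu> * f x \<longleftrightarrow>
      - laplace_beltrami round_metric f x = \<mu> * G x * f x" if "x \<in> S2" for x
  proof -
    have "laplace_beltrami (conformal_metric G) f x = inverse (G x) * laplace_beltrami round_metric f x"
      by (rule laplace_beltrami_conformal_round[OF that G_pos])
    then have L: "laplace_beltrami round_metric f x = G x * laplace_beltrami (conformal_metric G) f x"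
      using G_pos[OF that] by simp
    have "- a = \<mu> * f x \<longleftrightarrow> - (G x * a) = \<mu> * G x * f x" for a
    proof -
      have "- a = \<mu> * f x \<longleftrightarrow> G x * (- a) = G x * (\<mu> * f x)"
        using G_pos[OF that] by (subst mult_cancel_left) simp
      then show ?thesis by (simp add: mult_ac)
    qed
    then show ?thesis unfolding L .
  qed
  then show ?thesis by (auto simp: eigenspace_def)
qed

definition ip :: "(real^3 \<Rightarrow> real) \<Rightarrow> (real^3 \<Rightarrow> real) \<Rightarrow> real" where
  "ip f h = box_integral (\<lambda>s t. sin s * (G (polar s t) * (f (polar s t) * h (polar s t))))"

lemma cont2_ip: "smooth_on_S2 f \<Longrightarrow> smooth_on_S2 h \<Longrightarrow>
    cont2 (\<lambda>s t. sin s * (G (polar s t) * (f (polar s t) * h (polar s t))))"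
  by (intro cont2_intros cont2_polar G_smooth continuous_intros)

lemma E_neg_laplacian:
  assumes "f \<in> E \<mu>"
  shows "neg_laplacian f (\<lambda>s t. \<mu> * (G (polar s t) * f (polar s t)))"
proof -
  have f: "smooth_on_S2 f" using assms by (simp add: E_iff)
  have "cont2 (\<lambda>s t. \<mu> * (G (polar s t) * f (polar s t)))"
    by (intro cont2_intros cont2_polar G_smooth f continuous_intros)
  then show ?thesis using assms by (simp add: neg_laplacian_def E_iff mult.assoc)
qed

lemma E_orthogonal:
  assumes f: "f \<in> E \<mu>" and h: "h \<in> E \<nu>" and "\<mu> \<noteq> \<nu>"
  shows "ip f h = 0"
proof -
  have s: "smooth_on_S2 f" "smooth_on_S2 h" using f h by (simp_all add: E_iff)
  have "box_integral (\<lambda>s t. \<nu> * (sin s * (G (polar s t) * (f (polar s t) * h (polar s t)))))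
      = box_integral (\<lambda>s t. \<mu> * (sin s * (G (polar s t) * (f (polar s t) * h (polar s t)))))"
    using green_symmetric[OF s(1) E_neg_laplacian[OF f] s(2) E_neg_laplacian[OF h]]
    by (simp add: mult_ac)
  then have "\<nu> * ip f h = \<mu> * ip f h" by (simp add: box_integral_cmult ip_def)
  with \<open>\<mu> \<noteq> \<nu>\<close> show ?thesis by simp
qed

lemma ip_self_nonneg: "smooth_on_S2 f \<Longrightarrow> ip f f \<ge> 0"
proof -
  assume f: "smooth_on_S2 f"
  have "sin s * (G (polar s t) * (f (polar s t) * f (polar s t))) \<ge> 0" if "s \<in> {0..pi}" for s t
    using that G_pos[OF polar_in_S2, of s t] by (simp add: sin_ge_zero)
  then show "ip f f \<ge> 0"
    unfolding ip_def box_integral_def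
    by (intro integral_nonneg cont2_inner_integrable cont2_ip cont2_integrable f) auto
qed

lemma ip_self_zero:
  assumes "smooth_on_S2 f" "ip f f \<le> 0" "\<And>x. x \<notin> S2 \<Longrightarrow> f x = 0"
  shows "f = (\<lambda>x. 0)"
proof
  fix x
  have "cont2 (\<lambda>s t. G (polar s t))" by (rule cont2_polar[OF G_smooth])
  then show "f x = 0"
    using vanish_if_weighted_square_vanishes[OF assms(1), of "\<lambda>s t. G (polar s t)" x] assms(2,3) G_pos
    by (cases "x \<in> S2") (auto simp: ip_def power2_eq_square)
qed

lemma ip_sum_right:
  assumes "smooth_on_S2 f" "\<And>\<mu>. \<mu> \<in> M \<Longrightarrow> smooth_on_S2 (F \<mu>)"
  shows "ip f (\<lambda>x. \<Sum>\<mu>\<in>M. F \<mu> x) = (\<Sum>\<mu>\<in>M. ip f (F \<mu>))"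
proof -
  have "ip f (\<lambda>x. \<Sum>\<mu>\<in>M. F \<mu> x)
      = box_integral (\<lambda>s t. \<Sum>\<mu>\<in>M. sin s * (G (polar s t) * (f (polar s t) * F \<mu> (polar s t))))"
    unfolding ip_def by (simp add: sum_distrib_left)
  also have "\<dots> = (\<Sum>\<mu>\<in>M. ip f (F \<mu>))"
    unfolding ip_def by (intro box_integral_sum cont2_ip assms)
  finally show ?thesis .
qed

text \<open>Orthogonality makes the energy of \<open>f\<close> at most \<open>2 ip f f\<close>, while the lower bound makes it at least
  the integral of \<open>(21/20) g f\<^sup>2\<close>. As \<open>2 G < (21/20) g\<close>, both are compatible only for \<open>f = 0\<close>, and
  then the components \<open>F \<mu>\<close> vanish because they are orthogonal to each other.\<close>

lemma low_combination_vanishes: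
  assumes M: "finite M" "\<And>\<mu>. \<mu> \<in> M \<Longrightarrow> \<mu> \<le> 2" and F: "\<And>\<mu>. \<mu> \<in> M \<Longrightarrow> F \<mu> \<in> E \<mu>"
  defines "f \<equiv> \<lambda>x. \<Sum>\<mu>\<in>M. F \<mu> x"
  assumes mean: "integral {0..pi} (\<lambda>s. sin s * (21/20 * prof_g (cos s)) * (latitude_mean f s)\<^sup>2)
        \<le> integral {0..pi} (\<lambda>s. sin s * (latitude_mean_ds f s)\<^sup>2)"
    and \<mu>: "\<mu> \<in> M"
  shows "F \<mu> = (\<lambda>x. 0)"
proof -
  have sF: "smooth_on_S2 (F \<mu>)" if "\<mu> \<in> M" for \<mu> using F[OF that] by (simp add: E_iff)
  have sf: "smooth_on_S2 f" unfolding f_def by (intro smooth_on_S2_sum sF)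
  let ?w = "\<lambda>s t. \<Sum>\<mu>\<in>M. \<mu> * (G (polar s t) * F \<mu> (polar s t))"
  have w: "neg_laplacian f ?w"
    unfolding f_def by (intro neg_laplacian_sum sF E_neg_laplacian F)
  have diag: "(\<Sum>\<nu>\<in>M. ip (F \<mu>) (F \<nu>)) = ip (F \<mu>) (F \<mu>)" if "\<mu> \<in> M" for \<mu>
    using M(1) that by (subst sum.remove[of _ \<mu>]) (auto intro!: sum.neutral E_orthogonal F)
  have sym: "ip a b = ip b a" for a b unfolding ip_def by (simp add: mult.commute[of "a _"])
  have f_F: "ip f (F \<mu>) = ip (F \<mu>) (F \<mu>)" if "\<mu> \<in> M" for \<mu>
  proof -
    have "ip f (F \<mu>) = ip (F \<mu>) f" by (rule sym)
    also have "\<dots> = (\<Sum>\<nu>\<in>M. ip (F \<mu>) (F \<nu>))"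
      unfolding f_def by (rule ip_sum_right[OF sF[OF that] sF])
    finally show ?thesis using diag[OF that] by simp
  qed
  let ?K = "\<lambda>\<mu> s t. sin s * (G (polar s t) * (f (polar s t) * F \<mu> (polar s t)))"
  have "box_integral (\<lambda>s t. sin s * (f (polar s t) * ?w s t))
      = box_integral (\<lambda>s t. \<Sum>\<mu>\<in>M. \<mu> * ?K \<mu> s t)"
    by (simp add: sum_distrib_left mult_ac)
  also have "\<dots> = (\<Sum>\<mu>\<in>M. box_integral (\<lambda>s t. \<mu> * ?K \<mu> s t))"
    by (intro box_integral_sum cont2_intros(4)[OF cont2_intros(1)] cont2_ip sf sF continuous_on_const)
  also have "\<dots> = (\<Sum>\<mu>\<in>M. \<mu> * ip (F \<mu>) (F \<mu>))"
  proof (intro sum.cong refl)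
    fix \<mu> assume "\<mu> \<in> M"
    have "box_integral (\<lambda>s t. \<mu> * ?K \<mu> s t) = \<mu> * ip f (F \<mu>)"
      unfolding ip_def by (rule box_integral_cmult)
    then show "box_integral (\<lambda>s t. \<mu> * ?K \<mu> s t) = \<mu> * ip (F \<mu>) (F \<mu>)"
      using f_F[OF \<open>\<mu> \<in> M\<close>] by simp
  qed
  also have "\<dots> \<le> (\<Sum>\<mu>\<in>M. 2 * ip (F \<mu>) (F \<mu>))"
    by (intro sum_mono mult_right_mono M ip_self_nonneg sF)
  also have "\<dots> = 2 * ip f f"
  proof -
    have "ip f f = (\<Sum>\<mu>\<in>M. ip f (F \<mu>))"
      using ip_sum_right[OF sf sF, of M "\<lambda>i. i"] by (simp add: f_def[symmetric])
    then show ?thesis using f_F by (simp add: sum_distrib_left)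
  qed
  finally have upper: "box_integral (\<lambda>s t. sin s * (f (polar s t) * ?w s t)) \<le> 2 * ip f f" .
  let ?\<gamma> = "\<lambda>s. 21/20 * prof_g (cos s)"
  have c\<gamma>: "continuous_on UNIV ?\<gamma>" by (intro continuous_intros prof_continuous)
  have lower: "box_integral (\<lambda>s t. sin s * (?\<gamma> s * (f (polar s t))\<^sup>2))
      \<le> box_integral (\<lambda>s t. sin s * (f (polar s t) * ?w s t))"
  proof (rule spectral_lower_bound[OF sf w c\<gamma>])
    show "(sin s)\<^sup>2 * ?\<gamma> s \<le> 1" for s
      using prof_g_upper[of "cos s"] by (simp add: sin_squared_eq)
    show "?\<gamma> s \<ge> 0" for s using prof_g_pos[of "cos s"] by simp
  qed (rule mean)
  let ?\<rho> = "\<lambda>s t. ?\<gamma> s - 2 * G (polar s t)"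
  have c\<rho>: "cont2 ?\<rho>"
    by (intro cont2_intros cont2_intros(1)[OF c\<gamma>] cont2_polar G_smooth continuous_intros)
  have c1: "cont2 (\<lambda>s t. sin s * (?\<gamma> s * (f (polar s t))\<^sup>2))"
    by (intro cont2_intros cont2_intros(1)[OF c\<gamma>] cont2_polar sf continuous_intros)
  have c2: "cont2 (\<lambda>s t. 2 * (sin s * (G (polar s t) * (f (polar s t) * f (polar s t)))))"
    by (intro cont2_intros(4)[OF cont2_intros(1)] cont2_ip sf continuous_on_const)
  let ?A = "\<lambda>s t. sin s * (?\<gamma> s * (f (polar s t))\<^sup>2)" and ?B = "\<lambda>s t. 2 * (sin s * (G (polar s t) * (f (polar s t) * f (polar s t))))"
  have "box_integral (\<lambda>s t. sin s * (?\<rho> s t * (f (polar s t))\<^sup>2))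
      = box_integral ?A - 2 * ip f f"
  proof -
    have "box_integral (\<lambda>s t. sin s * (?\<rho> s t * (f (polar s t))\<^sup>2))
        = box_integral (\<lambda>s t. ?A s t - ?B s t)"
      by (simp add: power2_eq_square algebra_simps)
    also have "\<dots> = box_integral ?A
        - box_integral ?B"
      by (rule box_integral_diff[OF c1 c2])
    also have "box_integral ?B = 2 * ip f f"
      unfolding ip_def by (rule box_integral_cmult)
    finally show ?thesis .
  qed
  also have "\<dots> \<le> 0" using lower upper by simp
  finally have le: "box_integral (\<lambda>s t. sin s * (?\<rho> s t * (f (polar s t))\<^sup>2)) \<le> 0" .
  have "f x = 0" if "x \<in> S2" for x
    by (rule vanish_if_weighted_square_vanishes[OF sf c\<rho> _ le that])
      (use G_less[OF polar_in_S2] in simp)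
  then have "ip f (F \<mu>) = 0" by (simp add: ip_def box_integral_def)
  then show ?thesis
    using f_F[OF \<mu>] F[OF \<mu>] by (intro ip_self_zero) (auto simp: E_iff)
qed

lemma E_subspace: "fun_space.subspace (E \<mu>)"
proof (rule fun_space.subspaceI)
  show "0 \<in> E \<mu>"
    by (auto simp: E_iff smooth_on_S2_iff o_def zero_fun_def laplace_beltrami_round_zero
        intro!: smooth_on_const)
  show "f + h \<in> E \<mu>" if "f \<in> E \<mu>" "h \<in> E \<mu>" for f h
    using that smooth_on_S2_intros(1)[of f h] laplace_beltrami_round_linear(1)[of _ f h]
    by (auto simp: E_iff plus_fun_def algebra_simps)
  show "(\<lambda>x. c * f x) \<in> E \<mu>" if "f \<in> E \<mu>" for c f
  proof -
    have "- laplace_beltrami round_metric (\<lambda>x. c * f x) x = \<mu> * G x * (c * f x)" if x: "x \<in> S2" for x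
    proof -
      have "- (c * laplace_beltrami round_metric f x) = c * (\<mu> * G x * f x)"
        using \<open>f \<in> E \<mu>\<close> x by (simp add: E_iff flip: mult_minus_right)
      then show ?thesis
        using \<open>f \<in> E \<mu>\<close> x by (simp add: laplace_beltrami_round_linear(2) E_iff mult_ac)
    qed
    then show ?thesis using that smooth_on_S2_intros(2)[of f c] by (auto simp: E_iff)
  qed
qed

text \<open>With more than four eigenfunctions in total, some nontrivial combination \<open>f\<close> has mean zero on the
  four latitudes. Then its component in each eigenspace vanishes, against the independence of the sets.\<close>

lemma independent_total_card:
  assumes N: "finite N" "\<And>\<nu>. \<nu> \<in> N \<Longrightarrow> \<nu> \<le> 2"
    and B: "\<And>\<nu>. \<nu> \<in> N \<Longrightarrow> finite (B \<nu>) \<and> B \<nu> \<subseteq> E \<nu> \<and> fun_space.independent (B \<nu>)"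
  shows "(\<Sum>\<nu>\<in>N. card (B \<nu>)) \<le> 4"
proof (rule ccontr)
  assume "\<not> (\<Sum>\<nu>\<in>N. card (B \<nu>)) \<le> 4"
  obtain L :: "real set" where L: "finite L" "card L \<le> 4" 
    "\<And>f. smooth_on_S2 f \<Longrightarrow> (\<And>s. s \<in> L \<Longrightarrow> latitude_mean f s = 0) \<Longrightarrow>
      integral {0..pi} (\<lambda>s. sin s * (21/20 * prof_g (cos s)) * (latitude_mean f s)\<^sup>2)
        \<le> integral {0..pi} (\<lambda>s. sin s * (latitude_mean_ds f s)\<^sup>2)"
    by (rule mean_inequality) blast
  define I where "I = Sigma N B"
  have I: "finite I" "card I = (\<Sum>\<nu>\<in>N. card (B \<nu>))"
    using N B by (auto simp: I_def card_SigmaI)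
  obtain c where c: "\<exists>i\<in>I. c i \<noteq> 0" "\<forall>s\<in>L. (\<Sum>i\<in>I. c i * latitude_mean (snd i) s) = 0"
    using homogeneous_system_solution[OF L(1) I(1), of "\<lambda>s i. latitude_mean (snd i) s"] L(2) I(2)
      \<open>\<not> (\<Sum>\<nu>\<in>N. card (B \<nu>)) \<le> 4\<close> by auto
  define F where "F \<nu> = (\<lambda>x. \<Sum>b\<in>B \<nu>. c (\<nu>, b) * b x)" for \<nu>
  have F_sum: "F \<nu> = (\<Sum>b\<in>B \<nu>. (\<lambda>x. c (\<nu>, b) * b x))" for \<nu>
    by (simp add: F_def fun_eq_iff sum_fun_apply)
  have F: "F \<nu> \<in> E \<nu>" if "\<nu> \<in> N" for \<nu>
    unfolding F_sum using B[OF that]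
    by (intro fun_space.subspace_sum[OF E_subspace] fun_space.subspace_scale[OF E_subspace]) auto
  let ?f = "\<lambda>x. \<Sum>\<nu>\<in>N. F \<nu> x"
  have f_I: "?f x = (\<Sum>i\<in>I. c i * snd i x)" for x
    using N B by (simp add: F_def I_def sum.Sigma split_def)
  have sm: "smooth_on_S2 ?f" using F by (auto intro!: smooth_on_S2_sum simp: E_iff)
  have "latitude_mean ?f s = (\<Sum>i\<in>I. c i * latitude_mean (snd i) s)" for s
  proof -
    have "(\<lambda>t. snd i (polar s t)) integrable_on {0..2*pi}" if "i \<in> I" for i
    proof (intro cont2_integrable cont2_polar)
      have "snd i \<in> E (fst i)" using that B[of "fst i"] by (auto simp: I_def)
      then show "smooth_on_S2 (snd i)" by (simp add: E_iff)
    qed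
    then show ?thesis
      unfolding latitude_mean_def f_I using I(1)
      by (subst integral_sum) (auto simp: sum_divide_distrib intro: integrable_on_mult_right)
  qed
  with c(2) have mean: "integral {0..pi} (\<lambda>s. sin s * (21/20 * prof_g (cos s)) * (latitude_mean ?f s)\<^sup>2)
        \<le> integral {0..pi} (\<lambda>s. sin s * (latitude_mean_ds ?f s)\<^sup>2)"
    by (intro L(3)[OF sm]) simp
  from c(1) obtain \<nu> b where b: "\<nu> \<in> N" "b \<in> B \<nu>" "c (\<nu>, b) \<noteq> 0" by (auto simp: I_def)
  have "F \<nu> = (\<lambda>x. 0)"
    by (rule low_combination_vanishes[OF N F mean b(1)])
  then have "(\<Sum>b\<in>B \<nu>. (\<lambda>x. c (\<nu>, b) * b x)) = 0" unfolding F_sum by (simp add: zero_fun_def)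
  then have "fun_space.dependent (B \<nu>)"
    using B[OF b(1)] b by (subst fun_space.dependent_finite) auto
  with B[OF b(1)] show False by blast
qed

lemma independent_card:
  assumes "\<nu> \<le> 2" "S \<subseteq> E \<nu>" "fun_space.independent S"
  shows "finite S"
proof (rule ccontr)
  assume "infinite S"
  then obtain T where T: "T \<subseteq> S" "finite T" "card T = 5"
    using infinite_arbitrarily_large by blast
  then show False
    using independent_total_card[of "{\<nu>}" "\<lambda>_. T"] assms fun_space.independent_mono[OF assms(3) T(1)] by auto
qed

lemma eigen_basis:
  assumes "\<nu> \<le> 2"
  obtains B where "finite B" "B \<subseteq> E \<nu>" "fun_space.independent B" "card B = multiplicity (conformal_metric G) \<nu>"
proof -
  obtain B where "B \<subseteq> E \<nu>" "fun_space.independent B" "card B = fun_space.dim (E \<nu>)"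
    using fun_space.basis_exists[of "E \<nu>"] by metis
  then show thesis using that[of B] independent_card[OF assms] by (auto simp: multiplicity_def)
qed

lemma multiplicity_pos:
  assumes "\<nu> \<le> 2" "is_eigenvalue (conformal_metric G) \<nu>"
  shows "multiplicity (conformal_metric G) \<nu> \<ge> 1"
proof -
  obtain f where f: "f \<in> E \<nu>" "f \<noteq> 0" using assms(2) by (auto simp: is_eigenvalue_def)
  have "fun_space.independent {f}" using f(2) by (simp add: fun_space.dependent_single)
  moreover obtain B where B: "{f} \<subseteq> B" "B \<subseteq> E \<nu>" "fun_space.independent B" "E \<nu> \<subseteq> fun_space.span B"
    using fun_space.maximal_independent_subset_extend[of "{f}" "E \<nu>"] f(1) calculation by auto
  have "finite B" using independent_card[OF assms(1) B(2,3)] .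
  moreover have "fun_space.dim (E \<nu>) = card B"
    using fun_space.dim_unique[OF B(2,4,3)] by simp
  ultimately show ?thesis using B(1) by (auto simp: multiplicity_def Suc_le_eq card_gt_0_iff)
qed

lemma multiplicity_sum:
  assumes "finite N" "\<And>\<nu>. \<nu> \<in> N \<Longrightarrow> \<nu> \<le> 2"
  shows "(\<Sum>\<nu>\<in>N. multiplicity (conformal_metric G) \<nu>) \<le> 4"
proof -
  have "\<forall>\<nu>\<in>N. \<exists>B. finite B \<and> B \<subseteq> E \<nu> \<and> fun_space.independent B \<and> card B = multiplicity (conformal_metric G) \<nu>"
    by (intro ballI) (rule eigen_basis[OF assms(2)], assumption, blast)
  then obtain B where B: "\<forall>\<nu>\<in>N. finite (B \<nu>) \<and> B \<nu> \<subseteq> E \<nu> \<and> fun_space.independent (B \<nu>)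
      \<and> card (B \<nu>) = multiplicity (conformal_metric G) \<nu>"
    by metis
  have "(\<Sum>\<nu>\<in>N. multiplicity (conformal_metric G) \<nu>) = (\<Sum>\<nu>\<in>N. card (B \<nu>))"
    using B by (intro sum.cong) auto
  also have "\<dots> \<le> 4" using B assms by (intro independent_total_card) auto
  finally show ?thesis .
qed

lemma finite_eigenvalues: "finite {\<nu>. is_eigenvalue (conformal_metric G) \<nu> \<and> \<nu> \<le> 2}"
proof (rule ccontr)
  assume "infinite {\<nu>. is_eigenvalue (conformal_metric G) \<nu> \<and> \<nu> \<le> 2}"
  then obtain N where N: "N \<subseteq> {\<nu>. is_eigenvalue (conformal_metric G) \<nu> \<and> \<nu> \<le> 2}" "finite N" "card N = 5"
    using infinite_arbitrarily_large by blast
  have "card N = (\<Sum>\<nu>\<in>N. 1)" by simp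
  also have "\<dots> \<le> (\<Sum>\<nu>\<in>N. multiplicity (conformal_metric G) \<nu>)"
    using N(1) by (intro sum_mono multiplicity_pos) auto
  also have "\<dots> \<le> 4" using N by (intro multiplicity_sum) auto
  finally show False using N(3) by simp
qed

text \<open>The count of eigenvalues increases exactly at the eigenvalues. So with \<open>k\<close> the number of eigenvalues
  up to \<open>2\<close>, the \<open>k\<close>-th eigenvalue is \<open>2\<close>, and \<open>k \<le> 4\<close>.\<close>

lemma labelling_le_4:
  assumes 2: "is_eigenvalue (conformal_metric G) 2"
  shows "\<exists>k\<ge>1. eigenvalue (conformal_metric G) k = 2" "labelling (conformal_metric G) 2 \<le> 4"
proof -
  let ?g = "conformal_metric G"
  let ?k = "eigenvalue_count ?g 2"
  have k4: "?k \<le> 4"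
    unfolding eigenvalue_count_def by (rule multiplicity_sum[OF finite_eigenvalues]) auto
  have less: "eigenvalue_count ?g \<mu> < ?k" if "\<mu> < 2" for \<mu>
  proof -
    have "multiplicity ?g 2 + eigenvalue_count ?g \<mu>
        = (\<Sum>\<nu>\<in>insert 2 {\<nu>. is_eigenvalue ?g \<nu> \<and> \<nu> \<le> \<mu>}. multiplicity ?g \<nu>)"
      unfolding eigenvalue_count_def using that
      by (intro sum.insert[symmetric] finite_subset[OF _ finite_eigenvalues]) auto
    also have "\<dots> \<le> ?k"
      unfolding eigenvalue_count_def using that 2 by (intro sum_mono2 finite_eigenvalues) auto
    finally show ?thesis using multiplicity_pos[OF _ 2] by simp
  qed
  have k1: "?k \<ge> 1" using less[of 0] by simp
  have ev: "eigenvalue ?g ?k = 2"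
    unfolding eigenvalue_def
  proof (rule Least_equality)
    fix \<mu> assume "?k \<le> eigenvalue_count ?g \<mu>"
    then show "2 \<le> \<mu>" using less[of \<mu>] by (cases "\<mu> < 2") auto
  qed simp
  show "\<exists>k\<ge>1. eigenvalue ?g k = 2" using k1 ev by blast
  have "labelling ?g 2 \<le> ?k"
    unfolding labelling_def using k1 ev by (intro Least_le) simp
  with k4 show "labelling ?g 2 \<le> 4" by simp
qed

end

section \<open>The oscillating perturbation\<close>

text \<open>A class of functions that vanish to infinite order at \<open>0\<close> and is closed under differentiation; the
  pair of polynomials in \<open>1 / r\<close> records the coefficients of sine and cosine.\<close>

definition flat_osc :: "real poly \<times> real poly \<Rightarrow> real \<Rightarrow> real" where
  "flat_osc PQ r = (if r > 0 then exp (- inverse r) *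
     (poly (fst PQ) (inverse r) * sin (inverse r) + poly (snd PQ) (inverse r) * cos (inverse r)) else 0)"

definition flat_step :: "real poly \<times> real poly \<Rightarrow> real poly \<times> real poly" where
  "flat_step PQ = (monom 1 2 * (fst PQ - pderiv (fst PQ) + snd PQ), monom 1 2 * (snd PQ - fst PQ - pderiv (snd PQ)))"

lemma poly_times_exp_tendsto_0:
  fixes P :: "real poly"
  shows "((\<lambda>v. exp (- v) * poly P v) \<longlongrightarrow> 0) at_top"
proof -
  have "((\<lambda>v. \<Sum>i\<le>degree P. coeff P i * (v ^ i / exp v)) \<longlongrightarrow> (\<Sum>i\<le>degree P. coeff P i * 0)) at_top"
    by (intro tendsto_sum tendsto_mult tendsto_const tendsto_power_div_exp_0)
  moreover have "(\<lambda>v. \<Sum>i\<le>degree P. coeff P i * (v ^ i / exp v)) = (\<lambda>v. exp (- v) * poly P v)"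
    by (simp add: fun_eq_iff poly_altdef sum_distrib_left exp_minus field_simps)
  ultimately show ?thesis by simp
qed

lemma flat_osc_derivative:
  "(flat_osc PQ has_real_derivative flat_osc (flat_step PQ) r) (at r)"
proof -
  consider "r > 0" | "r < 0" | "r = 0" by linarith
  then show ?thesis
  proof cases
    case 1
    let ?f = "\<lambda>r. exp (- inverse r) *
     (poly (fst PQ) (inverse r) * sin (inverse r) + poly (snd PQ) (inverse r) * cos (inverse r))"
    have p: "((\<lambda>r. poly P (inverse r)) has_real_derivative - (inverse r)\<^sup>2 * poly (pderiv P) (inverse r)) (at r)" for P
      using DERIV_chain2[OF poly_DERIV DERIV_inverse, of r P] 1 by (simp add: mult.commute power2_eq_square power_inverse numeral_2_eq_2)
    have i: "(inverse has_real_derivative - (inverse r)\<^sup>2) (at r)"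
      using DERIV_inverse[of r] 1 by (simp add: numeral_2_eq_2)
    have "(?f has_real_derivative flat_osc (flat_step PQ) r) (at r)"
      using 1 by (auto intro!: derivative_eq_intros p i simp: flat_osc_def flat_step_def poly_monom power2_eq_square algebra_simps)
    then show ?thesis
      by (rule has_field_derivative_transform_within_open[OF _ open_greaterThan[of 0]])
        (use 1 in \<open>auto simp: flat_osc_def\<close>)
  next
    case 2
    have "((\<lambda>_. 0) has_real_derivative flat_osc (flat_step PQ) r) (at r)"
      using 2 by (simp add: flat_osc_def)
    then show ?thesis
      by (rule has_field_derivative_transform_within_open[OF _ open_lessThan[of 0]])
        (use 2 in \<open>auto simp: flat_osc_def\<close>)
  next
    case 3
    have right: "((\<lambda>y. flat_osc PQ y / y) \<longlongrightarrow> 0) (at_right 0)"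
    proof (rule Lim_null_comparison)
      let ?b = "\<lambda>P v. \<bar>exp (- v) * poly (pCons 0 P) v\<bar>"
      have "((\<lambda>v. ?b (fst PQ) v + ?b (snd PQ) v) \<longlongrightarrow> 0 + 0) at_top"
        by (intro tendsto_add tendsto_rabs_zero poly_times_exp_tendsto_0)
      from filterlim_compose[OF this filterlim_inverse_at_top_right]
      show "((\<lambda>y. ?b (fst PQ) (inverse y) + ?b (snd PQ) (inverse y)) \<longlongrightarrow> 0) (at_right 0)" by simp
      have "norm (flat_osc PQ y / y) \<le> ?b (fst PQ) (inverse y) + ?b (snd PQ) (inverse y)" if y: "y > 0" for y
      proof -
        let ?v = "inverse y"
        have "flat_osc PQ y / y = exp (- ?v) * poly (pCons 0 (fst PQ)) ?v * sin ?v + exp (- ?v) * poly (pCons 0 (snd PQ)) ?v * cos ?v"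
          using y by (simp add: flat_osc_def field_simps)
        also have "\<bar>\<dots>\<bar> \<le> ?b (fst PQ) ?v * \<bar>sin ?v\<bar> + ?b (snd PQ) ?v * \<bar>cos ?v\<bar>"
          by (rule order_trans[OF abs_triangle_ineq]) (simp add: abs_mult)
        also have "\<dots> \<le> ?b (fst PQ) ?v * 1 + ?b (snd PQ) ?v * 1"
          by (intro add_mono mult_left_mono abs_sin_le_one abs_cos_le_one abs_ge_zero)
        finally show ?thesis by simp
      qed
      then show "\<forall>\<^sub>F y in at_right 0. norm (flat_osc PQ y / y) \<le> ?b (fst PQ) (inverse y) + ?b (snd PQ) (inverse y)"
        by (auto simp: eventually_at_right_field intro: exI[of _ 1])
    qed
    have left: "((\<lambda>y. flat_osc PQ y / y) \<longlongrightarrow> 0) (at_left 0)"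
    proof (rule tendsto_eventually)
      show "\<forall>\<^sub>F y in at_left 0. flat_osc PQ y / y = 0"
        by (auto simp: eventually_at_left_field flat_osc_def intro!: exI[of _ "-1"])
    qed
    from filterlim_split_at[OF left right] show ?thesis
      using 3 by (simp add: has_field_derivative_iff flat_osc_def)
  qed
qed

text \<open>The \<open>n\<close>-th derivative of \<open>exp (- 1 / r) sin (1 / r)\<close>, extended by \<open>0\<close> to \<open>r \<le> 0\<close>.\<close>

definition bump :: "nat \<Rightarrow> real \<Rightarrow> real" where
  "bump n = flat_osc ((flat_step ^^ n) (1, 0))"

lemma bump_derivative: "(bump n has_real_derivative bump (Suc n) r) (at r)"
  unfolding bump_def using flat_osc_derivative by simp

lemma bump_smooth: "smooth_on UNIV (bump n)"
  by (rule smooth_on_sequence) (rule bump_derivative)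

lemma bump_0: "bump 0 r = (if r > 0 then exp (- inverse r) * sin (inverse r) else 0)"
  by (simp add: bump_def flat_osc_def)

lemma prof_smooth:
  assumes "\<sigma> = 1 \<or> \<sigma> = -1"
  shows "smooth_on UNIV (\<lambda>u. prof_w (stereo \<sigma> u $ 3))" (is ?w)
    "smooth_on UNIV (\<lambda>u. prof_u (stereo \<sigma> u $ 3))"
    "smooth_on UNIV (\<lambda>u. prof_du (stereo \<sigma> u $ 3))"
    "smooth_on UNIV (\<lambda>u. prof_g (stereo \<sigma> u $ 3))"
proof -
  have z: "\<bar>stereo \<sigma> u $ 3\<bar> \<le> 1" for u
    using component_le_norm_cart[of "stereo \<sigma> u" 3] stereo_in_S2[OF assms, of u] by (simp add: S2_def)
  have "9 - 8 * (stereo \<sigma> u $ 3)\<^sup>2 \<noteq> 0" for u using prof_denom[OF z[of u]] by linarith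
  then show w: ?w unfolding prof_w_def by (intro smooth_intros)
  show "smooth_on UNIV (\<lambda>u. prof_u (stereo \<sigma> u $ 3))"
    unfolding prof_u_def by (intro smooth_intros w) simp
  show "smooth_on UNIV (\<lambda>u. prof_du (stereo \<sigma> u $ 3))"
    unfolding prof_du_def by (intro smooth_intros w) simp
  have "20 - v + 6 * v\<^sup>2 \<noteq> 0" for v :: real using prof_quadratic_pos[of v] by linarith
  then show "smooth_on UNIV (\<lambda>u. prof_g (stereo \<sigma> u $ 3))"
    unfolding prof_g_def prof_cubic_def by (intro smooth_intros w)
qed

lemma S2_nth_bound: "x \<in> S2 \<Longrightarrow> \<bar>x $ k\<bar> \<le> 1"
  using component_le_norm_cart[of x k] by (simp add: S2_def)

definition prof_ddu :: "real \<Rightarrow> real" where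
  "prof_ddu z = deriv prof_du z"

lemma prof_ddu:
  assumes z: "\<bar>z\<bar> \<le> 1"
  shows "(prof_du has_real_derivative prof_ddu z) (at z)"
    "(1 - z\<^sup>2) * prof_ddu z - 2 * z * prof_du z = - prof_g z * prof_u z"
proof -
  have w: "prof_w differentiable (at z)"
    using prof_w_derivative[OF z] by (auto simp: real_differentiable_def)
  have "prof_du differentiable (at z)"
    unfolding prof_du_def[abs_def] by (intro derivative_intros w) auto
  then show d: "(prof_du has_real_derivative prof_ddu z) (at z)"
    unfolding prof_ddu_def real_differentiable_def by (auto intro: has_real_derivative_deriv)
  have "((\<lambda>z. (1 - z\<^sup>2) * prof_du z) has_real_derivative (1 - z\<^sup>2) * prof_ddu z - 2 * z * prof_du z) (at z)"
    by (auto intro!: derivative_eq_intros d)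
  then show "(1 - z\<^sup>2) * prof_ddu z - 2 * z * prof_du z = - prof_g z * prof_u z"
    using prof_ode[OF z] by (rule DERIV_unique)
qed

lemma differentiable_compose_real:
  fixes F :: "real^'n \<Rightarrow> real"
  assumes "(h has_real_derivative h') (at (F u))" "F differentiable (at u)"
  shows "(\<lambda>u. h (F u)) differentiable (at u)"
  using diff_chain_at[OF partial_of_differentiable[OF assms(2)], of h] assms(1)
  by (auto simp: has_field_derivative_def o_def differentiable_def)

text \<open>The round Laplacian of a product of a function of the height and a function of the first coordinate,
  from the gradients and Laplacians of the two coordinate functions.\<close>

lemma laplacian2_separated:
  assumes \<sigma>: "\<sigma> = 1 \<or> \<sigma> = -1"
    and A: "\<And>z. \<bar>z\<bar> \<le> 1 \<Longrightarrow> (A has_real_derivative A' z) (at z)" "\<And>z. \<bar>z\<bar> \<le> 1 \<Longrightarrow> (A' has_real_derivative A'' z) (at z)"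
    and B: "\<And>x. (B has_real_derivative B' x) (at x)" "\<And>x. (B' has_real_derivative B'' x) (at x)"
  defines "X \<equiv> \<lambda>u. stereo \<sigma> u $ 1" and "Z \<equiv> \<lambda>u. stereo \<sigma> u $ 3"
  shows "laplacian2 (\<lambda>u. A (Z u) * B (X u)) u = 4 / (stereo_denom u)\<^sup>2 *
    (B (X u) * ((1 - (Z u)\<^sup>2) * A'' (Z u) - 2 * Z u * A' (Z u)) - 2 * A' (Z u) * B' (X u) * X u * Z u
      + A (Z u) * ((1 - (X u)\<^sup>2) * B'' (X u) - 2 * X u * B' (X u)))" (is "_ = ?R")
proof -
  have z: "\<bar>Z u\<bar> \<le> 1" for u
    unfolding Z_def by (rule S2_nth_bound[OF stereo_in_S2[OF \<sigma>]])
  have sm: "smooth_on UNIV X" "smooth_on UNIV Z" unfolding X_def Z_def by (rule smooth_intros)+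
  note d = smooth_on_differentiable[OF sm(1)] smooth_on_differentiable[OF sm(2)]
    smooth_on_differentiable[OF smooth_on_partial[OF sm(1)]] smooth_on_differentiable[OF smooth_on_partial[OF sm(2)]]
  have dA: "(\<lambda>u. A (Z u)) differentiable (at u)" "partial i (\<lambda>u. A (Z u)) u = A' (Z u) * partial i Z u"
    and dA': "(\<lambda>u. A' (Z u)) differentiable (at u)" "partial i (\<lambda>u. A' (Z u)) u = A'' (Z u) * partial i Z u"
    and dB: "(\<lambda>u. B (X u)) differentiable (at u)" "partial i (\<lambda>u. B (X u)) u = B' (X u) * partial i X u"
    and dB': "(\<lambda>u. B' (X u)) differentiable (at u)" "partial i (\<lambda>u. B' (X u)) u = B'' (X u) * partial i X u" for u i
    using differentiable_compose_real[OF A(1)[OF z] d(2)] partial_compose_real[OF A(1)[OF z] d(2)]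
      differentiable_compose_real[OF A(2)[OF z] d(2)] partial_compose_real[OF A(2)[OF z] d(2)]
      differentiable_compose_real[OF B(1) d(1)] partial_compose_real[OF B(1) d(1)]
      differentiable_compose_real[OF B(2) d(1)] partial_compose_real[OF B(2) d(1)] by auto
  have 1: "partial i (\<lambda>u. A (Z u) * B (X u))
      = (\<lambda>u. (A' (Z u) * partial i Z u) * B (X u) + A (Z u) * (B' (X u) * partial i X u))" for i
    by (simp add: fun_eq_iff partial_mult dA dB)
  have 2: "partial i (partial i (\<lambda>u. A (Z u) * B (X u))) u
    = (A'' (Z u) * (partial i Z u)\<^sup>2 + A' (Z u) * partial i (partial i Z) u) * B (X u)
      + 2 * A' (Z u) * B' (X u) * (partial i X u * partial i Z u)
      + A (Z u) * (B'' (X u) * (partial i X u)\<^sup>2 + B' (X u) * partial i (partial i X) u)" for i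
    unfolding 1
    by (simp add: partial_add partial_mult dA dB dA' dB' d differentiable_mult power2_eq_square algebra_simps)
  have "laplacian2 (\<lambda>u. A (Z u) * B (X u)) u
    = (A'' (Z u) * ((partial 1 Z u)\<^sup>2 + (partial 2 Z u)\<^sup>2) + A' (Z u) * laplacian2 Z u) * B (X u)
      + 2 * A' (Z u) * B' (X u) * (partial 1 X u * partial 1 Z u + partial 2 X u * partial 2 Z u)
      + A (Z u) * (B'' (X u) * ((partial 1 X u)\<^sup>2 + (partial 2 X u)\<^sup>2) + B' (X u) * laplacian2 X u)"
    unfolding laplacian2_def 2 by (simp add: algebra_simps)
  also have "\<dots> = ?R"
    unfolding X_def Z_def stereo_gradients[OF \<sigma>] laplacian2_stereo_nth
    by (simp add: algebra_simps diff_divide_distrib add_divide_distrib)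
  finally show ?thesis .
qed

abbreviation "u_at x \<equiv> prof_u (x $ 3)" for x :: "real^3"
abbreviation "h_at x \<equiv> bump 0 (x $ 1)" for x :: "real^3"

text \<open>The quotient of \<open>- \<Delta>\<^sub>0 (u\<^sup>3 h)\<close> by \<open>u\<close>.\<close>

definition remainder :: "real \<Rightarrow> real \<Rightarrow> real" where
  "remainder z x = 3 * prof_g z * (prof_u z)\<^sup>2 * bump 0 x - 6 * (1 - z\<^sup>2) * (prof_du z)\<^sup>2 * bump 0 x
    + 6 * x * z * prof_u z * prof_du z * bump 1 x
    - (prof_u z)\<^sup>2 * ((1 - x\<^sup>2) * bump 2 x - 2 * x * bump 1 x)"

definition Phi :: "real \<Rightarrow> real^3 \<Rightarrow> real" where
  "Phi \<epsilon> x = u_at x + \<epsilon> * ((u_at x)^3 * h_at x)"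

definition Weight :: "real \<Rightarrow> real^3 \<Rightarrow> real" where
  "Weight \<epsilon> x = (prof_g (x $ 3) + \<epsilon> * remainder (x $ 3) (x $ 1)) / (2 * (1 + \<epsilon> * ((u_at x)\<^sup>2 * h_at x)))"

lemma bump_stereo_smooth: "smooth_on UNIV (\<lambda>u. bump n (stereo \<sigma> u $ k))"
  by (intro smooth_on_compose_real[OF bump_smooth] smooth_intros)

lemma Phi_smooth: "smooth_on_S2 (Phi \<epsilon>)"
  unfolding smooth_on_S2_def
proof
  fix \<sigma> :: real assume "\<sigma> \<in> {1, -1}"
  then have \<sigma>: "\<sigma> = 1 \<or> \<sigma> = -1" by auto
  show "smooth_on UNIV (Phi \<epsilon> \<circ> stereo \<sigma>)"
    unfolding Phi_def o_def by (intro smooth_intros prof_smooth[OF \<sigma>] bump_stereo_smooth)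
qed

lemma Weight_smooth:
  assumes "\<And>x. x \<in> S2 \<Longrightarrow> 1 + \<epsilon> * ((u_at x)\<^sup>2 * h_at x) \<noteq> 0"
  shows "smooth_on_S2 (Weight \<epsilon>)"
  unfolding smooth_on_S2_def
proof
  fix \<sigma> :: real assume "\<sigma> \<in> {1, -1}"
  then have \<sigma>: "\<sigma> = 1 \<or> \<sigma> = -1" by auto
  show "smooth_on UNIV (Weight \<epsilon> \<circ> stereo \<sigma>)"
    unfolding Weight_def o_def remainder_def
    by (intro smooth_intros prof_smooth[OF \<sigma>] bump_stereo_smooth) (use assms[OF stereo_in_S2[OF \<sigma>]] in \<open>simp only: mult_eq_0_iff, simp\<close>)
qed

lemma laplace_Phi:
  assumes x: "x \<in> S2"
  shows "- laplace_beltrami round_metric (Phi \<epsilon>) x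
    = u_at x * (prof_g (x $ 3) + \<epsilon> * remainder (x $ 3) (x $ 1))"
proof -
  define \<sigma> where "\<sigma> = chart_sign x"
  define v where "v = stereo_chart \<sigma> x"
  have \<sigma>: "\<sigma> = 1 \<or> \<sigma> = -1" unfolding \<sigma>_def by (rule chart_sign)
  have vx: "stereo \<sigma> v = x" unfolding v_def \<sigma>_def by (rule stereo_chart_sign[OF x])
  let ?z = "x $ 3" and ?x = "x $ 1"
  have z: "\<bar>?z\<bar> \<le> 1" by (rule S2_nth_bound[OF x])
  let ?A' = "\<lambda>z. 3 * (prof_u z)\<^sup>2 * prof_du z"
  let ?A'' = "\<lambda>z. 6 * prof_u z * (prof_du z)\<^sup>2 + 3 * (prof_u z)\<^sup>2 * prof_ddu z"
  have A: "((\<lambda>z. (prof_u z)^3) has_real_derivative ?A' z) (at z)" "(?A' has_real_derivative ?A'' z) (at z)" if "\<bar>z\<bar> \<le> 1" for z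
    by (auto intro!: derivative_eq_intros prof_u_derivative[OF that] prof_ddu(1)[OF that] simp: power2_eq_square)
  have B: "(bump 0 has_real_derivative bump 1 x) (at x)" "(bump 1 has_real_derivative bump 2 x) (at x)" for x
    using bump_derivative[of 0 x] bump_derivative[of 1 x] by (simp_all add: numeral_2_eq_2)
  note ode = prof_ddu(2)[OF z]
  have 1: "laplacian2 (\<lambda>u. prof_u (stereo \<sigma> u $ 3)) v = 4 / (stereo_denom v)\<^sup>2 * (- prof_g ?z * prof_u ?z)"
    using laplacian2_separated[OF \<sigma> prof_u_derivative prof_ddu(1), where B = "\<lambda>x. 1" and B' = "\<lambda>x. 0" and B'' = "\<lambda>x. 0" and u = v]
    by (simp add: vx ode)
  have 2: "laplacian2 (\<lambda>u. prof_u (stereo \<sigma> u $ 3) ^ 3 * bump 0 (stereo \<sigma> u $ 1)) v = 4 / (stereo_denom v)\<^sup>2 *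
    (bump 0 ?x * ((1 - ?z\<^sup>2) * ?A'' ?z - 2 * ?z * ?A' ?z) - 2 * ?A' ?z * bump 1 ?x * ?x * ?z
      + prof_u ?z ^ 3 * ((1 - ?x\<^sup>2) * bump 2 ?x - 2 * ?x * bump 1 ?x))"
    using laplacian2_separated[OF \<sigma> A B, where u = v] by (simp only: vx)
  have "(1 - ?z\<^sup>2) * ?A'' ?z - 2 * ?z * ?A' ?z
      = 3 * (prof_u ?z)\<^sup>2 * ((1 - ?z\<^sup>2) * prof_ddu ?z - 2 * ?z * prof_du ?z) + 6 * (1 - ?z\<^sup>2) * prof_u ?z * (prof_du ?z)\<^sup>2"
    by (simp add: algebra_simps)
  note 3 = this[unfolded ode]
  have s: "smooth_on UNIV (\<lambda>u. prof_u (stereo \<sigma> u $ 3))" 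
    "smooth_on UNIV (\<lambda>u. prof_u (stereo \<sigma> u $ 3) ^ 3 * bump 0 (stereo \<sigma> u $ 1))"
    by (intro smooth_intros prof_smooth[OF \<sigma>] bump_stereo_smooth)+
  have "laplacian2 (Phi \<epsilon> \<circ> stereo \<sigma>) v = laplacian2 (\<lambda>u. prof_u (stereo \<sigma> u $ 3)) v
      + \<epsilon> * laplacian2 (\<lambda>u. prof_u (stereo \<sigma> u $ 3) ^ 3 * bump 0 (stereo \<sigma> u $ 1)) v"
    using laplacian2_add[OF s(1) smooth_on_mult[OF smooth_on_const s(2)], of \<epsilon> v] laplacian2_cmult[OF s(2), of \<epsilon> v]
    by (simp add: Phi_def[abs_def] o_def)
  also have "\<dots> = - (4 / (stereo_denom v)\<^sup>2 * (u_at x * (prof_g (x $ 3) + \<epsilon> * remainder (x $ 3) (x $ 1))))"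
  proof -
    have alg: "c * (- g * u) + \<epsilon> * (c * (b0 * (3 * u\<^sup>2 * (- g * u) + 6 * (1 - zz\<^sup>2) * u * d\<^sup>2) - 2 * (3 * u\<^sup>2 * d) * b1 * xx * zz
        + u ^ 3 * ((1 - xx\<^sup>2) * b2 - 2 * xx * b1)))
      = - (c * (u * (g + \<epsilon> * (3 * g * u\<^sup>2 * b0 - 6 * (1 - zz\<^sup>2) * d\<^sup>2 * b0
         + 6 * xx * zz * u * d * b1 - u\<^sup>2 * ((1 - xx\<^sup>2) * b2 - 2 * xx * b1)))))" for c g u b0 b1 b2 d zz xx :: real
      by (simp add: power2_eq_square power3_eq_cube algebra_simps)
    show ?thesis unfolding 1 2 3 remainder_def by (rule alg)
  qed
  finally have "laplacian2 (Phi \<epsilon> \<circ> stereo \<sigma>) v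
    = - (4 / (stereo_denom v)\<^sup>2 * (u_at x * (prof_g (x $ 3) + \<epsilon> * remainder (x $ 3) (x $ 1))))" .
  then show ?thesis
    unfolding laplace_beltrami_round[OF x] \<sigma>_def[symmetric] v_def[symmetric] by simp
qed

text \<open>Compactness bounds the perturbation terms and keeps \<open>g\<close> away from \<open>0\<close>. The constant \<open>1/100\<close>
  suffices because \<open>(101/100) / (99/100) < 21/20\<close>.\<close>

lemma perturbation_bounds:
  obtains \<epsilon> :: real where "\<epsilon> > 0"
    "\<And>x. x \<in> S2 \<Longrightarrow> \<bar>\<epsilon> * remainder (x $ 3) (x $ 1)\<bar> \<le> prof_g (x $ 3) / 100"
    "\<And>x. x \<in> S2 \<Longrightarrow> \<bar>\<epsilon> * ((u_at x)\<^sup>2 * h_at x)\<bar> \<le> 1/100"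
proof -
  let ?I = "{-1..1::real}"
  have w: "continuous_on ?I prof_w"
    by (intro continuous_at_imp_continuous_on ballI DERIV_isCont[OF prof_w_derivative]) auto
  have g: "continuous_on ?I prof_g"
  proof -
    have "20 - v + 6 * v\<^sup>2 \<noteq> 0" for v :: real using prof_quadratic_pos[of v] by linarith
    then show ?thesis
      unfolding prof_g_def[abs_def] prof_cubic_def by (intro continuous_intros w) auto
  qed
  have u: "continuous_on ?I prof_u" "continuous_on ?I prof_du"
    unfolding prof_u_def[abs_def] prof_du_def[abs_def] by (intro continuous_intros w; simp)+
  have b: "continuous_on ?I (bump n)" for n
    using bump_smooth by (rule smooth_on_continuous)
  have *: "continuous_on (?I \<times> ?I) (\<lambda>p. F (fst p))" "continuous_on (?I \<times> ?I) (\<lambda>p. F (snd p))"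
    if "continuous_on ?I F" for F :: "real \<Rightarrow> real"
    by (auto intro!: continuous_on_compose2[OF that] continuous_intros)
  have "continuous_on (?I \<times> ?I) (\<lambda>p. remainder (fst p) (snd p))"
    unfolding remainder_def by (intro continuous_intros *[OF g] *[OF u(1)] *[OF u(2)] *[OF b])
  then have "bounded ((\<lambda>p. remainder (fst p) (snd p)) ` (?I \<times> ?I))"
    by (intro compact_imp_bounded compact_continuous_image compact_Times compact_Icc)
  then obtain M1 where M1: "\<And>z x. z \<in> ?I \<Longrightarrow> x \<in> ?I \<Longrightarrow> \<bar>remainder z x\<bar> \<le> M1"
    by (force simp: bounded_iff)
  have "continuous_on (?I \<times> ?I) (\<lambda>p. (prof_u (fst p))\<^sup>2 * bump 0 (snd p))"
    by (intro continuous_intros *[OF u(1)] *[OF b])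
  then have "bounded ((\<lambda>p. (prof_u (fst p))\<^sup>2 * bump 0 (snd p)) ` (?I \<times> ?I))"
    by (intro compact_imp_bounded compact_continuous_image compact_Times compact_Icc)
  then obtain M2 where M2: "\<And>z x. z \<in> ?I \<Longrightarrow> x \<in> ?I \<Longrightarrow> \<bar>(prof_u z)\<^sup>2 * bump 0 x\<bar> \<le> M2"
    by (force simp: bounded_iff)
  obtain z0 where z0: "z0 \<in> ?I" "\<And>z. z \<in> ?I \<Longrightarrow> prof_g z0 \<le> prof_g z"
    using continuous_attains_inf[OF compact_Icc _ g] by auto
  define m where "m = prof_g z0"
  have m: "m > 0" unfolding m_def using z0 by (intro prof_g_pos) auto
  \<comment> \<open>One bound for both perturbation terms; the summand \<open>1\<close> makes division by \<open>M\<close> safe.\<close>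
  define M where "M = 1 + \<bar>M1\<bar> + \<bar>M2\<bar>"
  define \<epsilon> where "\<epsilon> = min m 1 / (100 * M)"
  have M: "M \<ge> 1" by (simp add: M_def)
  have \<epsilon>: "\<epsilon> > 0" using m M by (simp add: \<epsilon>_def)
  have \<epsilon>M: "\<epsilon> * M = min m 1 / 100" using M by (simp add: \<epsilon>_def)
  show thesis
  proof (rule that[OF \<epsilon>])
    fix x :: "real^3" assume x: "x \<in> S2"
    have I: "x $ 3 \<in> ?I" "x $ 1 \<in> ?I" using S2_nth_bound[OF x] by (auto simp: abs_le_iff)
    have "\<bar>\<epsilon> * remainder (x $ 3) (x $ 1)\<bar> \<le> \<epsilon> * M"
      using M1[OF I] \<epsilon> by (auto simp: abs_mult M_def intro!: mult_left_mono)
    also have "\<dots> \<le> prof_g (x $ 3) / 100" using z0(2)[OF I(1)] by (simp add: \<epsilon>M m_def)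
    finally show "\<bar>\<epsilon> * remainder (x $ 3) (x $ 1)\<bar> \<le> prof_g (x $ 3) / 100" .
    have "\<bar>\<epsilon> * ((u_at x)\<^sup>2 * h_at x)\<bar> \<le> \<epsilon> * M"
      using M2[OF I] \<epsilon> by (auto simp: abs_mult[of \<epsilon>] M_def intro!: mult_left_mono)
    also have "\<dots> \<le> 1/100" by (simp add: \<epsilon>M)
    finally show "\<bar>\<epsilon> * ((u_at x)\<^sup>2 * h_at x)\<bar> \<le> 1/100" .
  qed
qed

text \<open>Where \<open>h \<le> 0\<close> the perturbation can only lower a positive \<open>u \<le> 1\<close>, and it does not change the sign of
  \<open>u\<close>; so \<open>\<Phi> > 1\<close> forces \<open>h > 0\<close>. The points \<open>p n\<close> of the equator have first coordinates \<open>r n\<close> with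
  \<open>sin (1 / r n) = 1\<close>, and between two of them there is some \<open>q m\<close> with \<open>sin (1 / q m) = - 1\<close>. The first
  coordinate maps a connected set to an interval, so no component contains two of the points.\<close>

lemma infinite_components:
  assumes \<epsilon>: "\<epsilon> > 0" and small: "\<And>x. x \<in> S2 \<Longrightarrow> 1 + \<epsilon> * ((u_at x)\<^sup>2 * h_at x) \<ge> 0"
  shows "infinite (components {x \<in> S2. Phi \<epsilon> x > 1})"
proof -
  let ?C = "{x \<in> S2. Phi \<epsilon> x > 1}"
  have pos: "h_at x > 0" if "x \<in> ?C" for x
  proof (rule ccontr)
    assume "\<not> h_at x > 0"
    then have h: "h_at x \<le> 0" by simp
    have x: "x \<in> S2" and gt: "Phi \<epsilon> x > 1" using that by auto
    show False
    proof (cases "u_at x > 0")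
      case True
      then have "\<epsilon> * ((u_at x)^3 * h_at x) \<le> 0"
        using \<epsilon> h by (intro mult_nonneg_nonpos) auto
      then show False using gt prof_u_upper[OF S2_nth_bound[OF x, of 3]] by (simp add: Phi_def)
    next
      case False
      have "Phi \<epsilon> x = u_at x * (1 + \<epsilon> * ((u_at x)\<^sup>2 * h_at x))"
        by (simp add: Phi_def power2_eq_square power3_eq_cube algebra_simps)
      also have "\<dots> \<le> 0" using False small[OF x] by (intro mult_nonpos_nonneg) auto
      finally show False using gt by simp
    qed
  qed
  define r where "r n = 1 / (pi / 2 + of_nat (2 * n) * pi)" for n :: nat
  define q where "q n = 1 / (3 * pi / 2 + of_nat (2 * n) * pi)" for n :: nat
  have den: "pi / 2 + of_nat (2 * n) * pi \<ge> pi / 2" for n by simp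
  have r: "0 < r n" "r n \<le> 1" for n
  proof -
    have "pi / 2 > 1" using pi_gt3 by simp
    then have "pi / 2 + of_nat (2 * n) * pi > 1" using den[of n] by linarith
    moreover have "0 < 1 / d \<and> 1 / d \<le> 1" if "d > 1" for d :: real using that by simp
    ultimately show "0 < r n" "r n \<le> 1" unfolding r_def by blast+
  qed
  have q0: "0 < q n" for n
    unfolding q_def using pi_gt_zero by (intro divide_pos_pos add_pos_nonneg) auto
  have hr: "bump 0 (r n) > 0" for n
  proof -
    have "sin (inverse (r n)) = sin (pi / 2 + 2 * real n * pi)" by (simp add: r_def)
    also have "\<dots> = 1" by (simp only: sin_add cos_2npi sin_2npi) simp
    finally show ?thesis using r[of n] by (simp add: bump_0)
  qed
  have hq: "bump 0 (q n) < 0" for n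
  proof -
    have "sin (inverse (q n)) = sin (3 / 2 * pi + 2 * real n * pi)" by (simp add: q_def)
    also have "\<dots> = - 1" by (simp only: sin_add cos_2npi sin_2npi sin_3over2_pi)
    finally show ?thesis using q0[of n] by (simp add: bump_0)
  qed
  define p where "p n = (vector [r n, sqrt (1 - (r n)\<^sup>2), 0] :: real^3)" for n
  have pC: "p n \<in> ?C" for n
  proof -
    have "(r n)\<^sup>2 \<le> 1" using r[of n] by (simp add: abs_square_le_1)
    then have "p n \<in> S2"
      by (simp add: p_def S2_def norm_eq_1 inner_vec_def sum_3 power2_eq_square)
    moreover have "Phi \<epsilon> (p n) > 1" using \<epsilon> hr[of n] by (simp add: Phi_def p_def)
    ultimately show ?thesis by simp
  qed
  have sep: "connected_component_set ?C (p m) \<noteq> connected_component_set ?C (p n)" if "m < n" for m n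
  proof
    let ?K = "connected_component_set ?C (p m)"
    assume eq: "?K = connected_component_set ?C (p n)"
    have in_K: "p m \<in> ?K" "p n \<in> ?K"
      using pC eq by (auto intro: connected_component_refl)
    have "connected ((\<lambda>x. x $ 1) ` ?K)"
      by (intro connected_continuous_image continuous_intros connected_connected_component)
    moreover have "r n \<in> (\<lambda>x. x $ 1) ` ?K" "r m \<in> (\<lambda>x. x $ 1) ` ?K"
      using imageI[OF in_K(2), of "\<lambda>x. x $ 1"] imageI[OF in_K(1), of "\<lambda>x. x $ 1"] by (simp_all add: p_def)
    ultimately have "{r n..r m} \<subseteq> (\<lambda>x. x $ 1) ` ?K"
      by (intro connected_contains_Icc)
    moreover have "q m \<in> {r n..r m}"
    proof -
      have inv: "1 / a \<le> 1 / b" if "0 < b" "b \<le> a" for a b :: real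
        using that by (simp add: frac_le)
      have "q m \<le> r m"
        unfolding q_def r_def
      proof (rule inv)
        show "0 < pi / 2 + of_nat (2 * m) * pi" using den[of m] pi_half_gt_zero by (rule less_le_trans[rotated])
        show "pi / 2 + of_nat (2 * m) * pi \<le> 3 * pi / 2 + of_nat (2 * m) * pi" by simp
      qed
      moreover have "3 * pi / 2 + of_nat (2 * m) * pi \<le> pi / 2 + of_nat (2 * n) * pi"
      proof -
        have "2 * m + 1 \<le> 2 * n" using that by simp
        then have "real (2 * m + 1) \<le> real (2 * n)" by (subst of_nat_le_iff)
        then have "real (2 * m + 1) * pi \<le> real (2 * n) * pi" by (rule mult_right_mono) simp
        then show ?thesis by (simp add: distrib_right)
      qed
      then have "r n \<le> q m"
        unfolding q_def r_def
      proof (rule inv[rotated])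
        have "0 < 3 * pi / 2" "0 \<le> of_nat (2 * m) * pi" by simp_all
        then show "0 < 3 * pi / 2 + of_nat (2 * m) * pi" by (rule add_pos_nonneg)
      qed
      ultimately show ?thesis by simp
    qed
    ultimately obtain y where y: "y \<in> ?K" "y $ 1 = q m" by auto
    then have "y \<in> ?C" using connected_component_subset by blast
    then show False using pos[of y] hq[of m] y by simp
  qed
  then have "inj (\<lambda>n. connected_component_set ?C (p n))"
    by (rule linorder_injI)
  then have "infinite (range (\<lambda>n. connected_component_set ?C (p n)))"
    by (rule range_inj_infinite)
  moreover have "range (\<lambda>n. connected_component_set ?C (p n)) \<subseteq> components ?C"
    using pC by (auto simp: components_def)
  ultimately show ?thesis using finite_subset by blast
qed

theorem proposition5p1:
  shows "\<exists>(\<Phi> :: real ^ 3 \<Rightarrow> real) (G :: real ^ 3 \<Rightarrow> real).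
    smooth_on_S2 \<Phi> \<and> smooth_on_S2 G \<and>
    infinite (components {x \<in> S2. \<Phi> x > 1}) \<and>
    (\<forall>x\<in>S2. G x > 0) \<and>
    riemannian_metric (conformal_metric G) \<and>
    (\<forall>f. smooth_on_S2 f \<longrightarrow> (\<forall>x\<in>S2.
      laplace_beltrami (conformal_metric G) f x = inverse (G x) * laplace_beltrami round_metric f x)) \<and>
    (\<forall>x\<in>S2. - laplace_beltrami (conformal_metric G) \<Phi> x = 2 * \<Phi> x) \<and>
    is_eigenvalue (conformal_metric G) 2 \<and>
    (\<exists>k\<ge>1. eigenvalue (conformal_metric G) k = 2) \<and>
    labelling (conformal_metric G) 2 \<le> 4"
proof -
  obtain \<epsilon> :: real where \<epsilon>: "\<epsilon> > 0"
    and rem: "\<And>x. x \<in> S2 \<Longrightarrow> \<bar>\<epsilon> * remainder (x $ 3) (x $ 1)\<bar> \<le> prof_g (x $ 3) / 100"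
    and fac: "\<And>x. x \<in> S2 \<Longrightarrow> \<bar>\<epsilon> * ((u_at x)\<^sup>2 * h_at x)\<bar> \<le> 1/100"
    using perturbation_bounds by blast
  let ?\<Phi> = "Phi \<epsilon>" and ?G = "Weight \<epsilon>"
  have g: "prof_g (x $ 3) > 0" if "x \<in> S2" for x
    by (rule prof_g_pos[OF S2_nth_bound[OF that]])
  have fac': "1 + \<epsilon> * ((u_at x)\<^sup>2 * h_at x) \<ge> 99/100" if "x \<in> S2" for x
    using fac[OF that] by (simp add: abs_le_iff)
  have num: "prof_g (x $ 3) + \<epsilon> * remainder (x $ 3) (x $ 1) > 0"
    "prof_g (x $ 3) + \<epsilon> * remainder (x $ 3) (x $ 1) \<le> 101/100 * prof_g (x $ 3)" if "x \<in> S2" for x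
    using rem[OF that] g[OF that] by (auto simp: abs_le_iff)
  have G_smooth: "smooth_on_S2 ?G"
    by (rule Weight_smooth) (use fac' in force)
  have G_pos: "?G x > 0" if "x \<in> S2" for x
    unfolding Weight_def using num(1)[OF that] fac'[OF that] by (intro divide_pos_pos) auto
  interpret weighted_sphere ?G
  proof
    fix x :: "real^3" assume x: "x \<in> S2"
    let ?f = "1 + \<epsilon> * ((u_at x)\<^sup>2 * h_at x)"
    have f: "?f > 0" using fac'[OF x] by linarith
    have "2 * ?G x = (prof_g (x $ 3) + \<epsilon> * remainder (x $ 3) (x $ 1)) / ?f"
    proof -
      have "2 * (a / (2 * b)) = a / b" for a b :: real by simp
      then show ?thesis unfolding Weight_def .
    qed
    also have "\<dots> < 21/20 * prof_g (x $ 3)"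
    proof -
      have "21/20 * prof_g (x $ 3) * (99/100) \<le> 21/20 * prof_g (x $ 3) * ?f"
        using fac'[OF x] g[OF x] by (intro mult_left_mono) auto
      then have "prof_g (x $ 3) + \<epsilon> * remainder (x $ 3) (x $ 1) < 21/20 * prof_g (x $ 3) * ?f"
        using num(2)[OF x] g[OF x] by linarith
      then show ?thesis using f by (simp only: pos_divide_less_eq)
    qed
    finally show "2 * ?G x < 21/20 * prof_g (x $ 3)" .
  qed (use G_smooth G_pos in auto)
  have conf: "laplace_beltrami (conformal_metric ?G) f x = inverse (?G x) * laplace_beltrami round_metric f x"
    if "x \<in> S2" for f x
    by (rule laplace_beltrami_conformal_round[OF that G_pos])
  have eq: "- laplace_beltrami round_metric ?\<Phi> x = 2 * ?G x * ?\<Phi> x" if x: "x \<in> S2" for x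
  proof -
    let ?f = "1 + \<epsilon> * ((u_at x)\<^sup>2 * h_at x)"
    have f: "?f \<noteq> 0" using fac'[OF x] by linarith
    have "?\<Phi> x = u_at x * ?f" by (simp add: Phi_def power2_eq_square power3_eq_cube algebra_simps)
    moreover have "2 * (a / (2 * b)) * (u * b) = u * a" if "b \<noteq> 0" for a b u :: real
      using that by simp
    ultimately have "2 * ?G x * ?\<Phi> x = u_at x * (prof_g (x $ 3) + \<epsilon> * remainder (x $ 3) (x $ 1))"
      unfolding Weight_def using f by metis
    then show ?thesis by (simp add: laplace_Phi[OF x])
  qed
  have eq': "- laplace_beltrami (conformal_metric ?G) ?\<Phi> x = 2 * ?\<Phi> x" if x: "x \<in> S2" for x
  proof -
    have "- laplace_beltrami (conformal_metric ?G) ?\<Phi> x = inverse (?G x) * (2 * ?G x * ?\<Phi> x)"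
      by (simp add: conf[OF x] flip: eq[OF x])
    then show ?thesis using G_pos[OF x] by simp
  qed
  have ev: "is_eigenvalue (conformal_metric ?G) 2"
    unfolding is_eigenvalue_def
  proof (rule bexI)
    \<comment> \<open>Members of an eigenspace are normalized to vanish off the sphere.\<close>
    let ?F = "\<lambda>x. if x \<in> S2 then ?\<Phi> x else 0"
    have comp: "?F \<circ> stereo \<sigma> = ?\<Phi> \<circ> stereo \<sigma>" if "\<sigma> = 1 \<or> \<sigma> = -1" for \<sigma>
      using stereo_in_S2[OF that] by (simp add: fun_eq_iff)
    have "smooth_on_S2 ?F" using Phi_smooth[of \<epsilon>] comp by (simp add: smooth_on_S2_iff)
    moreover have "laplace_beltrami round_metric ?F x = laplace_beltrami round_metric ?\<Phi> x" if "x \<in> S2" for x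
      unfolding laplace_beltrami_round[OF that] comp[OF chart_sign] ..
    ultimately show "?F \<in> E 2" using eq by (auto simp: E_iff)
    have a: "axis 1 (- 1) \<in> S2" by (simp add: S2_def norm_eq_1 inner_vec_def sum_3 axis_def)
    have b: "?\<Phi> (axis 1 (- 1)) = 1" by (simp add: Phi_def axis_def bump_0)
    show "?F \<noteq> 0"
    proof
      assume "?F = 0"
      then have "?F (axis 1 (- 1)) = 0 (axis 1 (- 1) :: real^3)" by (rule fun_cong)
      then show False using a b by simp
    qed
  qed
  show ?thesis
  proof (rule exI[of _ ?\<Phi>], rule exI[of _ ?G], intro conjI)
    show "infinite (components {x \<in> S2. ?\<Phi> x > 1})"
      by (rule infinite_components[OF \<epsilon>]) (use fac' in force)
    show "\<forall>x\<in>S2. ?G x > 0" using G_pos by blast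
    show "riemannian_metric (conformal_metric ?G)"
      by (rule riemannian_metric_conformal[OF G_smooth G_pos])
    show "\<forall>f. smooth_on_S2 f \<longrightarrow> (\<forall>x\<in>S2.
        laplace_beltrami (conformal_metric ?G) f x = inverse (?G x) * laplace_beltrami round_metric f x)"
      using conf by blast
    show "\<forall>x\<in>S2. - laplace_beltrami (conformal_metric ?G) ?\<Phi> x = 2 * ?\<Phi> x"
      using eq' by blast
  qed (rule Phi_smooth G_smooth ev labelling_le_4[OF ev])+
qed

end
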